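(* Let $\mathcal H$ be a finitely generated, torsion-free, $2$-step nilpotent group with $[\mathcal H,\mathcal H]=\langle z\rangle\simeq\mathbb Z$, and let $S$ be a finite symmetric generating set. Let $\gamma_1,\gamma_2\in\mathrm{Geo}(\mathcal H,S)$ be two infinite geodesic words. (a) If $b_{\gamma_1}=b_{\gamma_2}$, then $\mathrm F_{\gamma_1}=\mathrm F_{\gamma_2}$. Moreover, if this face is commutative, then $\mathrm E_{\gamma_1}=\mathrm E_{\gamma_2}$. (b) Conversely, suppose that $\mathrm F:=\mathrm F_{\gamma_1}=\mathrm F_{\gamma_2}$ and that either (1) $\mathrm F$ is commutative, $\mathrm E:=\mathrm E_{\gamma_1}=\mathrm E_{\gamma_2}$, and all the letters of $\gamma_1$ and $\gamma_2$ belong to $\mathrm E$; or (2) $\mathrm F$ is non-commutative, and all the letters of $\gamma_1$ and $\gamma_2$ project into $\mathrm F$ under $\Pr$. Then $b_{\gamma_1}=b_{\gamma_2}$. (c) The Busemann points $b_{\gamma_1},b_{\gamma_2}$ are in the same $\mathcal H$-orbit if and only if either (1) $\mathrm F_{\gamma_1}=\mathrm F_{\gamma_2}$ is commutative and $\mathrm E_{\gamma_1}=\mathrm E_{\gamma_2}$; or (2) $\mathrm F_{\gamma_1}=\mathrm F_{\gamma_2}$ is non-commutative. In particular, $\partial(\mathcal H,d_S)$ contains only finitely many orbits of Busemann points, hence countably many Busemann points.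
   Context: Horofunctions. For a group $G$ with finite symmetric generating set $S$ and word metric $d_S$, put $\varphi_g(\ast)=d_S(g,\ast)-d_S(g,e)$ for $g\in G$ and $\iota(g)=\varphi_g$, in the space of functions $G\to\mathbb R$ with pointwise convergence. The horofunction boundary is $\partial(G,d_S)=\overline{\iota(G)}\setminus\iota(G)$. $G$ acts on it by $(g\cdot\varphi)(x)=\varphi(g^{-1}x)-\varphi(g^{-1})$. $\mathrm{Geo}(G,S)$ is the set of infinite words $\gamma=s_1s_2\cdots\in S^\infty$ such that each prefix $\gamma_n=s_1\cdots s_n$ represents an element $\bar\gamma_n\in G$ of word length exactly $n$. The associated Busemann point is $b_\gamma=\lim_n\varphi_{\bar\gamma_n}\in\partial(G,d_S)$; every Busemann point (limit of a geodesic ray) arises in this way. Faces. $\mathcal H_{\mathbb R}$ denotes the real Malcev completion of $\mathcal H$, a simply connected nilpotent Lie group identified with its Lie algebra (a real vector space) via the exponential map. $\mathrm B\subset\mathcal H_{\mathbb R}$ is the convex hull of $S$ in this vector space. $\Pr:\mathcal H_{\mathbb R}\to\mathcal H_{\mathbb R}/[\mathcal H_{\mathbb R},\mathcal H_{\mathbb R}]\simeq\mathbb R^d$ is the abelianization map (linear in these coordinates), so $\Pr(\mathrm B)$ is the convex hull of $\Pr(S)$. For $\gamma\in\mathrm{Geo}(\mathcal H,S)$: $D_\gamma\subseteq S$ is the set of letters occurring infinitely often in $\gamma$; $\mathrm E_\gamma$ is the minimal face of the polytope $\mathrm B$ containing $D_\gamma$; $\mathrm F_\gamma$ is the minimal face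 of the polytope $\Pr(\mathrm B)$ containing $\Pr(D_\gamma)$ (it is a proper face). A face $\mathrm F\subset\Pr(\mathrm B)$ is commutative if the subgroup $\langle\Pr^{-1}(\mathrm F)\rangle\le\mathcal H_{\mathbb R}$ is abelian. *)

theory Defs
  imports
    "HOL-Algebra.Generated_Groups"
    "HOL-Algebra.Elementary_Groups"
    "HOL-Algebra.Group_Action"
    "HOL-Analysis.Analysis"
begin

section \<open>Nilpotent groups\<close>

fun lower_central :: "('a, 'b) monoid_scheme \<Rightarrow> nat \<Rightarrow> 'a set" where
  "lower_central G 0 = carrier G"
| "lower_central G (Suc n) =
     generate G (\<Union>x\<in>lower_central G n. \<Union>y\<in>carrier G.
       {x \<otimes>\<^bsub>G\<^esub> y \<otimes>\<^bsub>G\<^esub> inv\<^bsub>G\<^esub> x \<otimes>\<^bsub>G\<^esub> inv\<^bsub>G\<^esub> y})"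

text \<open>Nilpotent of class exactly \<open>n\<close>.\<close>

definition nilpotent_of_step :: "('a, 'b) monoid_scheme \<Rightarrow> nat \<Rightarrow> bool" where
  "nilpotent_of_step G n \<longleftrightarrow>
     group G \<and> lower_central G n = {\<one>\<^bsub>G\<^esub>} \<and> (\<forall>m<n. lower_central G m \<noteq> {\<one>\<^bsub>G\<^esub>})"

definition torsion_free :: "('a, 'b) monoid_scheme \<Rightarrow> bool" where
  "torsion_free G \<longleftrightarrow>
     (\<forall>x\<in>carrier G. \<forall>n::nat. 0 < n \<and> x [^]\<^bsub>G\<^esub> n = \<one>\<^bsub>G\<^esub> \<longrightarrow> x = \<one>\<^bsub>G\<^esub>)"

definition fin_sym_generating_set :: "('a, 'b) monoid_scheme \<Rightarrow> 'a set \<Rightarrow> bool" where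
  "fin_sym_generating_set G S \<longleftrightarrow>
     finite S \<and> S \<subseteq> carrier G \<and> (\<forall>s\<in>S. inv\<^bsub>G\<^esub> s \<in> S) \<and> generate G S = carrier G"

section \<open>Word metric, horofunctions and Busemann points\<close>

definition word_eval :: "('a, 'b) monoid_scheme \<Rightarrow> 'a list \<Rightarrow> 'a" where
  "word_eval G w = foldr (\<lambda>x y. x \<otimes>\<^bsub>G\<^esub> y) w \<one>\<^bsub>G\<^esub>"

definition word_length :: "('a, 'b) monoid_scheme \<Rightarrow> 'a set \<Rightarrow> 'a \<Rightarrow> nat" where
  "word_length G S g = (LEAST n. \<exists>w. set w \<subseteq> S \<and> length w = n \<and> word_eval G w = g)"

definition word_dist :: "('a, 'b) monoid_scheme \<Rightarrow> 'a set \<Rightarrow> 'a \<Rightarrow> 'a \<Rightarrow> nat" where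
  "word_dist G S g h = word_length G S (inv\<^bsub>G\<^esub> g \<otimes>\<^bsub>G\<^esub> h)"

text \<open>Functions on the group are represented by functions that are \<open>undefined\<close> outside the
  carrier, which are the points of the product topology indexed by the carrier (the topology of
  pointwise convergence).\<close>

definition horo :: "('a, 'b) monoid_scheme \<Rightarrow> 'a set \<Rightarrow> 'a \<Rightarrow> 'a \<Rightarrow> real" where
  "horo G S g =
     (\<lambda>x\<in>carrier G. real (word_dist G S g x) - real (word_dist G S g \<one>\<^bsub>G\<^esub>))"

definition pointwise_topology :: "('a, 'b) monoid_scheme \<Rightarrow> ('a \<Rightarrow> real) topology" where
  "pointwise_topology G = product_topology (\<lambda>_. euclideanreal) (carrier G)"

definition horo_boundary :: "('a, 'b) monoid_scheme \<Rightarrow> 'a set \<Rightarrow> ('a \<Rightarrow> real) set" where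
  "horo_boundary G S =
     (pointwise_topology G closure_of (horo G S ` carrier G)) - horo G S ` carrier G"

definition horo_action :: "('a, 'b) monoid_scheme \<Rightarrow> 'a \<Rightarrow> ('a \<Rightarrow> real) \<Rightarrow> 'a \<Rightarrow> real" where
  "horo_action G g \<phi> =
     (\<lambda>x\<in>carrier G. \<phi> (inv\<^bsub>G\<^esub> g \<otimes>\<^bsub>G\<^esub> x) - \<phi> (inv\<^bsub>G\<^esub> g))"

text \<open>Infinite words are indexed from \<open>0\<close>, so the prefix of length \<open>n\<close> consists of the letters
  \<open>\<gamma> 0, \<dots>, \<gamma> (n - 1)\<close>.\<close>

definition prefix_elt :: "('a, 'b) monoid_scheme \<Rightarrow> (nat \<Rightarrow> 'a) \<Rightarrow> nat \<Rightarrow> 'a" where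
  "prefix_elt G \<gamma> n = word_eval G (map \<gamma> [0..<n])"

definition Geo :: "('a, 'b) monoid_scheme \<Rightarrow> 'a set \<Rightarrow> (nat \<Rightarrow> 'a) set" where
  "Geo G S = {\<gamma>. (\<forall>n. \<gamma> n \<in> S) \<and> (\<forall>n. word_length G S (prefix_elt G \<gamma> n) = n)}"

definition busemann :: "('a, 'b) monoid_scheme \<Rightarrow> 'a set \<Rightarrow> (nat \<Rightarrow> 'a) \<Rightarrow> 'a \<Rightarrow> real" where
  "busemann G S \<gamma> = (\<lambda>x\<in>carrier G. lim (\<lambda>n. horo G S (prefix_elt G \<gamma> n) x))"

definition geodesic_ray :: "('a, 'b) monoid_scheme \<Rightarrow> 'a set \<Rightarrow> (nat \<Rightarrow> 'a) \<Rightarrow> bool" where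
  "geodesic_ray G S \<rho> \<longleftrightarrow>
     (\<forall>n. \<rho> n \<in> carrier G) \<and> (\<forall>m n. m \<le> n \<longrightarrow> word_dist G S (\<rho> m) (\<rho> n) = n - m)"

definition busemann_points :: "('a, 'b) monoid_scheme \<Rightarrow> 'a set \<Rightarrow> ('a \<Rightarrow> real) set" where
  "busemann_points G S =
     {b \<in> horo_boundary G S. \<exists>\<rho>. geodesic_ray G S \<rho> \<and>
        limitin (pointwise_topology G) (\<lambda>n. horo G S (\<rho> n)) b sequentially}"

section \<open>The real Malcev completion of a 2-step nilpotent group\<close>

text \<open>A simply connected 2-step nilpotent Lie group in exponential coordinates: the carrier is its
  Lie algebra \<open>V\<close> with bracket \<open>br\<close>, and the product is given by the Baker--Campbell--Hausdorff
  formula, which stops after the first bracket.\<close>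

definition bch_group :: "'v::real_vector set \<Rightarrow> ('v \<Rightarrow> 'v \<Rightarrow> 'v) \<Rightarrow> 'v monoid" where
  "bch_group V br =
     \<lparr>carrier = V, monoid.mult = (\<lambda>x y. x + y + (1/2) *\<^sub>R br x y), one = 0\<rparr>"

text \<open>The Lie algebra is a finite-dimensional subspace \<open>V\<close> of an arbitrary normed space, so that
  its dimension is not tied to a type. Only the restriction of \<open>br\<close> to \<open>V\<close> matters. The Jacobi
  identity is automatic, since all double brackets vanish.\<close>

definition two_step_lie_algebra :: "'v::real_normed_vector set \<Rightarrow> ('v \<Rightarrow> 'v \<Rightarrow> 'v) \<Rightarrow> bool" where
  "two_step_lie_algebra V br \<longleftrightarrow>
     subspace V \<and> (\<exists>B. finite B \<and> V = span B) \<and>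
     bilinear br \<and> (\<forall>x\<in>V. \<forall>y\<in>V. br x y \<in> V) \<and> (\<forall>x\<in>V. br x x = 0) \<and>
     (\<forall>x\<in>V. \<forall>y\<in>V. \<forall>w\<in>V. br (br x y) w = 0)"

text \<open>The real Malcev completion is the simply connected nilpotent Lie group in which the group
  embeds (via \<open>j\<close>) as a discrete cocompact subgroup; it is unique up to isomorphism and has the
  same nilpotency class as the group.\<close>

definition malcev_completion ::
  "('a, 'b) monoid_scheme \<Rightarrow> 'v::real_normed_vector set \<Rightarrow> ('v \<Rightarrow> 'v \<Rightarrow> 'v) \<Rightarrow> ('a \<Rightarrow> 'v) \<Rightarrow> bool"
where
  "malcev_completion G V br j \<longleftrightarrow>
     two_step_lie_algebra V br \<and>
     j \<in> hom G (bch_group V br) \<and> inj_on j (carrier G) \<and>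
     discrete (j ` carrier G) \<and>
     (\<exists>K. compact K \<and> K \<subseteq> V \<and> V = (j ` carrier G) <#>\<^bsub>bch_group V br\<^esub> K)"

text \<open>The quotient of \<open>V\<close> by its derived subgroup is realised as the image of a linear map whose
  kernel on \<open>V\<close> is that subgroup.\<close>

definition abelianization_map ::
  "'v::real_normed_vector set \<Rightarrow> ('v \<Rightarrow> 'v \<Rightarrow> 'v) \<Rightarrow> ('v \<Rightarrow> 'w::real_vector) \<Rightarrow> bool"
where
  "abelianization_map V br Pr \<longleftrightarrow>
     linear Pr \<and> {v \<in> V. Pr v = 0} = derived (bch_group V br) V"

section \<open>Faces\<close>

definition minimal_face :: "'v::real_vector set \<Rightarrow> 'v set \<Rightarrow> 'v set" where
  "minimal_face P A = \<Inter>{F. F face_of P \<and> A \<subseteq> F}"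

definition recurrent_letters :: "(nat \<Rightarrow> 'a) \<Rightarrow> 'a set" where
  "recurrent_letters \<gamma> = {s. infinite {n. \<gamma> n = s}}"

definition E_face :: "'a set \<Rightarrow> ('a \<Rightarrow> 'v::real_vector) \<Rightarrow> (nat \<Rightarrow> 'a) \<Rightarrow> 'v set" where
  "E_face S j \<gamma> = minimal_face (convex hull (j ` S)) (j ` recurrent_letters \<gamma>)"

definition F_face ::
  "'a set \<Rightarrow> ('a \<Rightarrow> 'v::real_vector) \<Rightarrow> ('v \<Rightarrow> 'w::real_vector) \<Rightarrow> (nat \<Rightarrow> 'a) \<Rightarrow> 'w set"
where
  "F_face S j Pr \<gamma> =
     minimal_face (Pr ` (convex hull (j ` S))) (Pr ` j ` recurrent_letters \<gamma>)"

definition commutative_face ::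
  "'v::real_vector set \<Rightarrow> ('v \<Rightarrow> 'v \<Rightarrow> 'v) \<Rightarrow> ('v \<Rightarrow> 'w::real_vector) \<Rightarrow> 'w set \<Rightarrow> bool"
where
  "commutative_face V br Pr F \<longleftrightarrow>
     comm_group ((bch_group V br)\<lparr>carrier := generate (bch_group V br) {v \<in> V. Pr v \<in> F}\<rparr>)"

end

theory Submission
  imports Defs
begin

text \<open>Let \<open>b\<close> be the Busemann function of a geodesic word and \<open>D\<close> its set of recurrent letters,
  spanning the face \<open>F\<close>. If \<open>F\<close> is non-commutative, pieces of the word (or balanced combinations
  of its letters) can be rearranged at no cost so as to shift the central coordinate in both
  directions; hence \<open>b\<close> is periodic along the centre, and a step by any letter of \<open>F\<close> lowers \<open>b\<close>
  by one. If \<open>F\<close> is commutative, no central shift is available and the same descent holds for the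
  letters of the finer face \<open>E\<close>. So words with letters in the same face dominate each other's
  Busemann functions. Conversely, if two Busemann functions lie in one orbit, the points of the two
  words are joined by words of bounded excess, and Dickson's lemma applied to their letter counts
  gives a balanced relation that puts the recurrent letters of each word in the face of the other.
  When \<open>F\<close> is commutative, a homomorphism to the reals exposing \<open>F\<close> keeps the joining words inside
  \<open>F\<close>, so the relation is exact and concerns \<open>E\<close>. Finally, real convex relations between
  generators are rounded to integral ones, using the discreteness of the group in its completion,
  which identifies the combinatorial faces with those of the polytopes.\<close>

section \<open>Groups whose commutators are powers of a central element\<close>

text \<open>Two Busemann functions are compared through one inequality: if
  \<open>bus \<gamma>1\<close> is at most \<open>- n\<close> at the \<open>n\<close>-th point of
  \<gamma>2, then it is below \<open>bus \<gamma>2\<close> everywhere. So it has to be shown that a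
  letter lowers \<open>bus\<close> by one, and the obstacle is the central error made when a letter
  is inserted away from the ray. The delicate case is a non-commutative face whose recurrent letters
  commute: reordering the ray itself gains nothing, so long powers of a balanced relation are
  reordered instead. Their central displacement is quadratic in the exponent, while the corrections
  are linear. These corrections depend on the point through its commutator with a recurrent word
  \<open>q\<close>, so a period is found only on each level set of that commutator; recurrent
  letters commute with \<open>q\<close>, so the descent stays on one level. All of this concerns
  words. The completion serves to compare the combinatorial faces with convex hulls, and there the
  difficulty is to control the central coordinate while rounding, since it depends quadratically on
  the letter counts.\<close>

locale two_step_group = group G for G :: "('a, 'b) monoid_scheme" (structure) +
  fixes S :: "'a set" and z :: 'a
  assumes gens: "fin_sym_generating_set G S"
    and z_closed: "z \<in> carrier G"
    and z_central: "x \<in> carrier G \<Longrightarrow> z \<otimes> x = x \<otimes> z"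
    and z_order: "z [^] (n::int) = \<one> \<Longrightarrow> n = 0"
    and commutator_ex: "x \<in> carrier G \<Longrightarrow> y \<in> carrier G \<Longrightarrow> \<exists>n::int. x \<otimes> y = y \<otimes> x \<otimes> z [^] n"
    and nonabelian: "\<exists>x\<in>carrier G. \<exists>y\<in>carrier G. x \<otimes> y \<noteq> y \<otimes> x"
begin

lemma finite_S: "finite S" and S_subset: "S \<subseteq> carrier G"
  and S_inv: "s \<in> S \<Longrightarrow> inv s \<in> S" and S_generate: "generate G S = carrier G"
  using gens by (auto simp: fin_sym_generating_set_def)

lemma S_closed [simp]: "s \<in> S \<Longrightarrow> s \<in> carrier G"
  using S_subset by auto

text \<open>Writing multiplication by a central power as a separate operation lets the simplifier
  collect all central factors.\<close>

definition zs :: "'a \<Rightarrow> int \<Rightarrow> 'a" where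
  "zs x n = x \<otimes> z [^] n"

lemma zs_closed [simp]: "x \<in> carrier G \<Longrightarrow> zs x n \<in> carrier G"
  by (simp add: zs_def z_closed)

lemma zpow_central: "x \<in> carrier G \<Longrightarrow> z [^] (n::int) \<otimes> x = x \<otimes> z [^] n"
proof (cases n rule: int_cases2)
  case (nonneg k)
  assume "x \<in> carrier G"
  then show ?thesis
    using nonneg group_commutes_pow[of z x k] z_central z_closed by (simp add: int_pow_int)
next
  case (nonpos k)
  assume x: "x \<in> carrier G"
  then have "z [^] k \<otimes> x = x \<otimes> z [^] k"
    using group_commutes_pow[of z x k] z_central z_closed by simp
  with nonpos x show ?thesis
    using z_closed
    by (simp add: int_pow_neg_int)
       (metis inv_closed inv_solve_left inv_solve_right m_assoc m_closed nat_pow_closed)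
qed

lemma zs_0 [simp]: "x \<in> carrier G \<Longrightarrow> zs x 0 = x"
  by (simp add: zs_def)

lemma zs_zs [simp]: "x \<in> carrier G \<Longrightarrow> zs (zs x m) n = zs x (m + n)"
  by (simp add: zs_def m_assoc z_closed int_pow_mult)

lemma zs_mult_left [simp]: "x \<in> carrier G \<Longrightarrow> y \<in> carrier G \<Longrightarrow> zs x n \<otimes> y = zs (x \<otimes> y) n"
  by (simp add: zs_def m_assoc z_closed zpow_central)

lemma zs_mult_right [simp]: "x \<in> carrier G \<Longrightarrow> y \<in> carrier G \<Longrightarrow> x \<otimes> zs y n = zs (x \<otimes> y) n"
  by (simp add: zs_def m_assoc z_closed)

lemma zs_cancel [simp]: "x \<in> carrier G \<Longrightarrow> y \<in> carrier G \<Longrightarrow> zs x n = zs y n \<longleftrightarrow> x = y"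
  by (simp add: zs_def z_closed)

lemma zs_eq_self [simp]: "x \<in> carrier G \<Longrightarrow> zs x n = x \<longleftrightarrow> n = 0"
  using z_order[of n] by (auto simp: zs_def z_closed)

lemma zs_eq_iff: "x \<in> carrier G \<Longrightarrow> y \<in> carrier G \<Longrightarrow> zs x m = zs y n \<longleftrightarrow> x = zs y (n - m)"
  using zs_cancel[of x "zs y (n - m)" m] by simp

lemma zs_inj [simp]: "x \<in> carrier G \<Longrightarrow> zs x m = zs x n \<longleftrightarrow> m = n"
  by (auto simp: zs_eq_iff dest: sym)

lemma inv_zs [simp]: "x \<in> carrier G \<Longrightarrow> inv (zs x n) = zs (inv x) (- n)"
  by (rule inv_equality) auto

lemma zs_pow: "x \<in> carrier G \<Longrightarrow> zs x n [^] (k::nat) = zs (x [^] k) (n * int k)"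
  by (induction k) (auto simp: algebra_simps)

section \<open>The commutator pairing\<close>

definition w :: "'a \<Rightarrow> 'a \<Rightarrow> int" where
  "w x y = (THE n. x \<otimes> y = zs (y \<otimes> x) n)"

lemma w_unique: "x \<in> carrier G \<Longrightarrow> y \<in> carrier G \<Longrightarrow> x \<otimes> y = zs (y \<otimes> x) n \<Longrightarrow> w x y = n"
  unfolding w_def by (rule the_equality) auto

lemma commute_w: "x \<in> carrier G \<Longrightarrow> y \<in> carrier G \<Longrightarrow> x \<otimes> y = zs (y \<otimes> x) (w x y)"
  using commutator_ex[of x y] w_unique[of x y] by (auto simp: zs_def)

lemma commute_w_left:
  assumes "x \<in> carrier G" "y \<in> carrier G" "u \<in> carrier G"
  shows "x \<otimes> (y \<otimes> u) = zs (y \<otimes> (x \<otimes> u)) (w x y)"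
  using assms commute_w[of x y] by (simp flip: m_assoc)

lemma commute_iff_w: "x \<in> carrier G \<Longrightarrow> y \<in> carrier G \<Longrightarrow> x \<otimes> y = y \<otimes> x \<longleftrightarrow> w x y = 0"
  by (subst commute_w) auto

lemma w_self [simp]: "x \<in> carrier G \<Longrightarrow> w x x = 0"
  by (rule w_unique) auto

lemma w_swap: "x \<in> carrier G \<Longrightarrow> y \<in> carrier G \<Longrightarrow> w y x = - w x y"
  by (rule w_unique) (auto simp: commute_w[of x y])

text \<open>Commutators being central, moving a product past \<open>u\<close> costs the sum of the
  two exponents. So \<open>w\<close> is an alternating bilinear form that does not see central
  factors; nearly all later bookkeeping rests on this.\<close>

lemma w_mult_left [simp]:
  assumes "x \<in> carrier G" "y \<in> carrier G" "u \<in> carrier G"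
  shows "w (x \<otimes> y) u = w x u + w y u"
  by (rule w_unique)
     (use assms in \<open>auto simp: m_assoc commute_w[of y u] commute_w_left[of x u]\<close>)

lemma w_mult_right [simp]:
  assumes "x \<in> carrier G" "y \<in> carrier G" "u \<in> carrier G"
  shows "w u (x \<otimes> y) = w u x + w u y"
  using assms w_swap[of "x \<otimes> y" u] w_swap[of x u] w_swap[of y u] by simp

lemma w_one [simp]: "x \<in> carrier G \<Longrightarrow> w \<one> x = 0" "x \<in> carrier G \<Longrightarrow> w x \<one> = 0"
  by (auto intro!: w_unique)

lemma w_zs [simp]:
  "x \<in> carrier G \<Longrightarrow> y \<in> carrier G \<Longrightarrow> w (zs x n) y = w x y"
  "x \<in> carrier G \<Longrightarrow> y \<in> carrier G \<Longrightarrow> w x (zs y n) = w x y"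
  by (auto intro!: w_unique simp: commute_w[of x y])

lemma w_inv [simp]:
  "x \<in> carrier G \<Longrightarrow> y \<in> carrier G \<Longrightarrow> w (inv x) y = - w x y"
  "x \<in> carrier G \<Longrightarrow> y \<in> carrier G \<Longrightarrow> w x (inv y) = - w x y"
  using w_mult_left[of "inv x" x y] w_mult_right[of "inv y" y x]
  by (auto simp del: w_mult_left w_mult_right)

lemma w_pow [simp]:
  "x \<in> carrier G \<Longrightarrow> y \<in> carrier G \<Longrightarrow> w (x [^] (n::nat)) y = int n * w x y"
  "x \<in> carrier G \<Longrightarrow> y \<in> carrier G \<Longrightarrow> w x (y [^] (n::nat)) = int n * w x y"
  by (induction n) (auto simp: algebra_simps)

section \<open>Words\<close>

abbreviation ev :: "'a list \<Rightarrow> 'a" where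
  "ev \<equiv> word_eval G"

abbreviation len :: "'a \<Rightarrow> nat" where
  "len \<equiv> word_length G S"

lemma ev_Nil [simp]: "ev [] = \<one>" and ev_Cons [simp]: "ev (x # u) = x \<otimes> ev u"
  by (auto simp: word_eval_def)

lemma ev_closed [simp]: "set u \<subseteq> carrier G \<Longrightarrow> ev u \<in> carrier G"
  by (induction u) auto

lemma ev_closed_S [simp]: "set u \<subseteq> S \<Longrightarrow> ev u \<in> carrier G"
  using S_subset by (auto intro!: ev_closed)

lemma ev_append [simp]:
  "set u \<subseteq> carrier G \<Longrightarrow> set v \<subseteq> carrier G \<Longrightarrow> ev (u @ v) = ev u \<otimes> ev v"
  by (induction u) (auto simp: m_assoc)

lemma ev_append_S [simp]: "set u \<subseteq> S \<Longrightarrow> set v \<subseteq> S \<Longrightarrow> ev (u @ v) = ev u \<otimes> ev v"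
  using S_subset by (intro ev_append) auto

lemma ev_replicate [simp]: "x \<in> carrier G \<Longrightarrow> ev (replicate n x) = x [^] n"
proof (induction n)
  case (Suc n)
  then show ?case using nat_pow_Suc2[of x n] by simp
qed auto

lemma ev_concat_replicate [simp]: "set u \<subseteq> S \<Longrightarrow> ev (concat (replicate n u)) = ev u [^] n"
proof (induction n)
  case (Suc n)
  have "set (concat (replicate n u)) \<subseteq> S" using Suc by auto
  then show ?case using Suc nat_pow_Suc2[of "ev u" n] by simp
qed auto

lemma inv_ev: 
  assumes "set u \<subseteq> S"
  shows "inv (ev u) = ev (rev (map (m_inv G) u))"
  using assms
proof (induction u)
  case (Cons a u)
  have "set (rev (map (m_inv G) u)) \<subseteq> S" using Cons S_inv by auto
  then show ?case using Cons by (simp add: inv_mult_group S_inv del: set_rev)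
qed auto

lemma word_exists:
  assumes "x \<in> carrier G"
  shows "\<exists>u. set u \<subseteq> S \<and> ev u = x"
proof -
  have "x \<in> generate G S" using assms S_generate by simp
  then show ?thesis
  proof induction
    case one
    show ?case by (rule exI[of _ "[]"]) auto
  next
    case (incl h)
    show ?case by (rule exI[of _ "[h]"]) (use incl in auto)
  next
    case (inv h)
    show ?case by (rule exI[of _ "[inv h]"]) (use inv S_inv in auto)
  next
    case (eng h1 h2)
    then obtain u v where "set u \<subseteq> S" "ev u = h1" "set v \<subseteq> S" "ev v = h2" by blast
    then show ?case by (intro exI[of _ "u @ v"]) auto
  qed
qed

lemma geodesic_word:
  assumes "x \<in> carrier G"
  obtains u where "set u \<subseteq> S" "ev u = x" "length u = len x"
proof -
  have "\<exists>n u. set u \<subseteq> S \<and> length u = n \<and> ev u = x" using word_exists[OF assms] by blast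
  from LeastI_ex[OF this] that show thesis unfolding word_length_def by blast
qed

lemma len_ev_le: "set u \<subseteq> S \<Longrightarrow> len (ev u) \<le> length u"
  unfolding word_length_def by (rule Least_le) auto

lemma len_one [simp]: "len \<one> = 0"
  using len_ev_le[of "[]"] by simp

lemma len_mult: 
  assumes "x \<in> carrier G" "y \<in> carrier G"
  shows "len (x \<otimes> y) \<le> len x + len y"
proof -
  obtain u v where "set u \<subseteq> S" "ev u = x" "length u = len x" "set v \<subseteq> S" "ev v = y" "length v = len y"
    using geodesic_word assms by metis
  then show ?thesis using len_ev_le[of "u @ v"] by auto
qed

lemma len_inv_le: 
  assumes "x \<in> carrier G"
  shows "len (inv x) \<le> len x"
proof -
  obtain u where u: "set u \<subseteq> S" "ev u = x" "length u = len x"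
    using geodesic_word assms by metis
  have "set (rev (map (m_inv G) u)) \<subseteq> S" using u S_inv by auto
  then show ?thesis using len_ev_le[of "rev (map (m_inv G) u)"] u inv_ev[of u] by simp
qed

lemma len_inv [simp]: "x \<in> carrier G \<Longrightarrow> len (inv x) = len x"
  using len_inv_le[of x] len_inv_le[of "inv x"] by simp

text \<open>In exponential coordinates \<open>ev u\<close> is the sum of the letters plus \<open>area u / 2\<close> times
  the central generator.\<close>

fun area :: "'a list \<Rightarrow> int" where
  "area [] = 0"
| "area (s # u) = w s (ev u) + area u"

lemma area_append [simp]:
  "set u \<subseteq> S \<Longrightarrow> set v \<subseteq> S \<Longrightarrow> area (u @ v) = area u + area v + w (ev u) (ev v)"
  by (induction u) auto

lemma area_replicate [simp]: "s \<in> S \<Longrightarrow> area (replicate n s) = 0"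
  by (induction n) auto

text \<open>\<open>area\<close> is the sum of \<open>w\<close> over all pairs of letters in order of
  occurrence, and reversal flips every pair. A word and its reverse therefore yield central
  displacements of opposite sign.\<close>

lemma area_rev [simp]: "set u \<subseteq> S \<Longrightarrow> area (rev u) = - area u"
proof (induction u)
  case (Cons s u)
  then have r: "set (rev u) \<subseteq> S" by auto
  have "w (ev (rev u)) s = w (ev u) s"
    using Cons.prems
  proof (induction u)
    case (Cons a u)
    then have "set (rev u) \<subseteq> S" by auto
    then show ?case using Cons by (simp del: set_rev)
  qed auto
  then show ?case using Cons r w_swap[of "ev u" s] by (simp del: set_rev)
qed auto

lemma area_concat_replicate [simp]:
  "set u \<subseteq> S \<Longrightarrow> area (concat (replicate n u)) = int n * area u"
proof (induction n)
  case (Suc n)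
  have "set (concat (replicate n u)) \<subseteq> S" using Suc by auto
  then show ?case using Suc by (simp add: algebra_simps)
qed auto

text \<open>Swapping neighbouring letters costs a central power, and twice that cost is the change
  of area. The factor two keeps the formula integral, since a single area may be odd.\<close>

lemma ev_permute:
  assumes "set u \<subseteq> S" "mset u = mset v"
  shows "\<exists>c. ev u = zs (ev v) c \<and> 2 * c = area u - area v"
  using assms
proof (induction u arbitrary: v)
  case Nil
  then show ?case by (intro exI[of _ 0]) auto
next
  case (Cons s u)
  have "s \<in> set v" using Cons.prems(2) by (metis list.set_intros(1) mset_eq_setD)
  then obtain v1 v2 where v: "v = v1 @ s # v2" by (meson split_list)
  have vS: "set v \<subseteq> S" using Cons.prems mset_eq_setD by blast
  have "mset u = mset (v1 @ v2)" using Cons.prems(2) v by simp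
  with Cons obtain c where c: "ev u = zs (ev (v1 @ v2)) c" "2 * c = area u - area (v1 @ v2)"
    by fastforce
  have S: "s \<in> S" "set v1 \<subseteq> S" "set v2 \<subseteq> S" "set u \<subseteq> S" using v vS Cons.prems by auto
  have "ev (s # u) = zs (ev v) (c - w (ev v1) s)"
    using S c v by (simp add: commute_w_left[of "ev v1" s])
  moreover have "2 * (c - w (ev v1) s) = area (s # u) - area v"
    using c(2) S v w_swap[of "ev v1" s] c(1) by simp
  ultimately show ?case by blast
qed

lemma ev_permute_mod: "set u \<subseteq> S \<Longrightarrow> mset u = mset v \<Longrightarrow> \<exists>c. ev u = zs (ev v) c"
  using ev_permute by blast

section \<open>Sets of pairwise commuting letters\<close>

definition commuting :: "'a set \<Rightarrow> bool" where
  "commuting X \<longleftrightarrow> (\<forall>x\<in>X. \<forall>y\<in>X. w x y = 0)"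

lemma w_ev_left: "set u \<subseteq> S \<Longrightarrow> y \<in> carrier G \<Longrightarrow> (\<forall>x\<in>set u. w x y = 0) \<Longrightarrow> w (ev u) y = 0"
  by (induction u) auto

lemma w_ev_right: "set u \<subseteq> S \<Longrightarrow> y \<in> carrier G \<Longrightarrow> (\<forall>x\<in>set u. w y x = 0) \<Longrightarrow> w y (ev u) = 0"
  by (induction u) auto

lemma commuting_ev:
  assumes "commuting X" "X \<subseteq> S" "set u \<subseteq> X" "set v \<subseteq> X"
  shows "w (ev u) (ev v) = 0"
proof (rule w_ev_left)
  show "\<forall>x\<in>set u. w x (ev v) = 0"
  proof
    fix x assume "x \<in> set u"
    then show "w x (ev v) = 0" using assms
      by (intro w_ev_right) (auto simp: commuting_def subset_iff)
  qed
qed (use assms in auto)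

lemma commuting_area:
  assumes "commuting X" "X \<subseteq> S" "set u \<subseteq> X"
  shows "area u = 0"
  using assms(3)
proof (induction u)
  case (Cons s u)
  then show ?case using commuting_ev[OF assms(1,2), of "[s]" u] assms by auto
qed auto

lemma commuting_permute:
  assumes "commuting X" "X \<subseteq> S" "set u \<subseteq> X" "mset u = mset v"
  shows "ev u = ev v"
proof -
  have "set v \<subseteq> X" using assms mset_eq_setD by blast
  then show ?thesis
    using ev_permute[of u v] commuting_area[OF assms(1,2), of u] commuting_area[OF assms(1,2), of v]
      assms by fastforce
qed

section \<open>Busemann functions of geodesic words\<close>

abbreviation pre :: "(nat \<Rightarrow> 'a) \<Rightarrow> nat \<Rightarrow> 'a" where
  "pre \<equiv> prefix_elt G"

lemma Geo_S: "\<gamma> \<in> Geo G S \<Longrightarrow> \<gamma> n \<in> S" and len_pre: "\<gamma> \<in> Geo G S \<Longrightarrow> len (pre \<gamma> n) = n"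
  by (auto simp: Geo_def)

lemma segment_S: "\<gamma> \<in> Geo G S \<Longrightarrow> set (map \<gamma> [m..<n]) \<subseteq> S"
  using Geo_S by auto

lemma pre_closed [simp]: "\<gamma> \<in> Geo G S \<Longrightarrow> pre \<gamma> n \<in> carrier G"
  unfolding prefix_elt_def using segment_S by simp

lemma pre_0 [simp]: "pre \<gamma> 0 = \<one>"
  by (simp add: prefix_elt_def)

lemma pre_split:
  assumes "\<gamma> \<in> Geo G S" "m \<le> n"
  shows "pre \<gamma> n = pre \<gamma> m \<otimes> ev (map \<gamma> [m..<n])"
proof -
  have "[0..<n] = [0..<m] @ [m..<n]"
    using assms(2) upt_add_eq_append[of 0 m "n - m"] by simp
  then show ?thesis
    unfolding prefix_elt_def using assms segment_S
    by (metis ev_append_S map_append)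
qed

lemma pre_Suc: "\<gamma> \<in> Geo G S \<Longrightarrow> pre \<gamma> (Suc n) = pre \<gamma> n \<otimes> \<gamma> n"
  using pre_split[of \<gamma> n "Suc n"] Geo_S by simp

text \<open>One may return along the ray from \<open>pre \<gamma> n\<close> to
  \<open>pre \<gamma> m\<close>, at the cost of \<open>n - m\<close> letters, and go on to
  \<open>x\<close> from there.\<close>

lemma len_translate_antimono:
  assumes "\<gamma> \<in> Geo G S" "x \<in> carrier G" "m \<le> n"
  shows "int (len (inv (pre \<gamma> n) \<otimes> x)) - int n \<le> int (len (inv (pre \<gamma> m) \<otimes> x)) - int m"
proof -
  let ?u = "map \<gamma> [m..<n]"
  have u: "set ?u \<subseteq> S" using assms segment_S by blast
  have "inv (pre \<gamma> n) \<otimes> x = inv (ev ?u) \<otimes> (inv (pre \<gamma> m) \<otimes> x)"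
    using assms u by (simp add: pre_split[of \<gamma> m n] inv_mult_group m_assoc)
  then have "len (inv (pre \<gamma> n) \<otimes> x) \<le> len (inv (ev ?u)) + len (inv (pre \<gamma> m) \<otimes> x)"
    using len_mult[of "inv (ev ?u)" "inv (pre \<gamma> m) \<otimes> x"] assms u by simp
  moreover have "len (inv (ev ?u)) \<le> n - m" using len_ev_le[OF u] u by simp
  ultimately show ?thesis using assms(3) by linarith
qed

lemma len_translate_bound:
  assumes "\<gamma> \<in> Geo G S" "x \<in> carrier G"
  shows "- int (len x) \<le> int (len (inv (pre \<gamma> n) \<otimes> x)) - int n"
proof -
  have "inv (pre \<gamma> n) = (inv (pre \<gamma> n) \<otimes> x) \<otimes> inv x" using assms by (simp add: m_assoc)
  then have "len (pre \<gamma> n) \<le> len (inv (pre \<gamma> n) \<otimes> x) + len x"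
    using len_mult[of "inv (pre \<gamma> n) \<otimes> x" "inv x"] assms by (metis inv_closed len_inv m_closed pre_closed)
  then show ?thesis using len_pre[OF assms(1), of n] by linarith
qed

lemma int_antimono_eventually_const:
  fixes f :: "nat \<Rightarrow> int"
  assumes "\<And>m n. m \<le> n \<Longrightarrow> f n \<le> f m" "\<And>n. c \<le> f n"
  shows "\<exists>N. \<forall>n\<ge>N. f n = f N"
proof -
  let ?g = "\<lambda>n. nat (f n - c)"
  obtain N where N: "\<And>n. ?g N \<le> ?g n"
    using ex_has_least_nat[of "\<lambda>_. True" 0 ?g] by auto
  have "f n = f N" if "n \<ge> N" for n
    using N[of n] assms(1)[OF that] assms(2)[of n] assms(2)[of N] by linarith
  then show ?thesis by blast
qed

text \<open>The sequence is antitone, integer-valued and bounded below, hence eventually constant.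
  The Busemann limit is thus attained at a finite time, which replaces limit arguments by exact
  equalities for large \<open>n\<close>.\<close>

definition bus :: "(nat \<Rightarrow> 'a) \<Rightarrow> 'a \<Rightarrow> int" where
  "bus \<gamma> x = (THE c. \<exists>N. \<forall>n\<ge>N. int (len (inv (pre \<gamma> n) \<otimes> x)) - int n = c)"

lemma bus_eventually:
  assumes "\<gamma> \<in> Geo G S" "x \<in> carrier G"
  shows "\<exists>N. \<forall>n\<ge>N. int (len (inv (pre \<gamma> n) \<otimes> x)) = bus \<gamma> x + int n"
proof -
  let ?f = "\<lambda>n. int (len (inv (pre \<gamma> n) \<otimes> x)) - int n"
  have "\<exists>N. \<forall>n\<ge>N. ?f n = ?f N"
    using len_translate_antimono[OF assms] len_translate_bound[OF assms]
    by (rule int_antimono_eventually_const)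
  then obtain N where N: "\<forall>n\<ge>N. ?f n = ?f N" by blast
  have "bus \<gamma> x = ?f N"
    unfolding bus_def
  proof (rule the_equality)
    show "\<exists>N'. \<forall>n\<ge>N'. ?f n = ?f N" using N by blast
    fix c assume "\<exists>N'. \<forall>n\<ge>N'. ?f n = c"
    then obtain N' where "\<forall>n\<ge>N'. ?f n = c" by blast
    then show "c = ?f N" using N by (metis le_cases)
  qed
  then have "int (len (inv (pre \<gamma> n) \<otimes> x)) = bus \<gamma> x + int n" if "n \<ge> N" for n
    using N[rule_format, OF that] by linarith
  then show ?thesis by blast
qed

lemma bus_le:
  assumes "\<gamma> \<in> Geo G S" "x \<in> carrier G"
  shows "bus \<gamma> x \<le> int (len (inv (pre \<gamma> m) \<otimes> x)) - int m"
proof -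
  obtain N where N: "\<forall>n\<ge>N. int (len (inv (pre \<gamma> n) \<otimes> x)) = bus \<gamma> x + int n"
    using bus_eventually[OF assms] by blast
  show ?thesis
    using N[rule_format, of "max N m"] len_translate_antimono[OF assms, of m "max N m"] by simp
qed

lemma busemann_eq_bus:
  assumes "\<gamma> \<in> Geo G S" "x \<in> carrier G"
  shows "busemann G S \<gamma> x = real_of_int (bus \<gamma> x)"
    and "(\<lambda>n. horo G S (pre \<gamma> n) x) \<longlonglongrightarrow> real_of_int (bus \<gamma> x)"
proof -
  obtain N where N: "\<forall>n\<ge>N. int (len (inv (pre \<gamma> n) \<otimes> x)) = bus \<gamma> x + int n"
    using bus_eventually[OF assms] by blast
  have "horo G S (pre \<gamma> n) x = real_of_int (bus \<gamma> x)" if "n \<ge> N" for n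
  proof -
    have "real (len (inv (pre \<gamma> n) \<otimes> x)) = real_of_int (bus \<gamma> x) + real n"
      using N that by (metis of_int_add of_int_of_nat_eq)
    then show ?thesis
      using assms len_pre[OF assms(1), of n] by (simp add: horo_def word_dist_def)
  qed
  then show lim: "(\<lambda>n. horo G S (pre \<gamma> n) x) \<longlonglongrightarrow> real_of_int (bus \<gamma> x)"
    by (intro tendsto_eventually eventually_sequentiallyI)
  show "busemann G S \<gamma> x = real_of_int (bus \<gamma> x)"
    using assms limI[OF lim] by (simp add: busemann_def)
qed

lemma busemann_eq_iff:
  assumes "\<gamma>1 \<in> Geo G S" "\<gamma>2 \<in> Geo G S"
  shows "busemann G S \<gamma>1 = busemann G S \<gamma>2 \<longleftrightarrow> (\<forall>x\<in>carrier G. bus \<gamma>1 x = bus \<gamma>2 x)"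
proof
  assume "busemann G S \<gamma>1 = busemann G S \<gamma>2"
  then show "\<forall>x\<in>carrier G. bus \<gamma>1 x = bus \<gamma>2 x"
    using busemann_eq_bus(1) assms by (metis of_int_eq_iff)
next
  assume R: "\<forall>x\<in>carrier G. bus \<gamma>1 x = bus \<gamma>2 x"
  show "busemann G S \<gamma>1 = busemann G S \<gamma>2"
  proof
    fix x
    show "busemann G S \<gamma>1 x = busemann G S \<gamma>2 x"
      using R busemann_eq_bus(1) assms by (cases "x \<in> carrier G") (auto simp: busemann_def)
  qed
qed

lemma bus_one [simp]: 
  assumes "\<gamma> \<in> Geo G S" shows "bus \<gamma> \<one> = 0"
proof -
  obtain N where "\<forall>n\<ge>N. int (len (inv (pre \<gamma> n) \<otimes> \<one>)) = bus \<gamma> \<one> + int n"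
    using bus_eventually[OF assms] by blast
  then show ?thesis using assms len_pre[OF assms, of N] by force
qed

lemma bus_lipschitz:
  assumes "\<gamma> \<in> Geo G S" "x \<in> carrier G" "y \<in> carrier G"
  shows "bus \<gamma> (x \<otimes> y) \<le> bus \<gamma> x + int (len y)"
proof -
  obtain N where N: "\<forall>n\<ge>N. int (len (inv (pre \<gamma> n) \<otimes> x)) = bus \<gamma> x + int n"
    using bus_eventually[OF assms(1,2)] by blast
  have "bus \<gamma> (x \<otimes> y) \<le> int (len (inv (pre \<gamma> N) \<otimes> x \<otimes> y)) - int N"
    using bus_le[of \<gamma> "x \<otimes> y" N] assms by (simp add: m_assoc)
  moreover have "len (inv (pre \<gamma> N) \<otimes> x \<otimes> y) \<le> len (inv (pre \<gamma> N) \<otimes> x) + len y"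
    using assms by (intro len_mult) auto
  ultimately show ?thesis using N[rule_format, of N] by linarith
qed

text \<open>The form in which descents are concluded: if some word leads from \<open>x\<close> to a
  point where \<open>bus\<close> is low, then going back over that word bounds \<open>bus\<close> at
  \<open>x\<close> itself.\<close>

lemma bus_lipschitz_word_back:
  assumes "\<gamma> \<in> Geo G S" "x \<in> carrier G" "set u \<subseteq> S"
  shows "bus \<gamma> x \<le> bus \<gamma> (x \<otimes> ev u) + int (length u)"
  using bus_lipschitz[of \<gamma> "x \<otimes> ev u" "inv (ev u)"] len_ev_le[of u] assms by (simp add: m_assoc)

lemma bus_pre:
  assumes "\<gamma> \<in> Geo G S" shows "bus \<gamma> (pre \<gamma> n) = - int n"
proof (rule antisym)
  show "bus \<gamma> (pre \<gamma> n) \<le> - int n" using bus_le[OF assms, of "pre \<gamma> n" n] assms by simp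
  show "- int n \<le> bus \<gamma> (pre \<gamma> n)"
    using bus_lipschitz_word_back[OF assms one_closed, of "map \<gamma> [0..<n]"] assms
      segment_S[OF assms, of 0 n] by (simp add: prefix_elt_def)
qed

text \<open>For large \<open>N\<close> the element \<open>x\<close> is reached from
  \<open>pre \<gamma>2 N\<close> by exactly \<open>bus \<gamma>2 x + N\<close> letters. The
  Lipschitz bound for \<open>bus \<gamma>1\<close> along them uses up the \<open>N\<close> gained on
  the ray.\<close>

lemma bus_le_bus:
  assumes "\<gamma>1 \<in> Geo G S" "\<gamma>2 \<in> Geo G S" "x \<in> carrier G"
    and "\<And>n. bus \<gamma>1 (pre \<gamma>2 n) \<le> - int n"
  shows "bus \<gamma>1 x \<le> bus \<gamma>2 x"
proof -
  obtain N where N: "\<forall>n\<ge>N. int (len (inv (pre \<gamma>2 n) \<otimes> x)) = bus \<gamma>2 x + int n"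
    using bus_eventually[OF assms(2,3)] by blast
  have "x = pre \<gamma>2 N \<otimes> (inv (pre \<gamma>2 N) \<otimes> x)" using assms by (simp flip: m_assoc)
  then have "bus \<gamma>1 x \<le> bus \<gamma>1 (pre \<gamma>2 N) + int (len (inv (pre \<gamma>2 N) \<otimes> x))"
    using bus_lipschitz[of \<gamma>1 "pre \<gamma>2 N" "inv (pre \<gamma>2 N) \<otimes> x"] assms by simp
  then show ?thesis using assms(4)[of N] N[rule_format, of N] by linarith
qed


section \<open>Recurrent letters and combinatorial faces\<close>

lemma rec_S: "\<gamma> \<in> Geo G S \<Longrightarrow> recurrent_letters \<gamma> \<subseteq> S"
proof
  fix s assume "\<gamma> \<in> Geo G S" "s \<in> recurrent_letters \<gamma>"
  then have "{n. \<gamma> n = s} \<noteq> {}" unfolding recurrent_letters_def by (metis finite.emptyI mem_Collect_eq)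
  then show "s \<in> S" using Geo_S \<open>\<gamma> \<in> Geo G S\<close> by auto
qed

lemma rec_recurs: "s \<in> recurrent_letters \<gamma> \<Longrightarrow> \<exists>n\<ge>N. \<gamma> n = s"
  unfolding recurrent_letters_def infinite_nat_iff_unbounded_le by auto

lemma eventually_rec:
  assumes "\<gamma> \<in> Geo G S"
  shows "\<exists>N. \<forall>n\<ge>N. \<gamma> n \<in> recurrent_letters \<gamma>"
proof -
  have "finite (\<Union>s\<in>S - recurrent_letters \<gamma>. {n. \<gamma> n = s})"
    using finite_S by (auto simp: recurrent_letters_def)
  then obtain N where N: "\<forall>n\<in>(\<Union>s\<in>S - recurrent_letters \<gamma>. {n. \<gamma> n = s}). n < N"
    using finite_nat_set_iff_bounded by blast
  have "\<gamma> n \<in> recurrent_letters \<gamma>" if "n \<ge> N" for n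
  proof (rule ccontr)
    assume "\<gamma> n \<notin> recurrent_letters \<gamma>"
    then have "n \<in> (\<Union>s\<in>S - recurrent_letters \<gamma>. {n. \<gamma> n = s})"
      using Geo_S[OF assms, of n] by blast
    with N have "n < N" by (rule bspec)
    then show False using that by simp
  qed
  then show ?thesis by blast
qed

text \<open>Modulo the centre, membership in \<open>face_letters D\<close> says that \<open>s\<close> occurs in a convex
  combination of generators that is also a convex combination of elements of \<open>D\<close>: this is the
  combinatorial form of lying in the minimal face spanned by \<open>D\<close>. The set
  \<open>fine_letters X D\<close> does the same without reducing modulo the centre.\<close>

definition face_letters :: "'a set \<Rightarrow> 'a set" where
  "face_letters D = {s \<in> S. \<exists>u q c. set u \<subseteq> S \<and> set q \<subseteq> D \<and> length q = Suc (length u) \<and>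
     ev (s # u) = zs (ev q) c}"

definition fine_letters :: "'a set \<Rightarrow> 'a set \<Rightarrow> 'a set" where
  "fine_letters X D = {s \<in> X. \<exists>u q. set u \<subseteq> X \<and> set q \<subseteq> D \<and> length q = Suc (length u) \<and>
     ev (s # u) = ev q}"

lemma face_letters_S: "face_letters D \<subseteq> S"
  by (auto simp: face_letters_def)

lemma subset_face_letters: "D \<subseteq> S \<Longrightarrow> D \<subseteq> face_letters D"
  unfolding face_letters_def by (force intro: exI[of _ "[]"] exI[of _ "[x]" for x] exI[of _ 0])

lemma fine_letters_subset: "fine_letters X D \<subseteq> X"
  by (auto simp: fine_letters_def)

lemma subset_fine_letters: "D \<subseteq> X \<Longrightarrow> D \<subseteq> fine_letters X D"
  unfolding fine_letters_def by (force intro: exI[of _ "[]"] exI[of _ "[x]" for x])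

section \<open>The non-commutative case\<close>

text \<open>The first positive value follows a non-positive one, hence it is at most
  \<open>M\<close>.\<close>

lemma discrete_ivt:
  fixes f :: "nat \<Rightarrow> int"
  assumes "f 0 \<le> 0" "0 < f n" "\<And>k. k < n \<Longrightarrow> f (Suc k) - f k \<le> M"
  shows "\<exists>k\<le>n. 1 \<le> f k \<and> f k \<le> M"
proof -
  define k where "k = (LEAST k. 0 < f k)"
  have k: "0 < f k" "k \<le> n" unfolding k_def using assms(2) by (auto intro: LeastI Least_le)
  have "k \<noteq> 0" using k(1) assms(1) by (intro notI) simp
  then obtain k' where k': "k = Suc k'" using not0_implies_Suc by blast
  then have "\<not> 0 < f k'" unfolding k_def using not_less_Least[of k' "\<lambda>k. 0 < f k"] by simp
  then show ?thesis using k assms(3)[of k'] k' by (intro exI[of _ k]) auto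
qed

text \<open>Moving the first \<open>s\<close> to the right, or the second one to the left, changes the central
  coordinate by steps of bounded size, with opposite signs.\<close>

lemma rearrange_conjugate:
  assumes s: "s \<in> S" and Y: "set Y \<subseteq> S" and ne: "w s (ev Y) \<noteq> 0"
    and M: "\<And>a b. a \<in> S \<Longrightarrow> b \<in> S \<Longrightarrow> \<bar>w a b\<bar> \<le> M" and e: "e = 1 \<or> e = (-1::int)"
  shows "\<exists>V c. set V \<subseteq> S \<and> length V = length Y + 2 \<and> 1 \<le> c \<and> c \<le> M \<and>
    ev V = zs (ev (s # Y @ [s])) (e * c)"
proof -
  have ee: "e * (e * a) = a" for a using e by auto
  have yS: "Y ! k \<in> S" if "k < length Y" for k using Y that by auto
  have step: "\<bar>e * w s (Y ! k)\<bar> \<le> M" if "k < length Y" for k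
    using M[OF s yS[OF that]] e by (auto simp: abs_mult)
  have tS: "set (take k Y) \<subseteq> S" "set (drop k Y) \<subseteq> S" for k
    using Y by (meson order_trans set_take_subset set_drop_subset)+
  have evY: "ev Y = ev (take k Y) \<otimes> ev (drop k Y)" for k
    using ev_append_S[OF tS[of k]] by simp
  show ?thesis
  proof (cases "e * w s (ev Y) < 0")
    case True
    \<comment> \<open>Moving the first \<open>s\<close> over the prefix of length \<open>k\<close>
      multiplies the element by \<open>z\<close> to the power \<open>e * f k\<close>; the case
      assumption says that the full move makes \<open>f\<close> positive.\<close>
    define f where "f k = - e * w s (ev (take k Y))" for k
    have "f (Suc k) - f k \<le> M" if "k < length Y" for k
    proof -
      have "ev (take (Suc k) Y) = ev (take k Y) \<otimes> Y ! k"
        using tS[of k] that yS[OF that] by (simp add: take_Suc_conv_app_nth)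
      then have "f (Suc k) - f k = - (e * w s (Y ! k))"
        using s yS[OF that] tS(1)[of k] by (simp add: f_def algebra_simps)
      then show ?thesis using step[OF that] by linarith
    qed
    then obtain k where k: "k \<le> length Y" "1 \<le> f k" "f k \<le> M"
      using discrete_ivt[of f "length Y" M] True s by (auto simp: f_def)
    let ?V = "take k Y @ s # drop k Y @ [s]"
    have V: "ev (s # Y @ [s]) = zs (ev ?V) (w s (ev (take k Y)))"
      using tS[of k] s Y
      by (simp add: evY[of k] m_assoc commute_w_left[of s "ev (take k Y)"])
    have "e * f k = - w s (ev (take k Y))" using e by (auto simp: f_def)
    then have "ev ?V = zs (ev (s # Y @ [s])) (e * f k)"
      unfolding V using tS[of k] s by simp
    then show ?thesis
      using k tS[of k] s by (intro exI[of _ ?V] exI[of _ "f k"]) auto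
  next
    case False
    \<comment> \<open>Here the last \<open>s\<close> moves left over a suffix of length
      \<open>k\<close>, which changes the centre with the opposite sign and so serves the remaining
      case.\<close>
    define f where "f k = e * w s (ev (drop (length Y - k) Y))" for k
    have "f (Suc k) - f k \<le> M" if "k < length Y" for k
    proof -
      let ?i = "length Y - Suc k"
      have "drop ?i Y = Y ! ?i # drop (length Y - k) Y"
        using that by (metis Cons_nth_drop_Suc Suc_diff_Suc diff_Suc_less length_greater_0_conv
            list.size(3) not_less_zero)
      then have "f (Suc k) - f k = e * w s (Y ! ?i)"
        using s yS[of ?i] tS(2)[of "length Y - k"] that by (simp add: f_def algebra_simps)
      then show ?thesis using step[of ?i] that by linarith
    qed
    moreover have "0 < f (length Y)" using False ne e by (auto simp: f_def)
    ultimately obtain k where k: "k \<le> length Y" "1 \<le> f k" "f k \<le> M"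
      using discrete_ivt[of f "length Y" M] s by (auto simp: f_def)
    let ?j = "length Y - k"
    let ?V = "s # take ?j Y @ s # drop ?j Y"
    have V: "ev (s # Y @ [s]) = zs (ev ?V) (- w s (ev (drop ?j Y)))"
      using tS[of ?j] s Y w_swap[of s "ev (drop ?j Y)"]
      by (simp add: evY[of ?j] m_assoc commute_w[of "ev (drop ?j Y)" s])
    have "e * f k = w s (ev (drop ?j Y))" using e by (auto simp: f_def)
    then have "ev ?V = zs (ev (s # Y @ [s])) (e * f k)"
      unfolding V using tS[of ?j] s by simp
    then show ?thesis
      using k tS[of ?j] s by (intro exI[of _ ?V] exI[of _ "f k"]) auto
  qed
qed

text \<open>By bilinearity \<open>w t (ev (Y1 @ s # Y2))\<close> and
  \<open>w t (ev (Y1 @ Y2))\<close> differ by \<open>w t s\<close>, so they cannot both vanish.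
  Either the two \<open>t\<close>s can be used as they stand, or the two \<open>s\<close>s can, or
  \<open>s\<close> commutes with the block between its occurrences; then the second \<open>s\<close>
  is pulled to the front, which removes it from between the \<open>t\<close>s.\<close>

lemma rearrange_alternating:
  assumes s: "s \<in> S" "t \<in> S" and Y: "set Y0 \<subseteq> S" "set Y1 \<subseteq> S" "set Y2 \<subseteq> S"
    and ne: "w s t \<noteq> 0"
    and M: "\<And>a b. a \<in> S \<Longrightarrow> b \<in> S \<Longrightarrow> \<bar>w a b\<bar> \<le> M" and e: "e = 1 \<or> e = (-1::int)"
  defines "U \<equiv> s # Y0 @ t # Y1 @ s # Y2 @ [t]"
  shows "\<exists>V c. set V \<subseteq> S \<and> length V = length U \<and> 1 \<le> c \<and> c \<le> M \<and> ev V = zs (ev U) (e * c)"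
proof -
  consider (1) "w s (ev (Y0 @ t # Y1)) \<noteq> 0"
    | (2) "w s (ev (Y0 @ t # Y1)) = 0" "w t (ev (Y1 @ Y2)) \<noteq> 0"
    | (3) "w t (ev (Y1 @ s # Y2)) \<noteq> 0"
    using ne s Y w_swap[of s t] by fastforce
  then show ?thesis
  proof cases
    case 1
    have "set (Y0 @ t # Y1) \<subseteq> S" using s Y by auto
    from rearrange_conjugate[OF s(1) this 1 M e]
    obtain V c where V: "set V \<subseteq> S" "length V = length (Y0 @ t # Y1) + 2" "1 \<le> c" "c \<le> M"
      "ev V = zs (ev (s # (Y0 @ t # Y1) @ [s])) (e * c)" by blast
    then have "ev (V @ Y2 @ [t]) = zs (ev U) (e * c)"
      using s Y by (simp add: U_def m_assoc)
    then show ?thesis using V s Y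
      by (intro exI[of _ "V @ Y2 @ [t]"] exI[of _ c]) (auto simp: U_def)
  next
    case 2
    have "set (Y1 @ Y2) \<subseteq> S" using Y by auto
    from rearrange_conjugate[OF s(2) this 2(2) M e]
    obtain V c where V: "set V \<subseteq> S" "length V = length (Y1 @ Y2) + 2" "1 \<le> c" "c \<le> M"
      "ev V = zs (ev (t # (Y1 @ Y2) @ [t])) (e * c)" by blast
    have "ev (Y0 @ t # Y1) \<otimes> s = s \<otimes> ev (Y0 @ t # Y1)"
      using commute_w[of s "ev (Y0 @ t # Y1)"] 2(1) s Y by simp
    then have "ev (Y0 @ t # Y1) \<otimes> (s \<otimes> ev (Y2 @ [t])) = s \<otimes> ev (Y0 @ t # Y1) \<otimes> ev (Y2 @ [t])"
      using s Y by (simp flip: m_assoc)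
    then have "ev U = ev (s # s # Y0 @ t # (Y1 @ Y2) @ [t])"
      using s Y by (simp add: U_def m_assoc)
    then have "ev (s # s # Y0 @ V) = zs (ev U) (e * c)"
      using V s Y by (simp add: m_assoc)
    then show ?thesis using V s Y
      by (intro exI[of _ "s # s # Y0 @ V"] exI[of _ c]) (auto simp: U_def)
  next
    case 3
    have "set (Y1 @ s # Y2) \<subseteq> S" using s Y by auto
    from rearrange_conjugate[OF s(2) this 3 M e]
    obtain V c where V: "set V \<subseteq> S" "length V = length (Y1 @ s # Y2) + 2" "1 \<le> c" "c \<le> M"
      "ev V = zs (ev (t # (Y1 @ s # Y2) @ [t])) (e * c)" by blast
    then have "ev (s # Y0 @ V) = zs (ev U) (e * c)"
      using s Y by (simp add: U_def m_assoc)
    then show ?thesis using V s Y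
      by (intro exI[of _ "s # Y0 @ V"] exI[of _ c]) (auto simp: U_def)
  qed
qed

section \<open>Central shifts of a ray with non-commuting recurrent letters\<close>

lemma w_bounded: "\<exists>M. \<forall>a\<in>S. \<forall>b\<in>S. \<bar>w a b\<bar> \<le> M"
proof -
  let ?A = "(\<lambda>(a, b). \<bar>w a b\<bar>) ` (S \<times> S)"
  have "finite ?A" using finite_S by auto
  then have "\<bar>w a b\<bar> \<le> Max ?A" if "a \<in> S" "b \<in> S" for a b
    using that by (intro Max_ge) auto
  then show ?thesis by blast
qed

lemma segment_split:
  assumes "m \<le> i" "i < n"
  shows "map \<gamma> [m..<n] = map \<gamma> [m..<i] @ \<gamma> i # map \<gamma> [Suc i..<n]"
proof -
  have "[m..<n] = [m..<i] @ [i..<n]" using upt_add_eq_append[of m i "n - i"] assms by simp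
  then show ?thesis using assms(2) by (simp add: upt_conv_Cons)
qed

text \<open>After \<open>m0\<close> the ray contains the pattern \<open>s\<close>, \<open>t\<close>,
  \<open>s\<close>, \<open>t\<close>. Rearranging that stretch keeps its length, so the centrally
  shifted endpoint is still within \<open>m - m0\<close> letters of
  \<open>pre \<gamma> m0\<close>.\<close>

lemma rearrange_tail:
  assumes g: "\<gamma> \<in> Geo G S" and s: "s \<in> recurrent_letters \<gamma>" and t: "t \<in> recurrent_letters \<gamma>"
    and ne: "w s t \<noteq> 0"
    and M: "\<And>a b. a \<in> S \<Longrightarrow> b \<in> S \<Longrightarrow> \<bar>w a b\<bar> \<le> M" and e: "e = 1 \<or> e = (-1::int)"
  shows "\<exists>c m. 1 \<le> c \<and> c \<le> M \<and> m0 \<le> m \<and>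
    len (inv (pre \<gamma> m0) \<otimes> zs (pre \<gamma> m) (e * c)) \<le> m - m0"
proof -
  obtain i1 where i1: "m0 \<le> i1" "\<gamma> i1 = s" using rec_recurs[OF s, of m0] by blast
  obtain i2 where i2: "Suc i1 \<le> i2" "\<gamma> i2 = t" using rec_recurs[OF t, of "Suc i1"] by blast
  obtain i3 where i3: "Suc i2 \<le> i3" "\<gamma> i3 = s" using rec_recurs[OF s, of "Suc i2"] by blast
  obtain i4 where i4: "Suc i3 \<le> i4" "\<gamma> i4 = t" using rec_recurs[OF t, of "Suc i3"] by blast
  define m where "m = Suc i4"
  let ?A = "map \<gamma> [m0..<i1]" and ?Y0 = "map \<gamma> [Suc i1..<i2]" and ?Y1 = "map \<gamma> [Suc i2..<i3]"
    and ?Y2 = "map \<gamma> [Suc i3..<i4]"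
  let ?U = "s # ?Y0 @ t # ?Y1 @ s # ?Y2 @ [t]"
  have U: "map \<gamma> [m0..<m] = ?A @ ?U"
    using i1 i2 i3 i4 segment_split[of m0 i1 m \<gamma>] segment_split[of "Suc i1" i2 m \<gamma>]
      segment_split[of "Suc i2" i3 m \<gamma>] segment_split[of "Suc i3" i4 m \<gamma>]
    by (simp add: m_def)
  have sS: "s \<in> S" "t \<in> S" using s t rec_S[OF g] by auto
  note segs = segment_S[OF g]
  obtain V c where V: "set V \<subseteq> S" "length V = length ?U" "1 \<le> c" "c \<le> M" "ev V = zs (ev ?U) (e * c)"
    using rearrange_alternating[OF sS segs segs segs ne M e] by blast
  have US: "set ?U \<subseteq> S" using sS segs[of "Suc i1" i2] segs[of "Suc i2" i3] segs[of "Suc i3" i4] by auto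
  have "m0 \<le> m" using i1 i2 i3 i4 m_def by linarith
  have "pre \<gamma> m = pre \<gamma> m0 \<otimes> (ev ?A \<otimes> ev ?U)"
    unfolding pre_split[OF g \<open>m0 \<le> m\<close>] U using segs[of m0 i1] US
    by (metis ev_append_S)
  then have "inv (pre \<gamma> m0) \<otimes> zs (pre \<gamma> m) (e * c) = ev (?A @ V)"
    using segs[of m0 i1] US g V
    by (simp add: m_assoc[symmetric] del: ev_Cons set_map set_append set_simps)
  moreover have "length (?A @ V) = m - m0"
    using arg_cong[OF U, of length] V(2) by simp
  ultimately have "len (inv (pre \<gamma> m0) \<otimes> zs (pre \<gamma> m) (e * c)) \<le> m - m0"
    using len_ev_le[of "?A @ V"] segs[of m0 i1] V(1) by simp
  then show ?thesis using V \<open>m0 \<le> m\<close> by blast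
qed

text \<open>If every candidate failed somewhere, an index beyond all these failures would be left
  without a candidate.\<close>

lemma eventually_const_choice:
  fixes P :: "'c \<Rightarrow> nat \<Rightarrow> bool"
  assumes "finite C" "\<And>n. \<exists>c\<in>C. P c n" "\<And>c m n. m \<le> n \<Longrightarrow> P c n \<Longrightarrow> P c m"
  shows "\<exists>c\<in>C. \<forall>n. P c n"
proof (rule ccontr)
  assume "\<not> ?thesis"
  then obtain f where f: "\<And>c. c \<in> C \<Longrightarrow> \<not> P c (f c)" by metis
  obtain c where c: "c \<in> C" "P c (Max (insert 0 (f ` C)))" using assms(2) by blast
  then have "f c \<le> Max (insert 0 (f ` C))" using assms(1) by simp
  then show False using f c assms(3) by blast
qed

text \<open>The exponent found by rearranging depends on the starting position, but it is bounded,
  and an exponent that works from one position works from all earlier ones. Hence a single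
  \<open>c\<close> serves all positions, and with them all \<open>x\<close>.\<close>

lemma shift_descent:
  assumes g: "\<gamma> \<in> Geo G S" and s: "s \<in> recurrent_letters \<gamma>" and t: "t \<in> recurrent_letters \<gamma>"
    and ne: "w s t \<noteq> 0" and e: "e = 1 \<or> e = (-1::int)"
  shows "\<exists>c>0. \<forall>x\<in>carrier G. bus \<gamma> (zs x (- (e * c))) \<le> bus \<gamma> x"
proof -
  obtain M where M: "\<And>a b. a \<in> S \<Longrightarrow> b \<in> S \<Longrightarrow> \<bar>w a b\<bar> \<le> M" using w_bounded by blast
  let ?P = "\<lambda>c m0. \<exists>m\<ge>m0. len (inv (pre \<gamma> m0) \<otimes> zs (pre \<gamma> m) (e * c)) \<le> m - m0"
  have anti: "?P c m'" if mm: "m' \<le> m0" and P: "?P c m0" for c m' m0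
  proof -
    obtain m where m: "m \<ge> m0" "len (inv (pre \<gamma> m0) \<otimes> zs (pre \<gamma> m) (e * c)) \<le> m - m0"
      using P by blast
    let ?A = "map \<gamma> [m'..<m0]"
    have A: "set ?A \<subseteq> S" using segment_S[OF g] .
    have eq: "inv (pre \<gamma> m') \<otimes> zs (pre \<gamma> m) (e * c) = ev ?A \<otimes> (inv (pre \<gamma> m0) \<otimes> zs (pre \<gamma> m) (e * c))"
      using A g by (simp add: pre_split[OF g mm] inv_mult_group m_assoc[symmetric])
    have "len (ev ?A \<otimes> (inv (pre \<gamma> m0) \<otimes> zs (pre \<gamma> m) (e * c))) \<le>
        len (ev ?A) + len (inv (pre \<gamma> m0) \<otimes> zs (pre \<gamma> m) (e * c))"
      using A g by (intro len_mult) auto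
    moreover have "len (ev ?A) \<le> m0 - m'" using len_ev_le[OF A] by simp
    ultimately have "len (inv (pre \<gamma> m') \<otimes> zs (pre \<gamma> m) (e * c)) \<le> m - m'"
      unfolding eq using m mm by linarith
    then show ?thesis using m mm by (intro exI[of _ m]) linarith
  qed
  have "\<exists>c\<in>{1..M}. \<forall>m0. ?P c m0"
  proof (rule eventually_const_choice)
    show "\<exists>c\<in>{1..M}. ?P c n" for n
      using rearrange_tail[OF g s t ne M e, of n] by auto
  qed (use anti in auto)
  then obtain c where c: "c \<in> {1..M}" "\<And>m0. ?P c m0" by blast
  have "bus \<gamma> (zs x (- (e * c))) \<le> bus \<gamma> x" if x: "x \<in> carrier G" for x
  proof -
    obtain N where N: "\<forall>n\<ge>N. int (len (inv (pre \<gamma> n) \<otimes> x)) = bus \<gamma> x + int n"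
      using bus_eventually[OF g x] by blast
    obtain m where m: "m \<ge> N" "len (inv (pre \<gamma> N) \<otimes> zs (pre \<gamma> m) (e * c)) \<le> m - N"
      using c(2) by blast
    let ?h = "inv (pre \<gamma> N) \<otimes> zs (pre \<gamma> m) (e * c)"
    \<comment> \<open>Shifting the endpoint of the ray by \<open>e * c\<close> is the same as
      shifting \<open>x\<close> by \<open>- (e * c)\<close>: the short element \<open>?h\<close>
      leads from \<open>pre \<gamma> N\<close> to the shifted endpoint.\<close>
    have "inv (pre \<gamma> m) \<otimes> zs x (- (e * c)) = inv ?h \<otimes> (inv (pre \<gamma> N) \<otimes> x)"
      using g x by (simp add: inv_mult_group m_assoc) (simp add: m_assoc[symmetric])
    then have "len (inv (pre \<gamma> m) \<otimes> zs x (- (e * c))) \<le> len ?h + len (inv (pre \<gamma> N) \<otimes> x)"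
      using len_mult[of "inv ?h" "inv (pre \<gamma> N) \<otimes> x"] len_inv[of ?h] g x by simp
    then show ?thesis
      using bus_le[OF g, of "zs x (- (e * c))" m] x m N[rule_format, of N] by simp
  qed
  then show ?thesis using c by (intro exI[of _ c]) auto
qed

text \<open>Making \<open>c2\<close> moves by \<open>c1\<close>, or \<open>c1\<close> moves by
  \<open>- c2\<close>, covers the same distance \<open>c1 * c2\<close> in opposite directions, so
  the two inequalities combine to an equality. Central shifts do not change \<open>w y q\<close>,
  which makes the restriction to a level consistent.\<close>

lemma zs_period:
  assumes q: "q \<in> carrier G" and c: "0 < c1" "0 < c2"
    and d1: "\<And>y. y \<in> carrier G \<Longrightarrow> w y q = l \<Longrightarrow> bus \<gamma> (zs y c1) \<le> bus \<gamma> y"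
    and d2: "\<And>y. y \<in> carrier G \<Longrightarrow> w y q = l \<Longrightarrow> bus \<gamma> (zs y (- c2)) \<le> bus \<gamma> y"
  shows "\<exists>k>0. \<forall>y\<in>carrier G. w y q = l \<longrightarrow> bus \<gamma> (zs y k) = bus \<gamma> y"
proof -
  have it: "bus \<gamma> (zs y (int n * c)) \<le> bus \<gamma> y"
    if "\<And>y. y \<in> carrier G \<Longrightarrow> w y q = l \<Longrightarrow> bus \<gamma> (zs y c) \<le> bus \<gamma> y"
      and y: "y \<in> carrier G" "w y q = l" for c n y
  proof (induction n)
    case (Suc n)
    have "zs y (int (Suc n) * c) = zs (zs y (int n * c)) c"
      using y by (simp add: algebra_simps)
    then have "bus \<gamma> (zs y (int (Suc n) * c)) \<le> bus \<gamma> (zs y (int n * c))"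
      using that(1)[of "zs y (int n * c)"] y q by simp
    then show ?case using Suc by linarith
  qed (use y in auto)
  let ?k = "c1 * c2"
  have le: "bus \<gamma> (zs y ?k) \<le> bus \<gamma> y" and ge: "bus \<gamma> (zs y (- ?k)) \<le> bus \<gamma> y"
    if "y \<in> carrier G" "w y q = l" for y
    using it[OF d1 that, of "nat c2"] it[OF d2 that, of "nat c1"] c by (auto simp: mult.commute)
  have "bus \<gamma> (zs y ?k) = bus \<gamma> y" if y: "y \<in> carrier G" "w y q = l" for y
    using le[OF y] ge[of "zs y ?k"] y q by simp
  then show ?thesis using c by (intro exI[of _ ?k]) auto
qed

text \<open>Seen from \<open>pre \<gamma> (Suc i)\<close>, the element
  \<open>y \<otimes> \<gamma> i\<close> is the conjugate of
  \<open>inv (pre \<gamma> i) \<otimes> y\<close> by the letter. Conjugation only adds a central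
  power, and the exponent in the statement cancels it, so the distance to the ray stays the same
  while the ray advances by one letter.\<close>

lemma letter_step:
  assumes g: "\<gamma> \<in> Geo G S" and y: "y \<in> carrier G"
  shows "\<exists>N. \<forall>i\<ge>N. bus \<gamma> (zs (y \<otimes> \<gamma> i) (w (pre \<gamma> i) (\<gamma> i) - w y (\<gamma> i))) \<le> bus \<gamma> y - 1"
proof -
  obtain N where N: "\<forall>n\<ge>N. int (len (inv (pre \<gamma> n) \<otimes> y)) = bus \<gamma> y + int n"
    using bus_eventually[OF g y] by blast
  have "bus \<gamma> (zs (y \<otimes> \<gamma> i) (w (pre \<gamma> i) (\<gamma> i) - w y (\<gamma> i))) \<le> bus \<gamma> y - 1" if "i \<ge> N" for i
  proof -
    let ?d = "\<gamma> i" and ?h = "inv (pre \<gamma> i) \<otimes> y" and ?n = "w (pre \<gamma> i) (\<gamma> i) - w y (\<gamma> i)"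
    have d: "?d \<in> S" using Geo_S[OF g] .
    have "inv (pre \<gamma> (Suc i)) \<otimes> zs (y \<otimes> ?d) ?n = zs (inv ?d \<otimes> (?h \<otimes> ?d)) ?n"
      using g d y by (simp add: pre_Suc inv_mult_group m_assoc)
    also have "?h \<otimes> ?d = zs (?d \<otimes> ?h) (w ?h ?d)"
      using g d y by (intro commute_w) auto
    also have "zs (inv ?d \<otimes> zs (?d \<otimes> ?h) (w ?h ?d)) ?n = ?h"
      using g d y by (simp add: m_assoc[symmetric])
    finally show ?thesis
      using bus_le[OF g, of "zs (y \<otimes> ?d) ?n" "Suc i"] g d y N[rule_format, OF that] by simp
  qed
  then show ?thesis by blast
qed

text \<open>Beyond \<open>i0\<close> only commuting letters follow, so
  \<open>w (pre \<gamma> i) d\<close> no longer depends on \<open>i\<close>. The corrections of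
  \<open>letter_step\<close> then add up, and recurrent letters may be inserted in any
  order.\<close>

lemma commuting_word_step:
  assumes g: "\<gamma> \<in> Geo G S" and D: "commuting (recurrent_letters \<gamma>)"
    and i0: "\<forall>n\<ge>i0. \<gamma> n \<in> recurrent_letters \<gamma>"
    and q: "set q \<subseteq> recurrent_letters \<gamma>" and y: "y \<in> carrier G"
  shows "bus \<gamma> (zs (y \<otimes> ev q) (w (pre \<gamma> i0) (ev q) - w y (ev q))) \<le> bus \<gamma> y - int (length q)"
  using q y
proof (induction q arbitrary: y)
  case (Cons d q)
  have d: "d \<in> recurrent_letters \<gamma>" and q: "set q \<subseteq> recurrent_letters \<gamma>" using Cons.prems by auto
  have dS: "d \<in> S" "set q \<subseteq> S" using d q rec_S[OF g] by auto
  obtain N where N: "\<forall>i\<ge>N. bus \<gamma> (zs (y \<otimes> \<gamma> i) (w (pre \<gamma> i) (\<gamma> i) - w y (\<gamma> i))) \<le> bus \<gamma> y - 1"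
    using letter_step[OF g Cons.prems(2)] by blast
  obtain i where i: "i \<ge> max N i0" "\<gamma> i = d" using rec_recurs[OF d] by blast
  have seg: "set (map \<gamma> [i0..<i]) \<subseteq> recurrent_letters \<gamma>" using i0 by auto
  have "w (pre \<gamma> i) d = w (pre \<gamma> i0) d"
    using i commuting_ev[OF D rec_S[OF g] seg, of "[d]"] d dS g segment_S[OF g, of i0 i]
    by (simp add: pre_split[OF g, of i0 i])
  then have step: "bus \<gamma> (zs (y \<otimes> d) (w (pre \<gamma> i0) d - w y d)) \<le> bus \<gamma> y - 1"
    using N i by auto
  let ?y = "zs (y \<otimes> d) (w (pre \<gamma> i0) d - w y d)"
  have "w d (ev q) = 0" using commuting_ev[OF D rec_S[OF g], of "[d]" q] d q dS by simp
  then have "zs (?y \<otimes> ev q) (w (pre \<gamma> i0) (ev q) - w ?y (ev q)) =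
      zs (y \<otimes> ev (d # q)) (w (pre \<gamma> i0) (ev (d # q)) - w y (ev (d # q)))"
    using g dS Cons.prems(2) by (simp add: m_assoc algebra_simps)
  then show ?case
    using Cons.IH[OF q, of ?y] Cons.prems(2) dS step by simp
qed (use pre_closed[OF g] in auto)

text \<open>Along \<open>q\<close> the function drops by \<open>length q\<close>, up to a central
  correction; returning along the equally long \<open>U\<close> loses no more than that. What
  remains is a pure central move.\<close>

lemma commuting_shift:
  assumes g: "\<gamma> \<in> Geo G S" and D: "commuting (recurrent_letters \<gamma>)"
    and i0: "\<forall>n\<ge>i0. \<gamma> n \<in> recurrent_letters \<gamma>"
    and q: "set q \<subseteq> recurrent_letters \<gamma>" and U: "set U \<subseteq> S" "length U = length q" "ev q = zs (ev U) c"
    and y: "y \<in> carrier G"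
  shows "bus \<gamma> (zs y (c + w (pre \<gamma> i0) (ev q) - w y (ev q))) \<le> bus \<gamma> y"
proof -
  have qS: "set q \<subseteq> S" using q rec_S[OF g] by auto
  let ?n = "w (pre \<gamma> i0) (ev q) - w y (ev q)"
  have "bus \<gamma> (zs y (c + ?n)) \<le> bus \<gamma> (zs y (c + ?n) \<otimes> ev U) + int (length U)"
    using bus_lipschitz_word_back[OF g _ U(1)] y by simp
  also have "zs y (c + ?n) \<otimes> ev U = zs (y \<otimes> ev q) ?n"
    using y U by simp
  finally show ?thesis
    using commuting_word_step[OF g D i0 q y] U(2) by (simp add: algebra_simps)
qed

text \<open>If two recurrent letters fail to commute, \<open>shift_descent\<close> gives shifts in
  both directions and \<open>q\<close> can be the identity. Otherwise \<open>q\<close> is the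
  recurrent side of a relation involving \<open>a\<close> and \<open>b\<close>, and the other side
  of its powers is reordered. The size of the resulting shifts involves \<open>w y q\<close>, whence
  the restriction to a level \<open>l\<close>.\<close>

lemma period_ex:
  assumes g: "\<gamma> \<in> Geo G S" and a: "a \<in> face_letters (recurrent_letters \<gamma>)"
    and b: "b \<in> face_letters (recurrent_letters \<gamma>)" and ne: "w a b \<noteq> 0"
  shows "\<exists>q\<in>carrier G. (\<forall>d\<in>recurrent_letters \<gamma>. w d q = 0) \<and>
    (\<forall>l. \<exists>k>0. \<forall>y\<in>carrier G. w y q = l \<longrightarrow> bus \<gamma> (zs y k) = bus \<gamma> y)"
proof (cases "commuting (recurrent_letters \<gamma>)")
  case False
  then obtain s t where st: "s \<in> recurrent_letters \<gamma>" "t \<in> recurrent_letters \<gamma>" "w s t \<noteq> 0"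
    unfolding commuting_def by blast
  obtain c1 where c1: "c1 > 0" "\<forall>x\<in>carrier G. bus \<gamma> (zs x (- c1)) \<le> bus \<gamma> x"
    using shift_descent[OF g st, of 1] by auto
  obtain c2 where c2: "c2 > 0" "\<forall>x\<in>carrier G. bus \<gamma> (zs x c2) \<le> bus \<gamma> x"
    using shift_descent[OF g st, of "-1"] by auto
  have "\<exists>k>0. \<forall>y\<in>carrier G. w y \<one> = l \<longrightarrow> bus \<gamma> (zs y k) = bus \<gamma> y" for l
    using c1 c2 by (intro zs_period[of \<one> c2 c1]) auto
  then show ?thesis using rec_S[OF g] by (intro bexI[of _ \<one>]) auto
next
  case True
  let ?D = "recurrent_letters \<gamma>"
  obtain i0 where i0: "\<forall>n\<ge>i0. \<gamma> n \<in> ?D" using eventually_rec[OF g] by blast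
  obtain ua qa ca where A: "a \<in> S" "set ua \<subseteq> S" "set qa \<subseteq> ?D" "length qa = Suc (length ua)"
      "ev (a # ua) = zs (ev qa) ca"
    using a unfolding face_letters_def by blast
  obtain ub qb cb where B: "b \<in> S" "set ub \<subseteq> S" "set qb \<subseteq> ?D" "length qb = Suc (length ub)"
      "ev (b # ub) = zs (ev qb) cb"
    using b unfolding face_letters_def by blast
  \<comment> \<open>The relations for \<open>a\<close> and \<open>b\<close> are added, so that both
    letters occur on the same side \<open>v\<close> of one relation with \<open>q\<close>.\<close>
  define q r v where "q = qa @ qb" and "r = ua @ ub" and "v = a # b # r"
  have qD: "set q \<subseteq> ?D" and qS: "set q \<subseteq> S" and S: "set qa \<subseteq> S" "set qb \<subseteq> S"
    using A B rec_S[OF g] by (auto simp: q_def)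
  have rS: "set r \<subseteq> S" and vS: "set v \<subseteq> S" using A B by (auto simp: r_def v_def)
  have "\<exists>c. ev ((a # ua) @ (b # ub)) = zs (ev v) c"
    by (rule ev_permute_mod) (use A B in \<open>auto simp: v_def r_def\<close>)
  moreover have "ev ((a # ua) @ (b # ub)) = ev (a # ua) \<otimes> ev (b # ub)"
    using A B by (intro ev_append_S) auto
  ultimately obtain c' where "zs (ev qa) ca \<otimes> zs (ev qb) cb = zs (ev v) c'"
    using A(5) B(5) by auto
  then have "zs (ev q) (cb + ca) = zs (ev v) c'" using S by (simp add: q_def add.commute)
  then obtain c0 where c0: "ev q = zs (ev v) c0" using qS vS by (auto simp: zs_eq_iff)
  have lenv: "length v = length q" using A B by (simp add: v_def r_def q_def)
  have wdq: "\<forall>d\<in>?D. w d (ev q) = 0"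
    using commuting_ev[OF True rec_S[OF g], of "[d]" q for d] qD rec_S[OF g] by fastforce
  \<comment> \<open>Both rearrangements of the word \<open>v\<^sup>2\<^sup>i\<close> below have area \<open>4 i\<^sup>2 w a b\<close>, up to sign, which
      dominates the linear correction terms.\<close>
  have shift: "bus \<gamma> (zs y (int i * (area v + 2 * c0 + 2 * w (pre \<gamma> i0) (ev q) - 2 * w y (ev q))
      + e * 2 * (int i)\<^sup>2 * w a b)) \<le> bus \<gamma> y"
    if y: "y \<in> carrier G" and e: "e = 1 \<or> e = (-1::int)" for y i e
  proof -
    \<comment> \<open>The \<open>2 * i\<close> copies of \<open>r\<close> are split evenly around
      the middle block, the second half reversed. Their areas cancel, and since both halves agree
      modulo the centre, so do their pairings with the middle; only \<open>a\<close> against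
      \<open>b\<close> contributes.\<close>
    let ?R = "concat (replicate i r)"
    let ?W = "?R @ replicate (2 * i) a @ replicate (2 * i) b @ rev ?R"
    define U where "U = (if e = -1 then ?W else rev ?W)"
    have R: "set ?R \<subseteq> S" "set (rev ?R) \<subseteq> S" using rS by auto
    have rep: "set (replicate (2 * i) a) \<subseteq> S" "set (replicate (2 * i) b) \<subseteq> S" using A B by auto
    then have WS: "set ?W \<subseteq> S" using R by auto
    have "\<exists>c. ev (rev ?R) = zs (ev ?R) c" using R by (intro ev_permute_mod) auto
    then obtain cR where cR: "ev (rev ?R) = zs (ev ?R) cR" by blast
    have aW: "area ?W = 4 * (int i)\<^sup>2 * w a b"
    proof -
      define x where "x = ev ?R"
      have x: "x \<in> carrier G" using R by (simp add: x_def)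
      have "area ?W = area ?R + (w (a [^] (2 * i)) (b [^] (2 * i) \<otimes> zs x cR) +
          (w (b [^] (2 * i)) (zs x cR) - area ?R)) + w x (a [^] (2 * i) \<otimes> (b [^] (2 * i) \<otimes> zs x cR))"
        using R rep A B cR by (simp add: x_def del: area_concat_replicate ev_concat_replicate set_rev
            set_concat set_replicate)
      also have "\<dots> = w (a [^] (2 * i)) (b [^] (2 * i))"
        using x A B w_swap[of x "a [^] (2 * i)"] w_swap[of x "b [^] (2 * i)"] by (simp del: w_pow)
      finally show ?thesis using A B by (simp add: power2_eq_square)
    qed
    have US: "set U \<subseteq> S" using WS by (auto simp: U_def)
    have aU: "area U = - e * 4 * (int i)\<^sup>2 * w a b"
      using aW area_rev[OF WS] e by (auto simp: U_def simp del: rev_append)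
    have V: "set (concat (replicate (2 * i) v)) \<subseteq> S" using vS by auto
    have "mset (concat (replicate (2 * i) v)) = mset ?W"
    proof -
      have "mset (concat (replicate n v)) = mset (concat (replicate n r)) + replicate_mset n a + replicate_mset n b" for n
        by (induction n) (auto simp: v_def)
      moreover have "concat (replicate (2 * i) r) = ?R @ ?R"
        by (metis concat_append mult_2 replicate_add)
      ultimately show ?thesis by (simp add: ac_simps)
    qed
    then have mU: "mset (concat (replicate (2 * i) v)) = mset U"
      by (simp add: U_def ac_simps)
    then obtain c where c: "ev (concat (replicate (2 * i) v)) = zs (ev U) c"
        "2 * c = int (2 * i) * area v - area U"
      using ev_permute[OF V, of U] area_concat_replicate[OF vS] by auto
    let ?q = "concat (replicate (2 * i) q)"
    have "ev ?q = ev q [^] (2 * i)" using qS by simp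
    also have "\<dots> = zs (ev v [^] (2 * i)) (c0 * int (2 * i))" using c0 vS by (simp add: zs_pow)
    also have "ev v [^] (2 * i) = zs (ev U) c" using c(1) vS by simp
    finally have evq: "ev ?q = zs (ev U) (c + 2 * int i * c0)" using US by (simp add: mult.commute)
    have lenU: "length U = length ?q"
    proof -
      have "length U = length (concat (replicate (2 * i) v))" using mU by (metis size_mset)
      then show ?thesis using lenv by (simp add: length_concat)
    qed
    have "set ?q \<subseteq> ?D" using qD by auto
    from commuting_shift[OF g True i0 this US lenU evq y]
    have "bus \<gamma> (zs y (c + 2 * int i * c0 + w (pre \<gamma> i0) (ev ?q) - w y (ev ?q))) \<le> bus \<gamma> y" .
    moreover have "c + 2 * int i * c0 + w (pre \<gamma> i0) (ev ?q) - w y (ev ?q) =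
        int i * (area v + 2 * c0 + 2 * w (pre \<gamma> i0) (ev q) - 2 * w y (ev q)) + e * 2 * (int i)\<^sup>2 * w a b"
      using c(2) aU qS g y by (simp add: algebra_simps)
    ultimately show ?thesis by simp
  qed
  have "\<exists>k>0. \<forall>y\<in>carrier G. w y (ev q) = l \<longrightarrow> bus \<gamma> (zs y k) = bus \<gamma> y" for l
  proof -
    define L where "L = area v + 2 * c0 + 2 * w (pre \<gamma> i0) (ev q) - 2 * l"
    \<comment> \<open>With \<open>i\<close> above \<open>\<bar>L\<bar>\<close> the quadratic term
      exceeds \<open>i * L\<close>, so the two signs of \<open>e\<close> produce shifts in two
      opposite directions. As \<open>L\<close> involves \<open>l\<close>, the period depends on the
      level.\<close>
    define i where "i = nat (\<bar>L\<bar> + 1)"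
    have i: "int i = \<bar>L\<bar> + 1" by (simp add: i_def)
    have sq: "int i * \<bar>L\<bar> < 2 * (int i)\<^sup>2 * \<bar>w a b\<bar>"
    proof -
      have "int i * \<bar>L\<bar> < int i * int i" using i by simp
      also have "\<dots> \<le> (int i)\<^sup>2 * (2 * \<bar>w a b\<bar>)"
        using ne unfolding power2_eq_square by (intro mult_le_cancel_left1[THEN iffD2]) auto
      finally show ?thesis by (simp add: algebra_simps)
    qed
    define e :: int where "e = (if w a b > 0 then 1 else -1)"
    have e: "e = 1 \<or> e = -1" and ew: "e * w a b = \<bar>w a b\<bar>" by (auto simp: e_def)
    let ?c1 = "int i * L + 2 * (int i)\<^sup>2 * \<bar>w a b\<bar>" and ?c2 = "2 * (int i)\<^sup>2 * \<bar>w a b\<bar> - int i * L"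
    have iL: "\<bar>int i * L\<bar> = int i * \<bar>L\<bar>" by (simp add: abs_mult)
    show ?thesis
    proof (rule zs_period)
      show "ev q \<in> carrier G" using qS by simp
      show "0 < ?c1" "0 < ?c2" using sq iL by linarith+
      fix y assume y: "y \<in> carrier G" "w y (ev q) = l"
      have "e * 2 * (int i)\<^sup>2 * w a b = 2 * (int i)\<^sup>2 * (e * w a b)" by (simp only: ac_simps)
      then have "e * 2 * (int i)\<^sup>2 * w a b = 2 * (int i)\<^sup>2 * \<bar>w a b\<bar>" by (simp only: ew)
      then have c: "int i * L + e * 2 * (int i)\<^sup>2 * w a b = ?c1"
        "int i * L + (- e) * 2 * (int i)\<^sup>2 * w a b = - ?c2"
        by simp_all
      have L: "area v + 2 * c0 + 2 * w (pre \<gamma> i0) (ev q) - 2 * w y (ev q) = L"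
        using y(2) by (simp add: L_def)
      have e': "- e = 1 \<or> - e = -1" using e by linarith
      show "bus \<gamma> (zs y ?c1) \<le> bus \<gamma> y" "bus \<gamma> (zs y (- ?c2)) \<le> bus \<gamma> y"
        using shift[OF y(1) e, of i] shift[OF y(1) e', of i] unfolding L c .
    qed
  qed
  then show ?thesis using qS wdq by (intro bexI[of _ "ev q"]) auto
qed


lemma zs_period_mult:
  assumes q: "q \<in> carrier G" and k: "\<forall>y\<in>carrier G. w y q = l \<longrightarrow> bus \<gamma> (zs y k) = bus \<gamma> y"
    and y: "y \<in> carrier G" "w y q = l"
  shows "bus \<gamma> (zs y (k * j)) = bus \<gamma> y"
proof -
  have nat: "bus \<gamma> (zs y (k * int n)) = bus \<gamma> y" if "y \<in> carrier G" "w y q = l" for y n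
  proof (induction n)
    case (Suc n)
    have "zs y (k * int (Suc n)) = zs (zs y (k * int n)) k"
      using that by (simp add: algebra_simps)
    then show ?case using Suc k[rule_format, of "zs y (k * int n)"] that q by simp
  qed (use that in auto)
  show ?thesis
  proof (cases j rule: int_cases2)
    case (nonneg n)
    then show ?thesis using nat[OF y] by simp
  next
    case (nonpos n)
    then show ?thesis using nat[of "zs y (k * j)" n] y q by simp
  qed
qed

text \<open>Modulo the period, the central correction in \<open>letter_step\<close> can be taken to
  be the same at every step. Repeating the step as many times as the period says makes the total
  correction a multiple of the period, so \<open>bus\<close> drops along the corresponding
  uncorrected power of \<open>d\<close>; the Lipschitz bound then isolates the first
  \<open>d\<close>.\<close>

lemma recurrent_step:
  assumes g: "\<gamma> \<in> Geo G S" and a: "a \<in> face_letters (recurrent_letters \<gamma>)"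
    and b: "b \<in> face_letters (recurrent_letters \<gamma>)" and ne: "w a b \<noteq> 0"
    and d: "d \<in> recurrent_letters \<gamma>" and x: "x \<in> carrier G"
  shows "bus \<gamma> (x \<otimes> d) \<le> bus \<gamma> x - 1"
proof -
  obtain q where q: "q \<in> carrier G" "\<forall>d\<in>recurrent_letters \<gamma>. w d q = 0"
    "\<forall>l. \<exists>k>0. \<forall>y\<in>carrier G. w y q = l \<longrightarrow> bus \<gamma> (zs y k) = bus \<gamma> y"
    using period_ex[OF g a b ne] by blast
  define l where "l = w x q"
  obtain k where k: "k > 0" "\<forall>y\<in>carrier G. w y q = l \<longrightarrow> bus \<gamma> (zs y k) = bus \<gamma> y"
    using q(3) by blast
  have dS: "d \<in> S" and dq: "w d q = 0" using d rec_S[OF g] q(2) by auto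
  \<comment> \<open>The exponent varies with the occurrence of \<open>d\<close>, but only its
    residue modulo \<open>k\<close> matters. One residue is taken infinitely often, hence at
    occurrences late enough for any \<open>y\<close> on the level.\<close>
  let ?A = "{i. \<gamma> i = d}" and ?f = "\<lambda>i. w (pre \<gamma> i) d mod k"
  have "infinite ?A" using d by (simp add: recurrent_letters_def)
  moreover have "?f ` ?A \<subseteq> {0..<k}" using k(1) by auto
  then have "finite (?f ` ?A)" by (rule finite_subset) simp
  ultimately obtain i0 where i0: "infinite {i \<in> ?A. ?f i = ?f i0}"
    using pigeonhole_infinite by blast
  define \<rho> where "\<rho> = ?f i0"
  have one: "bus \<gamma> (zs (y \<otimes> d) (\<rho> - w y d)) \<le> bus \<gamma> y - 1" if y: "y \<in> carrier G" "w y q = l" for y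
  proof -
    obtain N where N: "\<forall>i\<ge>N. bus \<gamma> (zs (y \<otimes> \<gamma> i) (w (pre \<gamma> i) (\<gamma> i) - w y (\<gamma> i))) \<le> bus \<gamma> y - 1"
      using letter_step[OF g y(1)] by blast
    obtain i where i: "i \<ge> N" "\<gamma> i = d" "?f i = \<rho>"
      using i0 unfolding infinite_nat_iff_unbounded_le \<rho>_def by blast
    let ?u = "zs (y \<otimes> d) (\<rho> - w y d)"
    have u: "?u \<in> carrier G" "w ?u q = l" using y dS dq q(1) by auto
    have "w (pre \<gamma> i) d = \<rho> + k * (w (pre \<gamma> i) d div k)" using i(3) by (metis mod_mult_div_eq)
    then have "zs (y \<otimes> d) (w (pre \<gamma> i) d - w y d) = zs ?u (k * (w (pre \<gamma> i) d div k))"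
      using y dS by simp
    then show ?thesis
      using zs_period_mult[OF q(1) k(2) u, of "w (pre \<gamma> i) d div k"] N i by auto
  qed
  have pow: "bus \<gamma> (zs (x \<otimes> d [^] n) (int n * (\<rho> - w x d))) \<le> bus \<gamma> x - int n" for n :: nat
  proof (induction n)
    case (Suc n)
    let ?u = "zs (x \<otimes> d [^] n) (int n * (\<rho> - w x d))"
    have "?u \<in> carrier G" "w ?u q = l" "w ?u d = w x d"
      using x dS dq q(1) by (auto simp: l_def)
    moreover from this have "zs (?u \<otimes> d) (\<rho> - w x d) = zs (x \<otimes> d [^] Suc n) (int (Suc n) * (\<rho> - w x d))"
      using x dS by (simp add: m_assoc algebra_simps)
    ultimately show ?case using one[of ?u] Suc by auto
  qed (use x in auto)
  obtain k' where k': "nat k = Suc k'" using k(1) by (metis Suc_nat_eq_nat_zadd1 int_one_le_iff_zero_less nat_0_le nat_eq_iff2 not0_implies_Suc zero_less_nat_eq less_numeral_extra(3))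
  have kk: "int (nat k) = k" using k(1) by simp
  have wl: "w (x \<otimes> d [^] nat k) q = l" using x dS dq q(1) by (simp add: l_def)
  have "bus \<gamma> (x \<otimes> d [^] nat k) = bus \<gamma> (zs (x \<otimes> d [^] nat k) (k * (\<rho> - w x d)))"
    using zs_period_mult[OF q(1) k(2) _ wl] x dS by simp
  also have "\<dots> \<le> bus \<gamma> x - k" using pow[of "nat k", unfolded kk] .
  finally have 1: "bus \<gamma> (x \<otimes> d [^] nat k) \<le> bus \<gamma> x - k" .
  have "x \<otimes> d [^] nat k = (x \<otimes> d) \<otimes> ev (replicate k' d)"
    using x dS k' nat_pow_Suc2[of d k'] by (simp add: m_assoc)
  moreover have "set (replicate k' d) \<subseteq> S" using dS by auto
  ultimately have "bus \<gamma> (x \<otimes> d) \<le> bus \<gamma> (x \<otimes> d [^] nat k) + int k'"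
    using bus_lipschitz_word_back[OF g, of "x \<otimes> d" "replicate k' d"] x dS by simp
  then show ?thesis using 1 k' kk by linarith
qed

text \<open>The relation trades a power of \<open>s # u\<close> for the same power of the recurrent
  word \<open>v\<close>, along which \<open>bus\<close> drops by one per letter. Going back over all
  letters but the first \<open>s\<close> raises it by at most their number, so \<open>s\<close>
  accounts for the missing one.\<close>

lemma face_letter_step:
  assumes g: "\<gamma> \<in> Geo G S" and nc: "\<not> commuting (face_letters (recurrent_letters \<gamma>))"
    and s: "s \<in> face_letters (recurrent_letters \<gamma>)" and x: "x \<in> carrier G"
  shows "bus \<gamma> (x \<otimes> s) \<le> bus \<gamma> x - 1"
proof -
  obtain a b where ab: "a \<in> face_letters (recurrent_letters \<gamma>)" "b \<in> face_letters (recurrent_letters \<gamma>)"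
      "w a b \<noteq> 0"
    using nc unfolding commuting_def by blast
  have word: "bus \<gamma> (x \<otimes> ev v) \<le> bus \<gamma> x - int (length v)"
    if "x \<in> carrier G" "set v \<subseteq> recurrent_letters \<gamma>" for x v
    using that
  proof (induction v arbitrary: x)
    case (Cons d v)
    then have "d \<in> S" "set v \<subseteq> S" using rec_S[OF g] by auto
    then show ?case
      using Cons.IH[of "x \<otimes> d"] Cons.prems recurrent_step[OF g ab, of d x] by (simp add: m_assoc)
  qed auto
  obtain q where q: "q \<in> carrier G" "\<forall>d\<in>recurrent_letters \<gamma>. w d q = 0"
    "\<forall>l. \<exists>k>0. \<forall>y\<in>carrier G. w y q = l \<longrightarrow> bus \<gamma> (zs y k) = bus \<gamma> y"
    using period_ex[OF g ab] by blast
  obtain k where k: "k > 0" "\<forall>y\<in>carrier G. w y q = w x q \<longrightarrow> bus \<gamma> (zs y k) = bus \<gamma> y"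
    using q(3) by blast
  obtain u v c where uv: "s \<in> S" "set u \<subseteq> S" "set v \<subseteq> recurrent_letters \<gamma>"
      "length v = Suc (length u)" "ev (s # u) = zs (ev v) c"
    using s unfolding face_letters_def by blast
  have vS: "set v \<subseteq> S" using uv(3) rec_S[OF g] by auto
  have su: "set (s # u) \<subseteq> S" using uv by auto
  \<comment> \<open>Raised to the period, the relation has central discrepancy \<open>k * c\<close>,
    which \<open>bus\<close> does not see on this level.\<close>
  define n where "n = nat k"
  have n: "int n = k" "n > 0" using k(1) by (auto simp: n_def)
  then obtain n' where n': "n = Suc n'" using not0_implies_Suc by blast
  let ?V = "concat (replicate n v)"
  have V: "set ?V \<subseteq> recurrent_letters \<gamma>" "length ?V = n * length v"
    using uv(3) by (auto simp: length_concat sum_list_replicate)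
  have "w (ev v) q = 0" using w_ev_left[OF vS q(1)] q(2) uv(3) by blast
  then have "bus \<gamma> (zs (x \<otimes> ev v [^] n) (k * c)) = bus \<gamma> (x \<otimes> ev v [^] n)"
    using zs_period_mult[OF q(1) k(2), of "x \<otimes> ev v [^] n" c] x vS q(1) by simp
  also have "\<dots> \<le> bus \<gamma> x - int (n * length v)"
    using word[OF x V(1)] V(2) vS by simp
  finally have 1: "bus \<gamma> (zs (x \<otimes> ev v [^] n) (k * c)) \<le> bus \<gamma> x - int (n * length v)" .
  let ?W = "u @ concat (replicate n' (s # u))"
  have W: "set ?W \<subseteq> S" "set (concat (replicate n' (s # u))) \<subseteq> S" using uv by auto
  have "ev (concat (replicate n (s # u))) = ev (s # u) [^] n"
    by (rule ev_concat_replicate[OF su])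
  moreover have "concat (replicate n (s # u)) = s # ?W" by (simp add: n')
  ultimately have "s \<otimes> ev ?W = ev (s # u) [^] n" by (metis ev_Cons)
  also have "\<dots> = zs (ev v [^] n) (c * k)" using uv(5) vS n by (simp add: zs_pow)
  finally have "(x \<otimes> s) \<otimes> ev ?W = zs (x \<otimes> ev v [^] n) (k * c)"
    using x uv(1) W vS by (simp add: m_assoc mult.commute del: ev_append_S ev_append)
  moreover have "length ?W = length u + n' * Suc (length u)"
    by (simp add: length_concat sum_list_replicate)
  then have "int (length ?W) = int (n * length v) - 1"
    using uv(4) n' by simp
  ultimately show ?thesis
    using bus_lipschitz_word_back[OF g, of "x \<otimes> s" ?W] W x uv(1) 1 by simp
qed

lemma bus_le_noncommuting:
  assumes g: "\<gamma>1 \<in> Geo G S" "\<gamma>2 \<in> Geo G S"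
    and nc: "\<not> commuting (face_letters (recurrent_letters \<gamma>1))"
    and l: "\<And>n. \<gamma>2 n \<in> face_letters (recurrent_letters \<gamma>1)" and x: "x \<in> carrier G"
  shows "bus \<gamma>1 x \<le> bus \<gamma>2 x"
proof (rule bus_le_bus[OF g x])
  show "bus \<gamma>1 (pre \<gamma>2 n) \<le> - int n" for n
  proof (induction n)
    case (Suc n)
    then show ?case using face_letter_step[OF g(1) nc l, of "pre \<gamma>2 n" n] g by (simp add: pre_Suc)
  qed (use g in auto)
qed

section \<open>Properness of the face of a ray\<close>

lemma not_commuting_S: "\<not> commuting S"
proof
  assume c: "commuting S"
  obtain x y where xy: "x \<in> carrier G" "y \<in> carrier G" "x \<otimes> y \<noteq> y \<otimes> x" using nonabelian by blast
  obtain u v where "set u \<subseteq> S" "ev u = x" "set v \<subseteq> S" "ev v = y"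
    using word_exists xy by metis
  then show False using commuting_ev[OF c subset_refl, of u v] xy commute_iff_w by auto
qed

lemma rec_nonempty: "\<gamma> \<in> Geo G S \<Longrightarrow> recurrent_letters \<gamma> \<noteq> {}"
  using eventually_rec by blast

text \<open>Otherwise \<open>s\<close> and its inverse would each lower \<open>bus\<close> by one,
  although together they lead back to the start. The letter outside the face obtained here
  normalises the weight in \<open>exposing_weight\<close>.\<close>

lemma face_letters_proper:
  assumes g: "\<gamma> \<in> Geo G S"
  shows "face_letters (recurrent_letters \<gamma>) \<noteq> S"
proof
  assume S: "face_letters (recurrent_letters \<gamma>) = S"
  obtain s where s: "s \<in> S" using rec_nonempty[OF g] rec_S[OF g] by blast
  have nc: "\<not> commuting (face_letters (recurrent_letters \<gamma>))" using S not_commuting_S by simp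
  have step: "bus \<gamma> (x \<otimes> t) \<le> bus \<gamma> x - 1" if "t \<in> S" "x \<in> carrier G" for t x
    using face_letter_step[OF g nc] S that by simp
  show False using step[OF s one_closed] step[OF S_inv[OF s], of s] s g by simp
qed

section \<open>The commutative case\<close>

text \<open>Every letter of \<gamma>2 comes with an exact relation inside the commuting set
  \<open>X\<close>, and such relations multiply. So the \<open>n\<close>-th point of \<gamma>2 is
  completed by some \<open>u\<close> to a recurrent word of \<gamma>1 that is \<open>n\<close>
  letters longer than \<open>u\<close>.\<close>

lemma bus_le_commuting:
  assumes g: "\<gamma>1 \<in> Geo G S" "\<gamma>2 \<in> Geo G S"
    and X: "commuting X" "X \<subseteq> S" and l1: "\<And>n. \<gamma>1 n \<in> X"
    and l2: "\<And>n. \<gamma>2 n \<in> fine_letters X (recurrent_letters \<gamma>1)" and x: "x \<in> carrier G"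
  shows "bus \<gamma>1 x \<le> bus \<gamma>2 x"
proof (rule bus_le_bus[OF g x])
  let ?D = "recurrent_letters \<gamma>1"
  have DX: "?D \<subseteq> X" using l1 rec_recurs[of _ \<gamma>1] by blast
  have D: "commuting ?D" using X DX by (auto simp: commuting_def)
  obtain i0 where i0: "\<forall>n\<ge>i0. \<gamma>1 n \<in> ?D" using eventually_rec[OF g(1)] by blast
  have bq: "bus \<gamma>1 (ev q) \<le> - int (length q)" if q: "set q \<subseteq> ?D" for q
  proof -
    \<comment> \<open>The initial part of \<gamma>1 also lies in \<open>X\<close> and commutes with
      recurrent words, so the central correction in \<open>commuting_word_step\<close>
      vanishes.\<close>
    have seg: "set (map \<gamma>1 [0..<i0]) \<subseteq> X" using l1 by auto
    have "set q \<subseteq> X" using q DX by auto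
    then have "w (pre \<gamma>1 i0) (ev q) = 0"
      using commuting_ev[OF X seg, of q] by (simp add: prefix_elt_def)
    moreover have "ev q \<in> carrier G" using q DX X by simp
    ultimately show ?thesis
      using commuting_word_step[OF g(1) D i0 q one_closed] g by simp
  qed
  have "\<exists>u q. set u \<subseteq> X \<and> set q \<subseteq> ?D \<and> length q = length u + n \<and> pre \<gamma>2 n \<otimes> ev u = ev q" for n
  proof (induction n)
    case 0
    show ?case by (intro exI[of _ "[]"]) auto
  next
    case (Suc n)
    then obtain u q where u: "set u \<subseteq> X" "set q \<subseteq> ?D" "length q = length u + n" "pre \<gamma>2 n \<otimes> ev u = ev q"
      by blast
    obtain u' q' where u': "set u' \<subseteq> X" "set q' \<subseteq> ?D" "length q' = Suc (length u')"
        "ev (\<gamma>2 n # u') = ev q'"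
      using l2[of n] unfolding fine_letters_def by blast
    have S: "set u \<subseteq> S" "set q \<subseteq> S" "set u' \<subseteq> S" "set q' \<subseteq> S" using u u' DX X by auto
    have "set q' \<subseteq> X" using u'(2) DX by auto
    then have c: "ev q' \<otimes> ev u = ev u \<otimes> ev q'"
      using commuting_ev[OF X, of q' u] u(1) S commute_iff_w by simp
    have "pre \<gamma>2 (Suc n) \<otimes> ev (u' @ u) = pre \<gamma>2 n \<otimes> (ev (\<gamma>2 n # u') \<otimes> ev u)"
      using S g Geo_S[OF g(2), of n] by (simp add: pre_Suc m_assoc)
    also have "\<dots> = pre \<gamma>2 n \<otimes> (ev u \<otimes> ev q')" using u'(4) c by simp
    also have "\<dots> = ev (q @ q')" using S g u(4) by (simp flip: m_assoc)
    finally show ?case using u u' by (intro exI[of _ "u' @ u"] exI[of _ "q @ q'"]) auto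
  qed
  then show "bus \<gamma>1 (pre \<gamma>2 n) \<le> - int n" for n
  proof -
    obtain u q where u: "set u \<subseteq> X" "set q \<subseteq> ?D" "length q = length u + n" "pre \<gamma>2 n \<otimes> ev u = ev q"
      using \<open>\<And>n. \<exists>u q. _ u q n\<close> by blast
    have "set u \<subseteq> S" using u(1) X by auto
    then show ?thesis
      using bus_lipschitz_word_back[OF g(1) pre_closed[OF g(2), of n], of u] bq[OF u(2)] u by simp
  qed
qed

section \<open>Tails and orbits\<close>

lemma tail_Geo:
  fixes N n :: nat
  assumes g: "\<gamma> \<in> Geo G S"
  defines "\<gamma>' \<equiv> \<lambda>n. \<gamma> (N + n)"
  shows "\<gamma>' \<in> Geo G S" and "pre \<gamma> (N + n) = pre \<gamma> N \<otimes> pre \<gamma>' n"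
    and "recurrent_letters \<gamma>' = recurrent_letters \<gamma>"
proof -
  have S: "set (map \<gamma>' [0..<n]) \<subseteq> S" for n using Geo_S[OF g] by (auto simp: \<gamma>'_def)
  have "map \<gamma> [N..<N + n] = map \<gamma>' [0..<n]" for n
    by (rule nth_equalityI) (auto simp: \<gamma>'_def)
  then have split: "pre \<gamma> (N + n) = pre \<gamma> N \<otimes> pre \<gamma>' n" for n
    using pre_split[OF g, of N "N + n"] by (simp add: prefix_elt_def[of G \<gamma>'])
  then show "pre \<gamma> (N + n) = pre \<gamma> N \<otimes> pre \<gamma>' n" .
  have c: "pre \<gamma>' n \<in> carrier G" for n using S by (simp add: prefix_elt_def)
  have "len (pre \<gamma>' n) = n" for n
  proof (rule antisym)
    show "len (pre \<gamma>' n) \<le> n" using len_ev_le[OF S[of n]] by (simp add: prefix_elt_def)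
    show "n \<le> len (pre \<gamma>' n)"
      using len_mult[of "pre \<gamma> N" "pre \<gamma>' n"] split[of n] g c len_pre[OF g, of "N + n"]
        len_pre[OF g, of N] by simp
  qed
  then show "\<gamma>' \<in> Geo G S" using Geo_S[OF g] by (auto simp: Geo_def \<gamma>'_def)
  have "infinite {n. \<gamma> (N + n) = s} \<longleftrightarrow> infinite {n. \<gamma> n = s}" for s
  proof -
    have "{n. \<gamma> n = s} \<subseteq> {..<N} \<union> (+) N ` {n. \<gamma> (N + n) = s}"
    proof
      fix n assume "n \<in> {n. \<gamma> n = s}"
      then show "n \<in> {..<N} \<union> (+) N ` {n. \<gamma> (N + n) = s}"
        by (cases "n < N") (auto simp: image_iff intro!: exI[of _ "n - N"])
    qed
    moreover have "(+) N ` {n. \<gamma> (N + n) = s} \<subseteq> {n. \<gamma> n = s}" by auto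
    ultimately show ?thesis
      by (metis finite_Un finite_imageD finite_imageI finite_lessThan finite_subset inj_on_add)
  qed
  then show "recurrent_letters \<gamma>' = recurrent_letters \<gamma>" by (simp add: recurrent_letters_def \<gamma>'_def)
qed

text \<open>Evaluation at the identity forces \<open>c\<close> to be
  \<open>- bus \<gamma>1 g\<close>; leaving it free makes inversion and composition of such
  relations immediate.\<close>

definition same_orbit :: "(nat \<Rightarrow> 'a) \<Rightarrow> (nat \<Rightarrow> 'a) \<Rightarrow> bool" where
  "same_orbit \<gamma>1 \<gamma>2 \<longleftrightarrow> (\<exists>g\<in>carrier G. \<exists>c. \<forall>x\<in>carrier G. bus \<gamma>2 x = bus \<gamma>1 (g \<otimes> x) + c)"

lemma same_orbit_refl: "(\<And>x. x \<in> carrier G \<Longrightarrow> bus \<gamma>1 x = bus \<gamma>2 x) \<Longrightarrow> same_orbit \<gamma>1 \<gamma>2"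
  unfolding same_orbit_def by (intro bexI[of _ \<one>] exI[of _ 0]) auto

lemma same_orbit_sym:
  assumes "same_orbit \<gamma>1 \<gamma>2" shows "same_orbit \<gamma>2 \<gamma>1"
proof -
  obtain g c where g: "g \<in> carrier G" "\<forall>x\<in>carrier G. bus \<gamma>2 x = bus \<gamma>1 (g \<otimes> x) + c"
    using assms unfolding same_orbit_def by blast
  have "bus \<gamma>1 x = bus \<gamma>2 (inv g \<otimes> x) + - c" if "x \<in> carrier G" for x
    using g that by (simp flip: m_assoc)
  then show ?thesis unfolding same_orbit_def using g(1) by blast
qed

lemma same_orbit_trans:
  assumes "same_orbit \<gamma>1 \<gamma>2" "same_orbit \<gamma>2 \<gamma>3" shows "same_orbit \<gamma>1 \<gamma>3"
proof -
  obtain g c where g: "g \<in> carrier G" "\<forall>x\<in>carrier G. bus \<gamma>2 x = bus \<gamma>1 (g \<otimes> x) + c"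
    using assms(1) unfolding same_orbit_def by blast
  obtain h d where h: "h \<in> carrier G" "\<forall>x\<in>carrier G. bus \<gamma>3 x = bus \<gamma>2 (h \<otimes> x) + d"
    using assms(2) unfolding same_orbit_def by blast
  have "bus \<gamma>3 x = bus \<gamma>1 ((g \<otimes> h) \<otimes> x) + (c + d)" if "x \<in> carrier G" for x
    using g h that by (simp add: m_assoc)
  then show ?thesis unfolding same_orbit_def using g(1) h(1) by blast
qed

lemma same_orbit_tail:
  assumes g: "\<gamma> \<in> Geo G S"
  shows "same_orbit (\<lambda>n. \<gamma> (N + n)) \<gamma>"
proof -
  let ?t = "\<lambda>n. \<gamma> (N + n)"
  note t = tail_Geo[OF g, of N]
  have "bus \<gamma> x = bus ?t (inv (pre \<gamma> N) \<otimes> x) + - int N" if x: "x \<in> carrier G" for x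
  proof -
    obtain N1 where N1: "\<forall>n\<ge>N1. int (len (inv (pre \<gamma> n) \<otimes> x)) = bus \<gamma> x + int n"
      using bus_eventually[OF g x] by blast
    obtain N2 where N2: "\<forall>n\<ge>N2. int (len (inv (pre ?t n) \<otimes> (inv (pre \<gamma> N) \<otimes> x))) =
        bus ?t (inv (pre \<gamma> N) \<otimes> x) + int n"
      using bus_eventually[OF t(1), of "inv (pre \<gamma> N) \<otimes> x"] g x by auto
    let ?n = "max N1 N2"
    have "inv (pre \<gamma> (N + ?n)) \<otimes> x = inv (pre ?t ?n) \<otimes> (inv (pre \<gamma> N) \<otimes> x)"
      using t(2)[of ?n] pre_closed[OF t(1), of ?n] g x by (simp add: inv_mult_group m_assoc)
    then show ?thesis
      using N1[rule_format, of "N + ?n"] N2[rule_format, of ?n] by simp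
  qed
  then show ?thesis unfolding same_orbit_def using g by (intro bexI[of _ "inv (pre \<gamma> N)"]) auto
qed

text \<open>Within an orbit a ray may be replaced by one with recurrent letters only, so results
  that constrain all letters become available for every ray.\<close>

lemma recurrent_tail:
  assumes g: "\<gamma> \<in> Geo G S"
  obtains \<gamma>' where "\<gamma>' \<in> Geo G S" "recurrent_letters \<gamma>' = recurrent_letters \<gamma>"
    "\<And>n. \<gamma>' n \<in> recurrent_letters \<gamma>" "same_orbit \<gamma>' \<gamma>"
proof -
  obtain N where "\<forall>n\<ge>N. \<gamma> n \<in> recurrent_letters \<gamma>" using eventually_rec[OF g] by blast
  then show thesis using that[of "\<lambda>n. \<gamma> (N + n)"] tail_Geo[OF g, of N] same_orbit_tail[OF g, of N] by simp
qed

lemma same_faces_imp_same_orbit: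
  assumes g: "\<gamma>1 \<in> Geo G S" "\<gamma>2 \<in> Geo G S"
    and F: "face_letters (recurrent_letters \<gamma>1) = face_letters (recurrent_letters \<gamma>2)"
    and E: "commuting (face_letters (recurrent_letters \<gamma>1)) \<Longrightarrow>
      fine_letters (face_letters (recurrent_letters \<gamma>1)) (recurrent_letters \<gamma>1) =
      fine_letters (face_letters (recurrent_letters \<gamma>1)) (recurrent_letters \<gamma>2)"
  shows "same_orbit \<gamma>1 \<gamma>2"
proof -
  obtain d1 where d1: "d1 \<in> Geo G S" "recurrent_letters d1 = recurrent_letters \<gamma>1"
    "\<And>n. d1 n \<in> recurrent_letters \<gamma>1" "same_orbit d1 \<gamma>1" using recurrent_tail[OF g(1)] by metis
  obtain d2 where d2: "d2 \<in> Geo G S" "recurrent_letters d2 = recurrent_letters \<gamma>2"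
    "\<And>n. d2 n \<in> recurrent_letters \<gamma>2" "same_orbit d2 \<gamma>2" using recurrent_tail[OF g(2)] by metis
  let ?X = "face_letters (recurrent_letters \<gamma>1)"
  have sub: "recurrent_letters \<gamma>1 \<subseteq> ?X" "recurrent_letters \<gamma>2 \<subseteq> ?X"
    using subset_face_letters[OF rec_S[OF g(1)]] subset_face_letters[OF rec_S[OF g(2)]] F by simp_all
  have "bus d1 x = bus d2 x" if x: "x \<in> carrier G" for x
  proof (cases "commuting ?X")
    case True
    have l: "d1 n \<in> ?X" "d2 n \<in> ?X" for n using d1(3)[of n] d2(3)[of n] sub by auto
    have f: "d2 n \<in> fine_letters ?X (recurrent_letters d1)" "d1 n \<in> fine_letters ?X (recurrent_letters d2)"
      for n
      using subset_fine_letters[OF sub(1)] subset_fine_letters[OF sub(2)] d1(2,3) d2(2,3) E[OF True]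
      by auto
    show ?thesis
      using bus_le_commuting[OF d1(1) d2(1) True face_letters_S l(1) f(1) x]
        bus_le_commuting[OF d2(1) d1(1) True face_letters_S l(2) f(2) x] by (rule antisym)
  next
    case False
    have l: "d2 n \<in> face_letters (recurrent_letters d1)" "d1 n \<in> face_letters (recurrent_letters d2)"
      for n using d1(2,3) d2(2,3) sub F by auto
    have "\<not> commuting (face_letters (recurrent_letters d1))"
      "\<not> commuting (face_letters (recurrent_letters d2))" using False F d1(2) d2(2) by auto
    then show ?thesis
      using bus_le_noncommuting[OF d1(1) d2(1) _ l(1) x] bus_le_noncommuting[OF d2(1) d1(1) _ l(2) x]
      by (intro antisym)
  qed
  then have "same_orbit d1 d2" by (rule same_orbit_refl)
  then show ?thesis using d1 d2 same_orbit_sym same_orbit_trans by blast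
qed

end

section \<open>Two combinatorial lemmas\<close>

text \<open>A decreasing sequence of naturals is eventually constant, hence monotone after dropping
  finitely many terms.\<close>

lemma nat_mono_subseq:
  fixes f :: "nat \<Rightarrow> nat"
  shows "\<exists>r :: nat \<Rightarrow> nat. strict_mono r \<and> mono (\<lambda>n. f (r n))"
proof -
  obtain r :: "nat \<Rightarrow> nat" where r: "strict_mono r" "monoseq (\<lambda>n. f (r n))" using seq_monosub by blast
  from r(2) consider "\<forall>m. \<forall>n\<ge>m. f (r m) \<le> f (r n)" | "\<forall>m. \<forall>n\<ge>m. f (r n) \<le> f (r m)"
    unfolding monoseq_def by blast
  then show ?thesis
  proof cases
    case 1
    then show ?thesis using r(1) by (intro exI[of _ r]) (auto simp: mono_def)
  next
    case 2
    obtain N where N: "\<forall>n. f (r N) \<le> f (r n)"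
      using ex_has_least_nat[of "\<lambda>_. True" 0 "\<lambda>n. f (r n)"] by blast
    have c: "f (r n) = f (r N)" if "n \<ge> N" for n
      by (rule antisym[OF 2[rule_format, OF that] N[rule_format]])
    have "strict_mono (\<lambda>n. r (N + n))"
      by (rule strict_monoI) (simp add: strict_monoD[OF r(1)])
    moreover have "f (r (N + n)) = f (r N)" for n by (rule c) simp
    then have "mono (\<lambda>n. f (r (N + n)))" by (simp add: mono_def)
    ultimately show ?thesis by blast
  qed
qed

lemma dickson:
  fixes f :: "'i \<Rightarrow> nat \<Rightarrow> nat"
  assumes "finite I"
  shows "\<exists>r :: nat \<Rightarrow> nat. strict_mono r \<and> (\<forall>i\<in>I. mono (\<lambda>n. f i (r n)))"
  using assms
proof induction
  case empty
  show ?case by (intro exI[of _ id]) (auto simp: strict_mono_def)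
next
  case (insert i I)
  then obtain r :: "nat \<Rightarrow> nat" where r: "strict_mono r" "\<forall>i\<in>I. mono (\<lambda>n. f i (r n))" by blast
  obtain r' :: "nat \<Rightarrow> nat" where r': "strict_mono r'" "mono (\<lambda>n. f i (r (r' n)))"
    using nat_mono_subseq[of "\<lambda>n. f i (r n)"] by blast
  have "strict_mono (\<lambda>n. r (r' n))"
    by (rule strict_monoI) (simp add: strict_monoD[OF r(1)] strict_monoD[OF r'(1)])
  moreover have "mono (\<lambda>n. f k (r (r' n)))" if "k \<in> I" for k
    using monoD[OF r(2)[rule_format, OF that]] monoD[OF strict_mono_mono[OF r'(1)]]
    by (intro monoI) blast
  ultimately show ?case using r'(2) by (intro exI[of _ "\<lambda>n. r (r' n)"]) auto
qed

text \<open>Tucker's theorem of the alternative, for an additive group of integer vectors. Working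
  with a group instead of a linear subspace keeps the first alternative integral, so that it can be
  read as a relation between words. The induction adds one sign-constrained coordinate at a
  time.\<close>

lemma tucker_alternative:
  fixes R :: "('i \<Rightarrow> int) set"
  assumes "finite J" "R \<noteq> {}" "\<And>x y. x \<in> R \<Longrightarrow> y \<in> R \<Longrightarrow> (\<lambda>i. x i - y i) \<in> R" "s \<notin> J"
  shows "(\<exists>x\<in>R. (\<forall>i\<in>insert s J. 0 \<le> x i) \<and> 0 < x s) \<or>
    (\<exists>u::'i \<Rightarrow> real. (\<forall>i\<in>insert s J. 0 \<le> u i) \<and> 0 < u s \<and>
      (\<forall>x\<in>R. (\<Sum>i\<in>insert s J. u i * of_int (x i)) = 0))"
  using assms
proof (induction arbitrary: R)
  case empty
  obtain x0 where "x0 \<in> R" using empty(1) by blast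
  then have zero: "(\<lambda>i. 0) \<in> R" using empty(2)[of x0 x0] by simp
  show ?case
  proof (cases "\<exists>x\<in>R. x s \<noteq> 0")
    case True
    then obtain x where x: "x \<in> R" "x s \<noteq> 0" by blast
    have "(\<lambda>i. - x i) \<in> R" using empty(2)[OF zero x(1)] by simp
    show ?thesis
    proof (cases "0 < x s")
      case True
      then show ?thesis using x(1) by (intro disjI1 bexI[of _ x]) auto
    next
      case False
      then show ?thesis
        using \<open>(\<lambda>i. - x i) \<in> R\<close> x(2) by (intro disjI1 bexI[of _ "\<lambda>i. - x i"]) auto
    qed
  next
    case False
    then show ?thesis by (intro disjI2 exI[of _ "\<lambda>_. 1"]) auto
  qed
next
  case (insert t J)
  obtain x0 where "x0 \<in> R" using insert.prems(1) by blast
  then have zero: "(\<lambda>i. 0) \<in> R" using insert.prems(2)[of x0 x0] by simp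
  have neg: "(\<lambda>i. - x i) \<in> R" if "x \<in> R" for x using insert.prems(2)[OF zero that] by simp
  have add: "(\<lambda>i. x i + y i) \<in> R" if "x \<in> R" "y \<in> R" for x y
    using insert.prems(2)[OF that(1) neg[OF that(2)]] by simp
  have scale_nat: "(\<lambda>i. int n * x i) \<in> R" if "x \<in> R" for x n
  proof (induction n)
    case (Suc n)
    then show ?case using add[OF Suc that] by (simp add: algebra_simps)
  qed (use zero in auto)
  have scale: "(\<lambda>i. k * x i) \<in> R" if "x \<in> R" for x k
    using scale_nat[OF that, of "nat k"] neg[OF scale_nat[OF that, of "nat (- k)"]]
    by (cases "0 \<le> k") auto
  have st: "s \<noteq> t" "s \<notin> J" using insert.prems by auto
  let ?I = "insert s J"
  have fin: "finite ?I" "t \<notin> ?I" using insert.hyps st by auto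
  have ins: "insert s (insert t J) = insert t ?I" by auto
  show ?case
  proof (cases "\<exists>u::'i \<Rightarrow> real. (\<forall>i\<in>?I. 0 \<le> u i) \<and> 0 < u s \<and> (\<forall>x\<in>R. (\<Sum>i\<in>?I. u i * of_int (x i)) = 0)")
    case True
    then obtain u :: "'i \<Rightarrow> real" where u: "\<forall>i\<in>?I. 0 \<le> u i" "0 < u s"
      "\<forall>x\<in>R. (\<Sum>i\<in>?I. u i * of_int (x i)) = 0" by blast
    let ?u = "u(t := 0)"
    have "(\<Sum>i\<in>?I. ?u i * of_int (x i)) = (\<Sum>i\<in>?I. u i * of_int (x i))" for x :: "'i \<Rightarrow> int"
      by (rule sum.cong) (use fin in auto)
    then show ?thesis unfolding ins using u fin st
      by (intro disjI2 exI[of _ ?u]) auto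
  next
    case False
    then obtain x1 where x1: "x1 \<in> R" "\<forall>i\<in>?I. 0 \<le> x1 i" "0 < x1 s"
      using insert.IH[of R] insert.prems st by blast
    \<comment> \<open>The induction hypothesis is used a second time, for the subgroup on which the
      new coordinate vanishes.\<close>
    let ?R0 = "{x \<in> R. x t = 0}"
    have R0: "?R0 \<noteq> {}" "\<And>x y. x \<in> ?R0 \<Longrightarrow> y \<in> ?R0 \<Longrightarrow> (\<lambda>i. x i - y i) \<in> ?R0"
      using zero insert.prems(2) by auto
    show ?thesis
    proof (cases "\<exists>x\<in>?R0. (\<forall>i\<in>?I. 0 \<le> x i) \<and> 0 < x s")
      case True
      then obtain x where "x \<in> R" "x t = 0" "\<forall>i\<in>?I. 0 \<le> x i" "0 < x s" by blast
      then show ?thesis unfolding ins by (intro disjI1 bexI[of _ x]) auto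
    next
      case False
      then obtain u :: "'i \<Rightarrow> real" where u: "\<forall>i\<in>?I. 0 \<le> u i" "0 < u s"
        "\<forall>x\<in>?R0. (\<Sum>i\<in>?I. u i * of_int (x i)) = 0"
        using insert.IH[OF R0 st(2)] by blast
      define \<phi> where "\<phi> x = (\<Sum>i\<in>?I. u i * of_int (x i))" for x :: "'i \<Rightarrow> int"
      have "u s * of_int (x1 s) \<le> \<phi> x1" unfolding \<phi>_def
        using fin u(1) x1(2) by (intro member_le_sum) auto
      moreover have "0 < u s * of_int (x1 s)" using u(2) x1(3) by simp
      ultimately have pos: "0 < \<phi> x1" by linarith
      show ?thesis
      proof (cases "0 \<le> x1 t")
        case True
        then show ?thesis unfolding ins using x1 by (intro disjI1 bexI[of _ x1]) auto
      next
        case False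
        \<comment> \<open>Orthogonality to \<open>x1\<close> forces this weight at \<open>t\<close>.
          For any other \<open>x\<close> the vector \<open>x1 t * x - x t * x1\<close> lies in
          \<open>?R0\<close>, which transfers the orthogonality to \<open>x\<close>.\<close>
        define \<mu> where "\<mu> = \<phi> x1 / (- of_int (x1 t))"
        have \<mu>: "\<mu> > 0" using pos False by (simp add: \<mu>_def divide_pos_neg)
        have "\<phi> x + \<mu> * of_int (x t) = 0" if x: "x \<in> R" for x
        proof -
          let ?y = "\<lambda>i. x1 t * x i - x t * x1 i"
          have "?y \<in> ?R0" using insert.prems(2)[OF scale[OF x] scale[OF x1(1)]] by simp
          then have "\<phi> ?y = 0" unfolding \<phi>_def by (rule u(3)[rule_format])
          moreover have "\<phi> ?y = of_int (x1 t) * \<phi> x - of_int (x t) * \<phi> x1"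
            by (simp add: \<phi>_def sum_distrib_left sum_subtractf algebra_simps)
          ultimately show ?thesis using False by (simp add: \<mu>_def field_simps)
        qed
        moreover have "(\<Sum>i\<in>?I. (u(t := \<mu>)) i * of_int (x i)) = \<phi> x" for x :: "'i \<Rightarrow> int"
          unfolding \<phi>_def by (rule sum.cong) (use fin in auto)
        ultimately show ?thesis unfolding ins using u \<mu> fin st
          by (intro disjI2 exI[of _ "u(t := \<mu>)"]) (auto simp: add.commute)
      qed
    qed
  qed
qed

context two_step_group
begin

lemma left_cancelD:
  "x \<otimes> a = x \<otimes> b \<Longrightarrow> x \<in> carrier G \<Longrightarrow> a \<in> carrier G \<Longrightarrow> b \<in> carrier G \<Longrightarrow> a = b"
  by simp

section \<open>Invariance of the faces on orbits\<close>

text \<open>If \<open>bus \<gamma>2\<close> is a translate of \<open>bus \<gamma>1\<close>, the points of \<open>\<gamma>2\<close> are joined to those of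
  \<open>\<gamma>1\<close> by words \<open>v\<close>. Comparing two such joining words whose letter counts are ordered (Dickson)
  exhibits each recurrent letter of \<open>\<gamma>2\<close> in a balanced relation with those of \<open>\<gamma>1\<close>.\<close>

lemma orbit_relation:
  assumes g: "\<gamma>1 \<in> Geo G S" "\<gamma>2 \<in> Geo G S" and h: "h \<in> carrier G" and T: "T \<subseteq> S"
    and l1: "\<And>n. \<gamma>1 n \<in> D1"
    and W: "\<And>n. \<exists>m v. set v \<subseteq> T \<and> int (length v) = int m - int n + C \<and>
        h \<otimes> pre \<gamma>1 m = pre \<gamma>2 n \<otimes> ev v"
    and s: "s \<in> recurrent_letters \<gamma>2"
  shows "\<exists>p q v wd v'. set p \<subseteq> range \<gamma>2 \<and> s \<in> set p \<and> set q \<subseteq> D1 \<and> set v \<subseteq> T \<and> set wd \<subseteq> T \<and>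
    length q = length p + length wd \<and> mset v' = mset v + mset wd \<and> ev v \<otimes> ev q = ev p \<otimes> ev v'"
proof -
  obtain m v where mv: "\<And>n. set (v n) \<subseteq> T" "\<And>n. int (length (v n)) = int (m n) - int n + C"
      "\<And>n. h \<otimes> pre \<gamma>1 (m n) = pre \<gamma>2 n \<otimes> ev (v n)"
    using W by metis
  \<comment> \<open>The index \<open>None\<close> carries the position on \<gamma>1, so that one
    subsequence makes this position and all letter counts monotone together.\<close>
  define f where "f i n = (case i of None \<Rightarrow> m n | Some t \<Rightarrow> count (mset (v n)) t)" for i n
  have "finite (insert None (Some ` T))" using T finite_S finite_subset by auto
  from dickson[OF this, of f] obtain r :: "nat \<Rightarrow> nat" where r: "strict_mono r"
      "\<forall>i\<in>insert None (Some ` T). mono (\<lambda>n. f i (r n))" by blast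
  obtain i where i: "r 0 \<le> i" "\<gamma>2 i = s" using rec_recurs[OF s] by blast
  \<comment> \<open>Since \<open>r (Suc i)\<close> is at least \<open>Suc i\<close>, the segment
    from \<open>n1\<close> to \<open>n2\<close> contains position \<open>i\<close>, where
    \<open>s\<close> occurs.\<close>
  define n1 n2 where "n1 = r 0" and "n2 = r (Suc i)"
  have n: "n1 \<le> i" "i < n2" using i(1) seq_suble[OF r(1), of "Suc i"] by (auto simp: n1_def n2_def)
  have m12: "m n1 \<le> m n2"
    using r(2) by (auto simp: f_def mono_def n1_def n2_def)
  have ct: "count (mset (v n1)) t \<le> count (mset (v n2)) t" for t
  proof (cases "t \<in> T")
    case True
    then have "mono (\<lambda>n. f (Some t) (r n))" using r(2) by blast
    then show ?thesis by (auto simp: f_def mono_def n1_def n2_def)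
  next
    case False
    then have "count (mset (v n1)) t = 0" using mv(1)[of n1] by (auto simp: count_eq_zero_iff)
    then show ?thesis by (rule ord_eq_le_trans) simp
  qed
  obtain wd where wd: "mset wd = mset (v n2) - mset (v n1)" using ex_mset by blast
  have sub: "mset (v n1) \<subseteq># mset (v n2)" using ct by (simp add: subseteq_mset_def)
  then have v2: "mset (v n2) = mset (v n1) + mset wd" by (simp add: wd)
  let ?p = "map \<gamma>2 [n1..<n2]" and ?q = "map \<gamma>1 [m n1..<m n2]"
  have wdT: "set wd \<subseteq> T" using mv(1)[of n2] v2 by (metis le_sup_iff set_mset_mset set_mset_union)
  have lens: "length (v n2) = length (v n1) + length wd" using v2 by (metis size_mset size_union)
  have "length ?q = length ?p + length wd"
    using lens mv(2)[of n1] mv(2)[of n2] m12 n by simp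
  moreover have "ev (v n1) \<otimes> ev ?q = ev ?p \<otimes> ev (v n2)"
  proof -
    have S: "set ?p \<subseteq> S" "set ?q \<subseteq> S" "set (v n1) \<subseteq> S" "set (v n2) \<subseteq> S"
      using segment_S[OF g(2), of n1 n2] segment_S[OF g(1), of "m n1" "m n2"] mv(1) T by blast+
    have "pre \<gamma>2 n1 \<otimes> (ev (v n1) \<otimes> ev ?q) = (h \<otimes> pre \<gamma>1 (m n1)) \<otimes> ev ?q"
      using S g mv(3)[of n1] by (simp add: m_assoc)
    also have "\<dots> = h \<otimes> pre \<gamma>1 (m n2)"
      using pre_split[OF g(1) m12] S h g by (simp add: m_assoc)
    also have "\<dots> = pre \<gamma>2 n1 \<otimes> (ev ?p \<otimes> ev (v n2))"
      using pre_split[OF g(2), of n1 n2] n mv(3)[of n2] S g by (simp add: m_assoc)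
    finally show ?thesis using S g by simp
  qed
  moreover have "s \<in> set ?p" using n i(2) by auto
  moreover have "set ?q \<subseteq> D1" using l1 by auto
  moreover have "set ?p \<subseteq> range \<gamma>2" by auto
  ultimately show ?thesis using mv(1)[of n1] wdT v2 by blast
qed

text \<open>Taking \<open>m\<close> so large that the limit defining \<open>bus \<gamma>1\<close> is
  attained makes the joining length exact, with an excess \<open>- c\<close> that does not depend on
  \<open>n\<close>.\<close>

lemma orbit_join:
  assumes g: "\<gamma>1 \<in> Geo G S" "\<gamma>2 \<in> Geo G S" and h: "h \<in> carrier G"
    and c: "\<forall>x\<in>carrier G. bus \<gamma>2 x = bus \<gamma>1 (h \<otimes> x) + c"
  shows "\<exists>m. int (len (inv (pre \<gamma>2 n) \<otimes> (inv h \<otimes> pre \<gamma>1 m))) = int m - int n - c"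
proof -
  have "bus \<gamma>1 (h \<otimes> pre \<gamma>2 n) = - int n - c" using c bus_pre[OF g(2), of n] g by simp
  moreover obtain m where "int (len (inv (pre \<gamma>1 m) \<otimes> (h \<otimes> pre \<gamma>2 n))) = bus \<gamma>1 (h \<otimes> pre \<gamma>2 n) + int m"
    using bus_eventually[OF g(1), of "h \<otimes> pre \<gamma>2 n"] h g by auto
  moreover have "inv (inv (pre \<gamma>1 m) \<otimes> (h \<otimes> pre \<gamma>2 n)) = inv (pre \<gamma>2 n) \<otimes> (inv h \<otimes> pre \<gamma>1 m)"
    using h g by (simp add: inv_mult_group m_assoc)
  ultimately show ?thesis
    using len_inv[of "inv (pre \<gamma>1 m) \<otimes> (h \<otimes> pre \<gamma>2 n)"] h g by (intro exI[of _ m]) simp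
qed

text \<open>In the relation of \<open>orbit_relation\<close> the word \<open>v\<close> occurs on
  both sides once letters are reordered modulo the centre. Cancelling it leaves \<open>s\<close> and
  the rest of \<open>p\<close> with \<open>wd\<close> on one side, and \<open>q\<close> on the
  other.\<close>

lemma same_orbit_face_letters:
  assumes g: "\<gamma>1 \<in> Geo G S" "\<gamma>2 \<in> Geo G S" and o: "same_orbit \<gamma>1 \<gamma>2"
  shows "recurrent_letters \<gamma>2 \<subseteq> face_letters (recurrent_letters \<gamma>1)"
proof
  fix s assume s: "s \<in> recurrent_letters \<gamma>2"
  let ?D = "recurrent_letters \<gamma>1"
  obtain d where d: "d \<in> Geo G S" "recurrent_letters d = ?D" "\<And>n. d n \<in> ?D" "same_orbit d \<gamma>1"
    using recurrent_tail[OF g(1)] by metis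
  have "same_orbit d \<gamma>2" using d(4) o same_orbit_trans by blast
  then obtain h c where h: "h \<in> carrier G" and c: "\<forall>x\<in>carrier G. bus \<gamma>2 x = bus d (h \<otimes> x) + c"
    unfolding same_orbit_def by blast
  have W: "\<exists>m v. set v \<subseteq> S \<and> int (length v) = int m - int n + (- c) \<and> inv h \<otimes> pre d m = pre \<gamma>2 n \<otimes> ev v" for n
  proof -
    obtain m where m: "int (len (inv (pre \<gamma>2 n) \<otimes> (inv h \<otimes> pre d m))) = int m - int n - c"
      using orbit_join[OF d(1) g(2) h c] by blast
    obtain v where v: "set v \<subseteq> S" "ev v = inv (pre \<gamma>2 n) \<otimes> (inv h \<otimes> pre d m)"
        "length v = len (inv (pre \<gamma>2 n) \<otimes> (inv h \<otimes> pre d m))"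
      using geodesic_word[of "inv (pre \<gamma>2 n) \<otimes> (inv h \<otimes> pre d m)"] g d h by auto
    have "pre \<gamma>2 n \<otimes> ev v = inv h \<otimes> pre d m" using v(2) g d h by (simp flip: m_assoc)
    then show ?thesis using v m by (intro exI[of _ m] exI[of _ v]) simp
  qed
  obtain p q v wd v' where R: "set p \<subseteq> range \<gamma>2" "s \<in> set p" "set q \<subseteq> ?D" "set v \<subseteq> S" "set wd \<subseteq> S"
    "length q = length p + length wd" "mset v' = mset v + mset wd" "ev v \<otimes> ev q = ev p \<otimes> ev v'"
    using orbit_relation[OF d(1) g(2) inv_closed[OF h] subset_refl d(3) W s] by blast
  obtain p1 p2 where p: "p = p1 @ s # p2" using R(2) by (meson split_list)
  have pS: "set p \<subseteq> S" and qS: "set q \<subseteq> S" and v'S: "set v' \<subseteq> S"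
    using R Geo_S[OF g(2)] rec_S[OF g(1)] mset_eq_setD[of v' "v @ wd"] by auto
  let ?u = "p1 @ p2 @ wd"
  have su: "set (s # ?u) \<subseteq> S" using pS p R(5) by auto
  have "mset (p @ v') = mset (v @ (s # ?u))" using R(7) p by simp
  moreover have "set (p @ v') \<subseteq> S" using pS v'S by simp
  ultimately obtain e where e: "ev (p @ v') = zs (ev (v @ (s # ?u))) e"
    using ev_permute_mod by blast
  have "ev v \<otimes> ev q = ev (p @ v')" using R(8) pS v'S by simp
  also have "\<dots> = ev v \<otimes> zs (ev (s # ?u)) e"
    unfolding e ev_append_S[OF R(4) su] by (rule zs_mult_right[symmetric, OF ev_closed_S[OF R(4)] ev_closed_S[OF su]])
  finally have "ev q = zs (ev (s # ?u)) e"
    by (rule left_cancelD) (use ev_closed_S[OF su] R(4) qS in \<open>simp_all del: ev_Cons\<close>)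
  then have "ev (s # ?u) = zs (ev q) (- e)"
    using ev_closed_S[OF su] by (simp del: ev_Cons)
  moreover have "length q = Suc (length ?u)" using R(6) p by simp
  moreover have "s \<in> S" "set ?u \<subseteq> S" using su by simp_all
  ultimately show "s \<in> face_letters ?D"
    unfolding face_letters_def using R(3) by blast
qed

text \<open>Adding up Tucker certificates for all letters outside the face gives a defect \<open>U \<ge> 0\<close>
  that vanishes exactly on the face and satisfies \<open>U s + U (inv s) = 2 * \<kappa>\<close>; the weight of a
  letter is then \<open>1 - U s / \<kappa>\<close>.\<close>

lemma exposing_weight:
  assumes g: "\<gamma> \<in> Geo G S"
  defines "X \<equiv> face_letters (recurrent_letters \<gamma>)"
  obtains f :: "'a \<Rightarrow> real" where
    "\<And>x y. x \<in> carrier G \<Longrightarrow> y \<in> carrier G \<Longrightarrow> f (x \<otimes> y) = f x + f y"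
    "\<And>s. s \<in> S \<Longrightarrow> f s \<le> 1" "\<And>s. s \<in> S \<Longrightarrow> f s = 1 \<longleftrightarrow> s \<in> X"
proof -
  let ?D = "recurrent_letters \<gamma>"
  have DS: "?D \<subseteq> S" using rec_S[OF g] .
  have DX: "?D \<subseteq> X" using subset_face_letters[OF DS] by (simp add: X_def)
  define Rel where "Rel u v \<longleftrightarrow> set u \<subseteq> S \<and> set v \<subseteq> S \<and> length u = length v \<and> (\<exists>c. ev u = zs (ev v) c)"
    for u v
  define vec where "vec u v = (\<lambda>t. int (count (mset u) t) - int (count (mset v) t))" for u v :: "'a list"
  \<comment> \<open>The difference vectors of letter counts of equally long words that agree modulo
    the centre; concatenation makes them a group, as \<open>tucker_alternative\<close>
    demands.\<close>
  define R where "R = {vec u v | u v. Rel u v}"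
  have Rel_sub: "Rel (u @ v') (v @ u')" if uv: "Rel u v" "Rel u' v'" for u v u' v'
  proof -
    obtain c c' where c: "ev u = zs (ev v) c" "ev u' = zs (ev v') c'" using uv by (auto simp: Rel_def)
    then have "ev (u @ v') = zs (ev (v @ u')) (c - c')"
      using uv by (simp add: Rel_def)
    then show ?thesis using uv by (auto simp: Rel_def)
  qed
  have R_sub: "(\<lambda>i. x i - y i) \<in> R" if xR: "x \<in> R" and yR: "y \<in> R" for x y
  proof -
    obtain u v where "x = vec u v" "Rel u v" using xR unfolding R_def by blast
    moreover obtain u' v' where "y = vec u' v'" "Rel u' v'" using yR unfolding R_def by blast
    ultimately have "(\<lambda>i. x i - y i) = vec (u @ v') (v @ u')" "Rel (u @ v') (v @ u')"
      using Rel_sub by (auto simp: vec_def)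
    then show ?thesis by (auto simp: R_def)
  qed
  have "Rel [] []" by (auto simp: Rel_def intro: exI[of _ 0])
  then have R_ne: "R \<noteq> {}" by (auto simp: R_def)
  let ?I = "S - ?D"
  have u_ex: "\<exists>u::'a \<Rightarrow> real. (\<forall>i\<in>?I. 0 \<le> u i) \<and> 0 < u s \<and> (\<forall>x\<in>R. (\<Sum>i\<in>?I. u i * of_int (x i)) = 0)"
    if s: "s \<in> S - X" for s
  proof -
    have sI: "insert s (?I - {s}) = ?I" using s DX by auto
    have "\<not> (\<exists>x\<in>R. (\<forall>i\<in>?I. 0 \<le> x i) \<and> 0 < x s)"
    proof
      assume "\<exists>x\<in>R. (\<forall>i\<in>?I. 0 \<le> x i) \<and> 0 < x s"
      then obtain u v where uv: "Rel u v" "\<forall>i\<in>?I. 0 \<le> vec u v i" "0 < vec u v s"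
        by (auto simp: R_def)
      \<comment> \<open>After cancelling common letters the right side has recurrent letters only,
        because outside \<open>?D\<close> the counts on the left dominate. The outcome is exactly
        what puts \<open>s\<close> into \<open>X\<close>.\<close>
      obtain u0 v0 k where k: "mset u0 = mset u - mset v" "mset v0 = mset v - mset u"
          "mset k = mset u \<inter># mset v"
        using ex_mset by metis
      have mu: "mset u = mset (k @ u0)" "mset v = mset (k @ v0)"
        using k by (auto simp: multiset_eq_iff)
      have S: "set k \<subseteq> S" "set u0 \<subseteq> S" "set v0 \<subseteq> S"
        using uv(1) mset_eq_setD[OF mu(1)] mset_eq_setD[OF mu(2)] by (auto simp: Rel_def)
      have uvS: "set u \<subseteq> S" "set v \<subseteq> S" using uv(1) by (auto simp: Rel_def)
      obtain c where "ev u = zs (ev v) c" using uv(1) unfolding Rel_def by blast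
      moreover obtain c1 where "ev u = zs (ev (k @ u0)) c1" using ev_permute_mod[OF uvS(1) mu(1)] by blast
      moreover obtain c2 where "ev v = zs (ev (k @ v0)) c2" using ev_permute_mod[OF uvS(2) mu(2)] by blast
      ultimately have "zs (ev k \<otimes> ev u0) c1 = zs (ev k \<otimes> ev v0) (c2 + c)" using S by simp
      then have "ev k \<otimes> ev u0 = ev k \<otimes> zs (ev v0) (c2 + c - c1)"
        using S by (simp add: zs_eq_iff)
      then have e: "ev u0 = zs (ev v0) (c2 + c - c1)"
        by (rule left_cancelD) (use S in simp_all)
      have vD: "t \<in> ?D" if "t \<in> set v0" for t
      proof (rule ccontr)
        assume "t \<notin> ?D"
        then have "count (mset v) t \<le> count (mset u) t" using uv(2) S that by (auto simp: vec_def)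
        then have "count (mset v0) t = 0" by (simp add: k)
        then show False using that by (simp add: count_eq_zero_iff)
      qed
      have "0 < count (mset u0) s" using uv(3) by (simp add: k vec_def)
      then have "s \<in> set u0" by (metis count_greater_zero_iff set_mset_mset)
      then obtain a b where ab: "u0 = a @ s # b" by (meson split_list)
      obtain c3 where c3: "ev u0 = zs (ev (s # a @ b)) c3"
        using ev_permute_mod[OF S(2), of "s # a @ b"] ab by auto
      have su: "set (s # a @ b) \<subseteq> S" using S ab by auto
      have "ev (s # (a @ b)) = zs (ev v0) (c2 + c - c1 - c3)"
        using e c3 ev_closed_S[OF su] ev_closed_S[OF S(3)] by (simp add: zs_eq_iff del: ev_Cons)
      moreover have "length v0 = length u0"
        using uv(1) mu unfolding Rel_def
        by (metis add_left_cancel length_append size_mset)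
      moreover have "length u0 = Suc (length (a @ b))" using ab by simp
      moreover have "s \<in> S" "set (a @ b) \<subseteq> S" "set v0 \<subseteq> ?D" using su vD by auto
      ultimately have "s \<in> X" unfolding X_def face_letters_def
        by (intro CollectI conjI exI[of _ "a @ b"] exI[of _ v0] exI[of _ "c2 + c - c1 - c3"]) simp_all
      then show False using s by simp
    qed
    then show ?thesis
      using tucker_alternative[of "?I - {s}" R s] R_ne R_sub finite_S unfolding sI by blast
  qed
  then obtain u where u: "\<And>s. s \<in> S - X \<Longrightarrow> \<forall>i\<in>?I. (0::real) \<le> u s i"
      "\<And>s. s \<in> S - X \<Longrightarrow> 0 < u s s" "\<And>s x. s \<in> S - X \<Longrightarrow> x \<in> R \<Longrightarrow> (\<Sum>i\<in>?I. u s i * of_int (x i)) = 0"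
    by metis
  define U where "U t = (if t \<in> ?I then \<Sum>s\<in>S - X. u s t else 0)" for t
  have U_nonneg: "0 \<le> U t" for t using u(1) by (auto simp: U_def intro!: sum_nonneg)
  have U_I: "(\<Sum>t\<in>?I. U t * of_int (x t)) = 0" if "x \<in> R" for x
  proof -
    have "(\<Sum>t\<in>?I. U t * of_int (x t)) = (\<Sum>t\<in>?I. \<Sum>s\<in>S - X. u s t * of_int (x t))"
      by (rule sum.cong) (auto simp: U_def sum_distrib_right)
    also have "\<dots> = (\<Sum>s\<in>S - X. \<Sum>t\<in>?I. u s t * of_int (x t))" by (rule sum.swap)
    also have "\<dots> = 0" using u(3) that by (intro sum.neutral) auto
    finally show ?thesis .
  qed
  have U_S: "(\<Sum>t\<in>S. U t * of_int (x t)) = 0" if "x \<in> R" for x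
    using U_I[OF that] sum.mono_neutral_right[of S ?I "\<lambda>t. U t * of_int (x t)"] finite_S
    by (auto simp: U_def)
  have U_pos: "0 < U s" if s: "s \<in> S - X" for s
  proof -
    have sI: "s \<in> ?I" using s DX by auto
    then have "u s s \<le> U s"
      using member_le_sum[of s "S - X" "\<lambda>t. u t s"] s u(1) finite_S by (auto simp: U_def)
    then show ?thesis using u(2)[OF s] by linarith
  qed
  have U_zero: "U s = 0" if s: "s \<in> X" for s
  proof (cases "s \<in> ?I")
    case True
    obtain a q c where q: "s \<in> S" "set a \<subseteq> S" "set q \<subseteq> ?D" "length q = Suc (length a)"
      "ev (s # a) = zs (ev q) c"
      using s unfolding X_def face_letters_def by blast
    then have "Rel (s # a) q" using DS by (auto simp: Rel_def)
    then have "vec (s # a) q \<in> R" by (auto simp: R_def)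
    from U_I[OF this] have sum0: "(\<Sum>t\<in>?I. U t * of_int (vec (s # a) q t)) = 0" .
    have q0: "count (mset q) t = 0" if "t \<in> ?I" for t
      using q(3) that by (auto simp: count_eq_zero_iff)
    have nn: "0 \<le> U t * of_int (vec (s # a) q t)" if "t \<in> ?I" for t
    proof -
      have "0 \<le> vec (s # a) q t" unfolding vec_def q0[OF that] by simp
      then show ?thesis using U_nonneg[of t] by simp
    qed
    have "\<forall>t\<in>?I. U t * of_int (vec (s # a) q t) = 0"
      by (rule sum_nonneg_eq_0_iff[THEN iffD1, OF _ _ sum0]) (use finite_S nn in \<open>simp_all only: finite_Diff\<close>)
    then have "U s * of_int (vec (s # a) q s) = 0" using True by blast
    then show ?thesis unfolding vec_def q0[OF True] by simp
  next
    case False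
    then show ?thesis unfolding U_def by (rule if_not_P)
  qed
  have usum: "sum_list (map U v) = (\<Sum>t\<in>S. U t * of_nat (count (mset v) t))" if "set v \<subseteq> S" for v
    using that
  proof (induction v)
    case (Cons a v)
    have "(\<Sum>t\<in>S. U t * of_nat (count (mset (a # v)) t)) =
        (\<Sum>t\<in>S. U t * of_nat (count (mset v) t) + (if t = a then U t else 0))"
      by (rule sum.cong) (auto simp: algebra_simps)
    also have "\<dots> = (\<Sum>t\<in>S. U t * of_nat (count (mset v) t)) + U a"
      using Cons.prems finite_S by (simp add: sum.distrib)
    finally show ?case using Cons by simp
  qed simp
  have U_rel: "sum_list (map U v) = sum_list (map U v')" if "Rel v v'" for v v'
  proof -
    have "vec v v' \<in> R" using that by (auto simp: R_def)
    from U_S[OF this] show ?thesis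
      using that by (simp add: Rel_def usum vec_def sum_subtractf algebra_simps)
  qed
  obtain s0 where s0: "s0 \<in> S - X" using face_letters_proper[OF g] face_letters_S[of ?D] by (auto simp: X_def)
  \<comment> \<open>This gives the pair \<open>s0\<close>, \<open>inv s0\<close> total weight zero,
    so it can pad words without changing \<open>F\<close>. Positivity comes from \<open>s0\<close>
    lying outside the face.\<close>
  define \<kappa> where "\<kappa> = (U s0 + U (inv s0)) / 2"
  have lam: "\<kappa> > 0" using U_pos[OF s0] U_nonneg[of "inv s0"] by (simp add: \<kappa>_def)
  define F where "F v = real (length v) - sum_list (map U v) / \<kappa>" for v
  have F_app: "F (v @ v') = F v + F v'" for v v' by (simp add: F_def add_divide_distrib)
  let ?pad = "\<lambda>k. concat (replicate k [s0, inv s0])"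
  have pad: "F (?pad k) = 0" "length (?pad k) = 2 * k" "set (?pad k) \<subseteq> S" "ev (?pad k) = \<one>" for k
  proof -
    have F0: "F [s0, inv s0] = 0" using lam by (simp add: F_def \<kappa>_def field_simps)
    show "F (?pad k) = 0"
    proof (induction k)
      case (Suc k)
      have "?pad (Suc k) = [s0, inv s0] @ ?pad k" by simp
      then show ?case using F_app[of "[s0, inv s0]" "?pad k"] F0 Suc by simp
    qed (simp add: F_def)
    show "length (?pad k) = 2 * k" by (induction k) auto
    have sS: "set [s0, inv s0] \<subseteq> S" using s0 S_inv by auto
    then show "set (?pad k) \<subseteq> S" by auto
    show "ev (?pad k) = \<one>" unfolding ev_concat_replicate[OF sS] using s0 by simp
  qed
  have F_le: "F v = F v'" if "set v \<subseteq> S" "set v' \<subseteq> S" "ev v = zs (ev v') c" "length v \<le> length v'" for v v' c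
  proof -
    \<comment> \<open>Padding adds letters in pairs, so both words are doubled first; then the
      lengths can be matched whatever their parity.\<close>
    define P where "P = ?pad (length v' - length v)"
    have P: "F P = 0" "length P = 2 * (length v' - length v)" "set P \<subseteq> S" "ev P = \<one>"
      unfolding P_def by (rule pad)+
    have "ev ((v @ v) @ P) = zs (ev (v' @ v')) (2 * c)"
      using that P by simp
    then have "Rel ((v @ v) @ P) (v' @ v')"
      using that P(2,3) by (auto simp: Rel_def)
    moreover have "length ((v @ v) @ P) = length (v' @ v')" using that P(2) by simp
    ultimately have "F ((v @ v) @ P) = F (v' @ v')" using U_rel unfolding F_def by presburger
    then show ?thesis using P(1) by (simp add: F_app)
  qed
  have F_eq: "F v = F v'" if "set v \<subseteq> S" "set v' \<subseteq> S" "ev v = ev v'" for v v'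
  proof (cases "length v \<le> length v'")
    case True
    then show ?thesis using F_le[of v v' 0] that by simp
  next
    case False
    then show ?thesis using F_le[of v' v 0] that by simp
  qed
  define f where "f x = F (SOME v. set v \<subseteq> S \<and> ev v = x)" for x
  have f_ev: "f (ev v) = F v" if "set v \<subseteq> S" for v
  proof -
    have "set (SOME w. set w \<subseteq> S \<and> ev w = ev v) \<subseteq> S \<and> ev (SOME w. set w \<subseteq> S \<and> ev w = ev v) = ev v"
      by (rule someI[of _ v]) (use that in auto)
    then show ?thesis unfolding f_def using F_eq that by blast
  qed
  show thesis
  proof (rule that[of f])
    fix x y assume "x \<in> carrier G" "y \<in> carrier G"
    then obtain v v' where "set v \<subseteq> S" "ev v = x" "set v' \<subseteq> S" "ev v' = y" using word_exists by metis
    then show "f (x \<otimes> y) = f x + f y" using f_ev[of v] f_ev[of v'] f_ev[of "v @ v'"] F_app by auto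
  next
    fix s assume s: "s \<in> S"
    then have fs: "f s = 1 - U s / \<kappa>" using f_ev[of "[s]"] by (simp add: F_def)
    then show "f s \<le> 1" using U_nonneg[of s] lam by simp
    show "f s = 1 \<longleftrightarrow> s \<in> X" using fs lam U_zero[of s] U_pos[of s] s by force
  qed
qed

text \<open>A relation modulo the centre would not suffice here. The weight gains at most one per
  letter, and the translation constant equals the weight of \<open>h\<close>, so the joining words
  have as much weight as length and use letters of the face only. These commute, hence reordering is
  free and the relation is exact.\<close>

lemma same_orbit_fine_letters:
  assumes g: "\<gamma>1 \<in> Geo G S" "\<gamma>2 \<in> Geo G S" and o: "same_orbit \<gamma>1 \<gamma>2"
    and F: "face_letters (recurrent_letters \<gamma>1) = face_letters (recurrent_letters \<gamma>2)"
    and com: "commuting (face_letters (recurrent_letters \<gamma>1))"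
  shows "recurrent_letters \<gamma>2 \<subseteq> fine_letters (face_letters (recurrent_letters \<gamma>1)) (recurrent_letters \<gamma>1)"
proof
  fix s assume s: "s \<in> recurrent_letters \<gamma>2"
  let ?D = "recurrent_letters \<gamma>1" and ?X = "face_letters (recurrent_letters \<gamma>1)"
  obtain d1 where d1: "d1 \<in> Geo G S" "recurrent_letters d1 = ?D" "\<And>n. d1 n \<in> ?D" "same_orbit d1 \<gamma>1"
    using recurrent_tail[OF g(1)] by metis
  obtain d2 where d2: "d2 \<in> Geo G S" "recurrent_letters d2 = recurrent_letters \<gamma>2"
    "\<And>n. d2 n \<in> recurrent_letters \<gamma>2" "same_orbit d2 \<gamma>2"
    using recurrent_tail[OF g(2)] by metis
  have "same_orbit d1 d2" using d1(4) d2(4) o same_orbit_trans same_orbit_sym by blast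
  then obtain h c where h: "h \<in> carrier G" and c: "\<forall>x\<in>carrier G. bus d2 x = bus d1 (h \<otimes> x) + c"
    unfolding same_orbit_def by blast
  have X: "?X \<subseteq> S" by (rule face_letters_S)
  have sub: "?D \<subseteq> ?X" "recurrent_letters \<gamma>2 \<subseteq> ?X"
    using subset_face_letters[OF rec_S[OF g(1)]] subset_face_letters[OF rec_S[OF g(2)]] F by simp_all
  obtain f :: "'a \<Rightarrow> real" where f: "\<And>x y. x \<in> carrier G \<Longrightarrow> y \<in> carrier G \<Longrightarrow> f (x \<otimes> y) = f x + f y"
    "\<And>s. s \<in> S \<Longrightarrow> f s \<le> 1" "\<And>s. s \<in> S \<Longrightarrow> f s = 1 \<longleftrightarrow> s \<in> ?X"
    using exposing_weight[OF g(1)] by blast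
  have f1: "f \<one> = 0" using f(1)[of \<one> \<one>] by simp
  have finv: "f (inv x) = - f x" if "x \<in> carrier G" for x
    using f(1)[of x "inv x"] that f1 by simp
  have f_word: "f (ev v) \<le> real (length v) \<and> (f (ev v) = real (length v) \<longrightarrow> set v \<subseteq> ?X)"
    if "set v \<subseteq> S" for v
    using that
  proof (induction v)
    case (Cons a v)
    then have "f (ev (a # v)) = f a + f (ev v)" using f(1) by simp
    then show ?case using Cons f(2)[of a] f(3)[of a] by (auto simp: algebra_simps)
  qed (use f1 in auto)
  have f_X: "f (ev v) = real (length v)" if "set v \<subseteq> ?X" for v
    using that
  proof (induction v)
    case (Cons a v)
    then have "a \<in> S" "set v \<subseteq> S" using X by auto
    then show ?case using Cons f(1)[of a "ev v"] f(3)[of a] by simp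
  qed (use f1 in auto)
  have f_len: "f x \<le> real (len x)" if x: "x \<in> carrier G" for x
  proof -
    obtain v where "set v \<subseteq> S" "ev v = x" "length v = len x" using geodesic_word[OF x] by metis
    then show ?thesis using f_word[of v] by simp
  qed
  have f_pre: "f (pre d n) = real n" if "\<And>n. d n \<in> ?X" for d n
    using f_X[of "map d [0..<n]"] that by (auto simp: prefix_elt_def)
  have fp1: "f (pre d1 n) = real n" and fp2: "f (pre d2 n) = real n" for n
    using f_pre[of d1 n] f_pre[of d2 n] d1(3) d2(3) sub by auto
  have bus_f: "- f x \<le> real_of_int (bus d x)"
    if d: "d \<in> Geo G S" "\<And>n. f (pre d n) = real n" and x: "x \<in> carrier G" for d x
  proof -
    obtain m where m: "int (len (inv (pre d m) \<otimes> x)) = bus d x + int m"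
      using bus_eventually[OF d(1) x] by blast
    have "f (inv (inv (pre d m) \<otimes> x)) = - (f x - real m)"
      using d x f(1) finv by (simp add: d(2))
    moreover have "len (inv (inv (pre d m) \<otimes> x)) = len (inv (pre d m) \<otimes> x)"
      using d x by (intro len_inv) auto
    ultimately have "real m - f x \<le> real (len (inv (pre d m) \<otimes> x))"
      using f_len[of "inv (inv (pre d m) \<otimes> x)"] d x by simp
    also have "\<dots> = real_of_int (bus d x) + real m" using m by (metis of_int_add of_int_of_nat_eq)
    finally show ?thesis by simp
  qed
  \<comment> \<open>\<open>- f\<close> bounds both Busemann functions from below. The orbit identity
    at the identity and at \<open>inv h\<close>, where one of the two values is zero, gives the two
    inequalities.\<close>
  have c_eq: "real_of_int c = f h"
  proof (rule antisym)
    have "bus d2 \<one> = bus d1 h + c" using c h by simp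
    then show "real_of_int c \<le> f h" using bus_f[OF d1(1) fp1 h] d2(1) by simp
    have "bus d2 (inv h) = bus d1 \<one> + c" using c h by simp
    then show "f h \<le> real_of_int c" using bus_f[OF d2(1) fp2, of "inv h"] finv[OF h] h d1(1) by simp
  qed
  have W: "\<exists>m v. set v \<subseteq> ?X \<and> int (length v) = int m - int n + (- c) \<and> inv h \<otimes> pre d1 m = pre d2 n \<otimes> ev v" for n
  proof -
    let ?y = "\<lambda>m. inv (pre d2 n) \<otimes> (inv h \<otimes> pre d1 m)"
    obtain m where m: "int (len (?y m)) = int m - int n - c"
      using orbit_join[OF d1(1) d2(1) h c] by blast
    obtain v where v: "set v \<subseteq> S" "ev v = ?y m" "length v = len (?y m)"
      using geodesic_word[of "?y m"] d1 d2 h by auto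
    have "f (ev v) = real m - real n - f h"
      unfolding v(2) using f(1) finv h d1(1) d2(1) fp1 fp2 by simp
    also have "\<dots> = real (length v)" using m c_eq v(3) by (metis of_int_diff of_int_of_nat_eq)
    finally have "set v \<subseteq> ?X" using f_word[OF v(1)] by blast
    moreover have "pre d2 n \<otimes> ev v = inv h \<otimes> pre d1 m" using v(2) d1(1) d2(1) h by (simp flip: m_assoc)
    ultimately show ?thesis using v m by (intro exI[of _ m] exI[of _ v]) simp
  qed
  have s2: "s \<in> recurrent_letters d2" using s d2(2) by simp
  obtain p q v wd v' where R: "set p \<subseteq> range d2" "s \<in> set p" "set q \<subseteq> ?D" "set v \<subseteq> ?X" "set wd \<subseteq> ?X"
    "length q = length p + length wd" "mset v' = mset v + mset wd" "ev v \<otimes> ev q = ev p \<otimes> ev v'"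
    using orbit_relation[OF d1(1) d2(1) inv_closed[OF h] X d1(3) W s2] by blast
  obtain p1 p2 where p: "p = p1 @ s # p2" using R(2) by (meson split_list)
  have "set p \<subseteq> recurrent_letters \<gamma>2" using R(1) d2(3) by blast
  then have pX: "set p \<subseteq> ?X" using sub(2) by (rule subset_trans)
  have qX: "set q \<subseteq> ?X" using R(3) sub(1) by (rule subset_trans)
  have v'X: "set v' \<subseteq> ?X" using R(4,5,7) mset_eq_setD[of v' "v @ wd"] by simp
  let ?u = "p1 @ p2 @ wd"
  have su: "set (s # ?u) \<subseteq> ?X" using pX p R(5) by auto
  have S: "set v \<subseteq> S" "set q \<subseteq> S" "set p \<subseteq> S" "set v' \<subseteq> S" "set (s # ?u) \<subseteq> S"
    using R(4) qX pX v'X su X by blast+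
  have "mset (p @ v') = mset (v @ (s # ?u))" using R(7) p by simp
  moreover have "set (p @ v') \<subseteq> ?X" using pX v'X by simp
  ultimately have "ev (p @ v') = ev (v @ (s # ?u))"
    using commuting_permute[OF com X] by blast
  then have "ev v \<otimes> ev q = ev v \<otimes> ev (s # ?u)"
    unfolding R(8) ev_append_S[OF S(3,4)] ev_append_S[OF S(1,5)] .
  then have "ev q = ev (s # ?u)"
    by (rule left_cancelD) (rule ev_closed_S[OF S(1)] ev_closed_S[OF S(2)] ev_closed_S[OF S(5)])+
  moreover have "length q = Suc (length ?u)" using R(6) p by simp
  moreover have "s \<in> ?X" using su by simp
  moreover have "set ?u \<subseteq> ?X" using su by simp
  ultimately show "s \<in> fine_letters ?X ?D"
    unfolding fine_letters_def using R(3) by (intro CollectI conjI exI[of _ ?u] exI[of _ q]) simp_all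
qed


section \<open>Orbits of Busemann points\<close>

lemma horo_action_mult:
  assumes "g \<in> carrier G" "h \<in> carrier G"
  shows "horo_action G g (horo_action G h \<phi>) = horo_action G (g \<otimes> h) \<phi>"
proof
  fix x
  show "horo_action G g (horo_action G h \<phi>) x = horo_action G (g \<otimes> h) \<phi> x"
    using assms by (cases "x \<in> carrier G") (auto simp: horo_action_def inv_mult_group m_assoc)
qed

lemma orbit_horo_action:
  assumes h: "h \<in> carrier G"
  shows "orbit G (horo_action G) (horo_action G h \<phi>) = orbit G (horo_action G) \<phi>"
proof (intro equalityI subsetI)
  fix \<psi> assume "\<psi> \<in> orbit G (horo_action G) (horo_action G h \<phi>)"
  then obtain g where "g \<in> carrier G" "\<psi> = horo_action G g (horo_action G h \<phi>)"
    unfolding orbit_def by blast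
  then show "\<psi> \<in> orbit G (horo_action G) \<phi>"
    using horo_action_mult h unfolding orbit_def by auto
next
  fix \<psi> assume "\<psi> \<in> orbit G (horo_action G) \<phi>"
  then obtain g where g: "g \<in> carrier G" "\<psi> = horo_action G g \<phi>" unfolding orbit_def by blast
  have "\<psi> = horo_action G (g \<otimes> inv h) (horo_action G h \<phi>)"
    using horo_action_mult[of "g \<otimes> inv h" h \<phi>] g h by (simp add: m_assoc)
  then show "\<psi> \<in> orbit G (horo_action G) (horo_action G h \<phi>)"
    using g h unfolding orbit_def by auto
qed

lemma horo_action_busemann:
  assumes "\<gamma> \<in> Geo G S" "g \<in> carrier G"
  shows "horo_action G g (busemann G S \<gamma>) =
    (\<lambda>x\<in>carrier G. real_of_int (bus \<gamma> (inv g \<otimes> x) - bus \<gamma> (inv g)))"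
  using assms by (auto simp: horo_action_def busemann_eq_bus(1) restrict_def)

lemma busemann_eq_horo_action_iff:
  assumes "\<gamma>1 \<in> Geo G S" "\<gamma>2 \<in> Geo G S" "g \<in> carrier G"
  shows "busemann G S \<gamma>2 = horo_action G g (busemann G S \<gamma>1) \<longleftrightarrow>
    (\<forall>x\<in>carrier G. bus \<gamma>2 x = bus \<gamma>1 (inv g \<otimes> x) - bus \<gamma>1 (inv g))"
proof -
  have "busemann G S \<gamma>2 = (\<lambda>x\<in>carrier G. real_of_int (bus \<gamma>2 x))"
  proof
    fix x show "busemann G S \<gamma>2 x = (\<lambda>x\<in>carrier G. real_of_int (bus \<gamma>2 x)) x"
      using busemann_eq_bus(1)[OF assms(2)] by (cases "x \<in> carrier G") (auto simp: busemann_def)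
  qed
  moreover have "restrict f A = restrict f' A \<longleftrightarrow> (\<forall>x\<in>A. f x = f' x)" for f f' :: "'a \<Rightarrow> real" and A
    by (metis restrict_apply' restrict_ext)
  ultimately show ?thesis
    unfolding horo_action_busemann[OF assms(1,3)] by (simp only: of_int_eq_iff)
qed

lemma orbit_eq_iff_same_orbit:
  assumes g: "\<gamma>1 \<in> Geo G S" "\<gamma>2 \<in> Geo G S"
  shows "orbit G (horo_action G) (busemann G S \<gamma>1) = orbit G (horo_action G) (busemann G S \<gamma>2)
    \<longleftrightarrow> same_orbit \<gamma>1 \<gamma>2"
proof
  assume eq: "orbit G (horo_action G) (busemann G S \<gamma>1) = orbit G (horo_action G) (busemann G S \<gamma>2)"
  have "busemann G S \<gamma>2 = horo_action G \<one> (busemann G S \<gamma>2)"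
    using busemann_eq_horo_action_iff[OF g(2,2) one_closed] g by simp
  then have "busemann G S \<gamma>2 \<in> orbit G (horo_action G) (busemann G S \<gamma>2)"
    unfolding orbit_def by blast
  then have "busemann G S \<gamma>2 \<in> orbit G (horo_action G) (busemann G S \<gamma>1)" unfolding eq .
  then obtain h where h: "h \<in> carrier G" "busemann G S \<gamma>2 = horo_action G h (busemann G S \<gamma>1)"
    unfolding orbit_def by blast
  then have "\<forall>x\<in>carrier G. bus \<gamma>2 x = bus \<gamma>1 (inv h \<otimes> x) + - bus \<gamma>1 (inv h)"
    using busemann_eq_horo_action_iff[OF g h(1)] by simp
  then show "same_orbit \<gamma>1 \<gamma>2"
    unfolding same_orbit_def using h(1) by blast
next
  assume "same_orbit \<gamma>1 \<gamma>2"
  then obtain h c where h: "h \<in> carrier G" "\<forall>x\<in>carrier G. bus \<gamma>2 x = bus \<gamma>1 (h \<otimes> x) + c"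
    unfolding same_orbit_def by blast
  have "c = - bus \<gamma>1 h" using h(2)[rule_format, of \<one>] g h(1) by simp
  then have "busemann G S \<gamma>2 = horo_action G (inv h) (busemann G S \<gamma>1)"
    using busemann_eq_horo_action_iff[OF g inv_closed[OF h(1)]] h by simp
  then show "orbit G (horo_action G) (busemann G S \<gamma>1) = orbit G (horo_action G) (busemann G S \<gamma>2)"
    using orbit_horo_action[OF inv_closed[OF h(1)]] by simp
qed

text \<open>Consecutive quotients of the ray have length one, hence are letters. The word they spell
  starts at the identity, so its Busemann function must be translated by
  \<open>\<rho> 0\<close>.\<close>

lemma busemann_point_in_orbit:
  assumes "b \<in> busemann_points G S"
  shows "\<exists>\<gamma>\<in>Geo G S. \<exists>g\<in>carrier G. b = horo_action G g (busemann G S \<gamma>)"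
proof -
  obtain \<rho> where \<rho>: "geodesic_ray G S \<rho>"
      and lim: "limitin (pointwise_topology G) (\<lambda>n. horo G S (\<rho> n)) b sequentially"
    using assms unfolding busemann_points_def by blast
  have \<rho>C [simp]: "\<rho> n \<in> carrier G" for n using \<rho> by (simp add: geodesic_ray_def)
  have \<rho>d: "len (inv (\<rho> m) \<otimes> \<rho> n) = n - m" if "m \<le> n" for m n
    using \<rho> that by (simp add: geodesic_ray_def word_dist_def)
  define \<gamma> where "\<gamma> n = inv (\<rho> n) \<otimes> \<rho> (Suc n)" for n
  have \<gamma>S: "\<gamma> n \<in> S" for n
  proof -
    obtain u where u: "set u \<subseteq> S" "ev u = \<gamma> n" "length u = len (\<gamma> n)"
      using geodesic_word[of "\<gamma> n"] by (auto simp: \<gamma>_def)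
    then have "length u = Suc 0" using \<rho>d[of n "Suc n"] by (simp add: \<gamma>_def)
    then obtain a where "u = [a]" by (auto simp: length_Suc_conv)
    then show ?thesis using u by auto
  qed
  have pre: "pre \<gamma> n = inv (\<rho> 0) \<otimes> \<rho> n" for n
  proof (induction n)
    case (Suc n)
    have "set (map \<gamma> [0..<n]) \<subseteq> S" using \<gamma>S by auto
    then have "pre \<gamma> (Suc n) = pre \<gamma> n \<otimes> \<gamma> n"
      using \<gamma>S[of n] by (simp add: prefix_elt_def)
    also have "\<dots> = inv (\<rho> 0) \<otimes> \<rho> (Suc n)"
      unfolding Suc by (simp add: \<gamma>_def m_assoc) (simp flip: m_assoc)
    finally show ?case .
  qed simp
  have g: "\<gamma> \<in> Geo G S" using \<gamma>S \<rho>d[of 0] by (auto simp: Geo_def pre)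
  have "b x = horo_action G (\<rho> 0) (busemann G S \<gamma>) x" for x
  proof (cases "x \<in> carrier G")
    case True
    have "limitin euclideanreal (\<lambda>n. horo G S (\<rho> n) x) (b x) sequentially"
      using lim True unfolding pointwise_topology_def limitin_componentwise by blast
    then have lim_b: "(\<lambda>n. horo G S (\<rho> n) x) \<longlonglongrightarrow> b x" by simp
    let ?y = "inv (\<rho> 0) \<otimes> x"
    obtain N1 where N1: "\<forall>n\<ge>N1. int (len (inv (pre \<gamma> n) \<otimes> ?y)) = bus \<gamma> ?y + int n"
      using bus_eventually[OF g, of ?y] True by auto
    obtain N2 where N2: "\<forall>n\<ge>N2. int (len (inv (pre \<gamma> n) \<otimes> inv (\<rho> 0))) = bus \<gamma> (inv (\<rho> 0)) + int n"
      using bus_eventually[OF g, of "inv (\<rho> 0)"] by auto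
    have "horo G S (\<rho> n) x = real_of_int (bus \<gamma> ?y - bus \<gamma> (inv (\<rho> 0)))" if "n \<ge> max N1 N2" for n
    proof -
      have e: "inv (pre \<gamma> n) \<otimes> ?y = inv (\<rho> n) \<otimes> x" "inv (pre \<gamma> n) \<otimes> inv (\<rho> 0) = inv (\<rho> n)"
        using True by (simp_all add: pre inv_mult_group m_assoc) (simp add: m_assoc[symmetric])
      have "int (len (inv (\<rho> n) \<otimes> x)) - int (len (inv (\<rho> n))) = bus \<gamma> ?y - bus \<gamma> (inv (\<rho> 0))"
        using N1[rule_format, of n] N2[rule_format, of n] that unfolding e by simp
      moreover have "horo G S (\<rho> n) x = real_of_int (int (len (inv (\<rho> n) \<otimes> x)) - int (len (inv (\<rho> n))))"
        using True by (simp add: horo_def word_dist_def)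
      ultimately show ?thesis by (simp only:)
    qed
    then have "(\<lambda>n. horo G S (\<rho> n) x) \<longlonglongrightarrow> real_of_int (bus \<gamma> ?y - bus \<gamma> (inv (\<rho> 0)))"
      by (intro tendsto_eventually eventually_sequentiallyI)
    then have "b x = real_of_int (bus \<gamma> ?y - bus \<gamma> (inv (\<rho> 0)))"
      using lim_b LIMSEQ_unique by blast
    then show ?thesis using True horo_action_busemann[OF g \<rho>C] by simp
  next
    case False
    have "b \<in> extensional (carrier G)"
      using lim unfolding pointwise_topology_def limitin_componentwise by blast
    then show ?thesis using False by (simp add: extensional_def horo_action_def)
  qed
  then show ?thesis using g \<rho>C by blast
qed

text \<open>The orbit is determined by a pair of subsets of \<open>S\<close>; choosing a
  representative word for each pair that occurs leaves finitely many orbits.\<close>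

lemma finite_busemann_orbits: "finite (orbits G (busemann_points G S) (horo_action G))"
proof -
  let ?O = "\<lambda>\<gamma>. orbit G (horo_action G) (busemann G S \<gamma>)"
  let ?F = "\<lambda>\<gamma>. face_letters (recurrent_letters \<gamma>)"
  let ?k = "\<lambda>\<gamma>. (?F \<gamma>, fine_letters (?F \<gamma>) (recurrent_letters \<gamma>))"
  have "?k ` Geo G S \<subseteq> Pow S \<times> Pow S"
    using face_letters_S fine_letters_subset by blast
  then have fin: "finite (?k ` Geo G S)" using finite_S finite_subset by blast
  have "?O \<gamma>1 = ?O \<gamma>2" if "\<gamma>1 \<in> Geo G S" "\<gamma>2 \<in> Geo G S" "?k \<gamma>1 = ?k \<gamma>2" for \<gamma>1 \<gamma>2
    using same_faces_imp_same_orbit[OF that(1,2)] that orbit_eq_iff_same_orbit by auto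
  then have "?O \<gamma> = ?O (SOME d. d \<in> Geo G S \<and> ?k d = ?k \<gamma>)" if "\<gamma> \<in> Geo G S" for \<gamma>
    using someI[of "\<lambda>d. d \<in> Geo G S \<and> ?k d = ?k \<gamma>" \<gamma>] that by blast
  then have "?O ` Geo G S \<subseteq> (\<lambda>k. ?O (SOME d. d \<in> Geo G S \<and> ?k d = k)) ` ?k ` Geo G S"
    by (auto simp only: image_image)
  then have "finite (?O ` Geo G S)" using fin finite_subset by blast
  moreover have "orbits G (busemann_points G S) (horo_action G) \<subseteq> ?O ` Geo G S"
  proof
    fix Q assume "Q \<in> orbits G (busemann_points G S) (horo_action G)"
    then obtain b where "b \<in> busemann_points G S" "Q = orbit G (horo_action G) b"
      unfolding orbits_def by blast
    then show "Q \<in> ?O ` Geo G S"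
      using busemann_point_in_orbit[of b] orbit_horo_action by blast
  qed
  ultimately show ?thesis using finite_subset by blast
qed

lemma countable_busemann_points: "countable (busemann_points G S)"
proof -
  let ?O = "orbits G (busemann_points G S) (horo_action G)"
  have sub: "carrier G \<subseteq> ev ` lists S"
  proof
    fix x assume "x \<in> carrier G"
    then obtain u where "set u \<subseteq> S" "ev u = x" using word_exists by blast
    then show "x \<in> ev ` lists S" by (intro image_eqI[of _ _ u]) (auto simp: in_lists_conv_set)
  qed
  have "countable (lists S)" by (intro countable_lists countable_finite finite_S)
  then have "countable (carrier G)" using countable_subset[OF sub countable_image] by blast
  then have "countable (orbit G (horo_action G) b)" for b
    unfolding orbit_def Setcompr_eq_image by (rule countable_image)
  then have "countable Q" if "Q \<in> ?O" for Q using that unfolding orbits_def by blast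
  then have "countable (\<Union>Q\<in>?O. Q)"
    by (rule countable_UN[OF countable_finite[OF finite_busemann_orbits]])
  then have "countable (\<Union> ?O)" by simp
  moreover have "busemann_points G S \<subseteq> \<Union> ?O"
  proof
    fix b assume b: "b \<in> busemann_points G S"
    then obtain \<gamma> g where "g \<in> carrier G" "b = horo_action G g (busemann G S \<gamma>)"
      using busemann_point_in_orbit by blast
    then have "b \<in> orbit G (horo_action G) b"
      using orbit_horo_action[of g] unfolding orbit_def by blast
    then show "b \<in> \<Union> ?O" using b unfolding orbits_def by blast
  qed
  ultimately show ?thesis using countable_subset by blast
qed

end

section \<open>Minimal faces of polytopes\<close>

text \<open>Weights are indexed by letters and not by points, because distinct letters may become
  equal under \<open>p\<close>, for instance under the projection.\<close>

lemma convex_hull_image_finite: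
  fixes p :: "'i \<Rightarrow> 'v::real_vector"
  assumes "finite T"
  shows "x \<in> convex hull (p ` T) \<longleftrightarrow> (\<exists>l. (\<forall>t\<in>T. 0 \<le> l t) \<and> sum l T = 1 \<and> x = (\<Sum>t\<in>T. l t *\<^sub>R p t))"
proof
  let ?A = "{x. \<exists>l. (\<forall>t\<in>T. 0 \<le> l t) \<and> sum l T = 1 \<and> x = (\<Sum>t\<in>T. l t *\<^sub>R p t)}"
  have "p ` T \<subseteq> ?A"
  proof
    fix y assume "y \<in> p ` T"
    then obtain t where t: "t \<in> T" "y = p t" by blast
    have "(\<Sum>r\<in>T. (if r = t then 1 else 0) *\<^sub>R p r) = (\<Sum>r\<in>T. if r = t then p r else 0)"
      by (rule sum.cong) auto
    then show "y \<in> ?A" using t assms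
      by (intro CollectI exI[of _ "\<lambda>r. if r = t then 1 else 0"]) auto
  qed
  moreover have "convex ?A"
    unfolding convex_def
  proof (intro ballI allI impI)
    fix x y and u v :: real
    assume "x \<in> ?A" "y \<in> ?A" and uv: "0 \<le> u" "0 \<le> v" "u + v = 1"
    then obtain l m where l: "\<forall>t\<in>T. 0 \<le> l t" "sum l T = 1" "x = (\<Sum>t\<in>T. l t *\<^sub>R p t)"
      and m: "\<forall>t\<in>T. 0 \<le> m t" "sum m T = 1" "y = (\<Sum>t\<in>T. m t *\<^sub>R p t)" by blast
    show "u *\<^sub>R x + v *\<^sub>R y \<in> ?A"
    proof (intro CollectI exI[of _ "\<lambda>t. u * l t + v * m t"] conjI)
      show "\<forall>t\<in>T. 0 \<le> u * l t + v * m t" using l m uv by auto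
      show "(\<Sum>t\<in>T. u * l t + v * m t) = 1"
        using l m uv by (simp add: sum.distrib flip: sum_distrib_left)
      show "u *\<^sub>R x + v *\<^sub>R y = (\<Sum>t\<in>T. (u * l t + v * m t) *\<^sub>R p t)"
        using l m by (simp add: scaleR_add_left sum.distrib scaleR_sum_right)
    qed
  qed
  ultimately have "convex hull (p ` T) \<subseteq> ?A" by (rule hull_minimal)
  then show "x \<in> convex hull (p ` T) \<Longrightarrow> \<exists>l. (\<forall>t\<in>T. 0 \<le> l t) \<and> sum l T = 1 \<and> x = (\<Sum>t\<in>T. l t *\<^sub>R p t)"
    by blast
next
  assume "\<exists>l. (\<forall>t\<in>T. 0 \<le> l t) \<and> sum l T = 1 \<and> x = (\<Sum>t\<in>T. l t *\<^sub>R p t)"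
  then obtain l where l: "\<forall>t\<in>T. 0 \<le> l t" "sum l T = 1" "x = (\<Sum>t\<in>T. l t *\<^sub>R p t)" by blast
  show "x \<in> convex hull (p ` T)"
    unfolding l(3) using assms l by (intro convex_sum) (auto intro: hull_inc)
qed

text \<open>The real counterpart of the relation behind \<open>face_letters\<close>. The mass is not
  normalised to one, so that relations can be added and scaled.\<close>

definition balanced :: "'i set \<Rightarrow> 'i set \<Rightarrow> ('i \<Rightarrow> 'v::real_vector) \<Rightarrow> ('i \<Rightarrow> real) \<Rightarrow> ('i \<Rightarrow> real) \<Rightarrow> bool" where
  "balanced S D p \<mu> \<nu> \<longleftrightarrow> (\<forall>t. 0 \<le> \<mu> t \<and> 0 \<le> \<nu> t) \<and> (\<forall>t. t \<notin> D \<longrightarrow> \<nu> t = 0) \<and>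
     sum \<mu> S = sum \<nu> S \<and> (\<Sum>t\<in>S. \<mu> t *\<^sub>R p t) = (\<Sum>t\<in>S. \<nu> t *\<^sub>R p t)"

text \<open>The sum of the given relations has positive weight on all of \<open>T\<close>. A small
  multiple of \<open>l\<close> is taken out of it and the same multiple of \<open>a\<close> put in,
  which changes neither mass nor weighted sum but gives \<open>t\<close> positive weight.\<close>

lemma balanced_substitute:
  fixes p :: "'i \<Rightarrow> 'v::real_vector"
  assumes S: "finite S" and T: "T \<subseteq> S" "\<And>r. r \<in> T \<Longrightarrow> \<exists>\<mu> \<nu>. balanced S D p \<mu> \<nu> \<and> 0 < \<mu> r"
    and l: "\<And>t. 0 \<le> l t" "\<And>t. t \<notin> T \<Longrightarrow> l t = 0" and a: "\<And>t. 0 \<le> a t"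
    and eq: "sum a S = sum l S" "(\<Sum>t\<in>S. a t *\<^sub>R p t) = (\<Sum>t\<in>S. l t *\<^sub>R p t)"
    and t: "0 < a t"
  shows "\<exists>\<mu> \<nu>. balanced S D p \<mu> \<nu> \<and> 0 < \<mu> t"
proof -
  obtain \<mu> \<nu> where mn: "\<And>r. r \<in> T \<Longrightarrow> balanced S D p (\<mu> r) (\<nu> r)" "\<And>r. r \<in> T \<Longrightarrow> 0 < \<mu> r r"
    using T(2) by metis
  have finT: "finite T" using T(1) S finite_subset by blast
  define M N where "M t = (\<Sum>r\<in>T. \<mu> r t)" and "N t = (\<Sum>r\<in>T. \<nu> r t)" for t
  have nn: "0 \<le> \<mu> r t" "0 \<le> \<nu> r t" if "r \<in> T" for r t using mn(1)[OF that] by (auto simp: balanced_def)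
  have M0: "0 \<le> M t" and N0: "0 \<le> N t" for t using nn by (auto simp: M_def N_def intro!: sum_nonneg)
  have Mpos: "0 < M r" if "r \<in> T" for r
  proof -
    have "\<mu> r r \<le> M r" unfolding M_def
      using member_le_sum[of r T "\<lambda>q. \<mu> q r"] that nn finT by simp
    then show ?thesis using mn(2)[OF that] by linarith
  qed
  \<comment> \<open>Small enough to keep \<open>M - \<delta> * l\<close> non-negative; the
    \<open>1\<close> covers empty \<open>T\<close>, and \<open>l r + 1\<close> avoids a zero
    denominator.\<close>
  define \<delta> where "\<delta> = Min (insert 1 ((\<lambda>r. M r / (l r + 1)) ` T))"
  have l1: "0 < l r + 1" for r using l(1)[of r] by linarith
  have \<delta>: "0 < \<delta>" unfolding \<delta>_def using finT Mpos l1 by (subst Min_gr_iff) auto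
  have \<delta>M: "\<delta> * l r \<le> M r" for r
  proof (cases "r \<in> T")
    case True
    then have "\<delta> \<le> M r / (l r + 1)" unfolding \<delta>_def using finT by (intro Min_le) auto
    then have "\<delta> * (l r + 1) \<le> M r" using l1[of r] by (simp add: pos_le_divide_eq)
    then show ?thesis using \<delta> by (simp add: algebra_simps)
  qed (use l(2) M0 in auto)
  have sums: "sum M S = sum N S" "(\<Sum>t\<in>S. M t *\<^sub>R p t) = (\<Sum>t\<in>S. N t *\<^sub>R p t)"
  proof -
    have "sum M S = (\<Sum>r\<in>T. sum (\<mu> r) S)" unfolding M_def by (rule sum.swap)
    also have "\<dots> = (\<Sum>r\<in>T. sum (\<nu> r) S)"
      by (rule sum.cong[OF refl]) (use mn(1) in \<open>simp add: balanced_def\<close>)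
    also have "\<dots> = sum N S" unfolding N_def by (rule sum.swap)
    finally show "sum M S = sum N S" .
    have "(\<Sum>t\<in>S. M t *\<^sub>R p t) = (\<Sum>r\<in>T. \<Sum>t\<in>S. \<mu> r t *\<^sub>R p t)"
      unfolding M_def scaleR_sum_left by (rule sum.swap)
    also have "\<dots> = (\<Sum>r\<in>T. \<Sum>t\<in>S. \<nu> r t *\<^sub>R p t)"
      by (rule sum.cong[OF refl]) (use mn(1) in \<open>simp add: balanced_def\<close>)
    also have "\<dots> = (\<Sum>t\<in>S. N t *\<^sub>R p t)" unfolding N_def scaleR_sum_left by (rule sum.swap)
    finally show "(\<Sum>t\<in>S. M t *\<^sub>R p t) = (\<Sum>t\<in>S. N t *\<^sub>R p t)" .
  qed
  define m where "m t = M t - \<delta> * l t + \<delta> * a t" for t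
  have "balanced S D p m N"
    unfolding balanced_def
  proof (intro conjI allI impI)
    show "0 \<le> m t" for t using \<delta>M[of t] \<delta> a[of t] unfolding m_def by (simp add: add_nonneg_nonneg)
    show "0 \<le> N t" for t by (rule N0)
    show "N t = 0" if "t \<notin> D" for t
      unfolding N_def using mn(1) that by (intro sum.neutral) (auto simp: balanced_def)
    show "sum m S = sum N S"
      unfolding m_def using sums(1) eq(1) by (simp add: sum.distrib sum_subtractf flip: sum_distrib_left)
    have "(\<Sum>t\<in>S. m t *\<^sub>R p t) = (\<Sum>t\<in>S. M t *\<^sub>R p t) - \<delta> *\<^sub>R (\<Sum>t\<in>S. l t *\<^sub>R p t) + \<delta> *\<^sub>R (\<Sum>t\<in>S. a t *\<^sub>R p t)"
      unfolding m_def by (simp add: algebra_simps sum.distrib sum_subtractf scaleR_sum_right)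
    then show "(\<Sum>t\<in>S. m t *\<^sub>R p t) = (\<Sum>t\<in>S. N t *\<^sub>R p t)"
      using sums(2) eq(2) by simp
  qed
  moreover have "0 < \<delta> * a t" using \<delta> t by simp
  then have "0 < m t" using \<delta>M[of t] unfolding m_def by linarith
  ultimately show ?thesis by blast
qed

text \<open>If a point of the smaller hull lies strictly between \<open>x\<close> and
  \<open>y\<close>, each letter with positive weight in \<open>x\<close> or \<open>y\<close> occurs
  in a combination equal to one supported on \<open>T\<close>. By \<open>balanced_substitute\<close>
  it belongs to \<open>T\<close>.\<close>

lemma balanced_hull_face:
  fixes p :: "'i \<Rightarrow> 'v::real_vector" and D :: "'i set"
  assumes S: "finite S"
  defines "T \<equiv> {t \<in> S. \<exists>\<mu> \<nu>. balanced S D p \<mu> \<nu> \<and> 0 < \<mu> t}"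
  shows "(convex hull (p ` T)) face_of (convex hull (p ` S))"
proof -
  have TS: "T \<subseteq> S" by (auto simp: T_def)
  have finT: "finite T" using TS S finite_subset by blast
  have key: "x \<in> convex hull (p ` T) \<and> y \<in> convex hull (p ` T)"
    if xy: "x \<in> convex hull (p ` S)" "y \<in> convex hull (p ` S)"
      and z: "z \<in> convex hull (p ` T)" "z \<in> open_segment x y" for x y z
  proof -
    obtain u where u: "0 < u" "u < 1" "z = (1 - u) *\<^sub>R x + u *\<^sub>R y"
      using z(2) by (auto simp: in_segment)
    obtain a where a: "\<forall>t\<in>S. 0 \<le> a t" "sum a S = 1" "x = (\<Sum>t\<in>S. a t *\<^sub>R p t)"
      using xy(1) unfolding convex_hull_image_finite[OF S] by blast
    obtain b where b: "\<forall>t\<in>S. 0 \<le> b t" "sum b S = 1" "y = (\<Sum>t\<in>S. b t *\<^sub>R p t)"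
      using xy(2) unfolding convex_hull_image_finite[OF S] by blast
    obtain l where l: "\<forall>t\<in>T. 0 \<le> l t" "sum l T = 1" "z = (\<Sum>t\<in>T. l t *\<^sub>R p t)"
      using z(1) unfolding convex_hull_image_finite[OF finT] by blast
    define c where "c t = (if t \<in> S then (1 - u) * a t + u * b t else 0)" for t
    define l' where "l' t = (if t \<in> T then l t else 0)" for t
    have supp: "t \<in> T" if "t \<in> S" "0 < c t" for t
    proof -
      have "\<exists>\<mu> \<nu>. balanced S D p \<mu> \<nu> \<and> 0 < \<mu> t"
      proof (rule balanced_substitute[OF S TS])
        show "\<exists>\<mu> \<nu>. balanced S D p \<mu> \<nu> \<and> 0 < \<mu> r" if "r \<in> T" for r using that by (simp add: T_def)
        show "0 \<le> l' t" "t \<notin> T \<Longrightarrow> l' t = 0" for t using l(1) by (auto simp: l'_def)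
        show "0 \<le> c t" for t using a(1) b(1) u by (auto simp: c_def)
        have "sum c S = (1 - u) * sum a S + u * sum b S"
          by (simp add: c_def sum.distrib sum_distrib_left)
        moreover have l'S: "(\<Sum>t\<in>S. l' t *\<^sub>R q t) = (\<Sum>t\<in>T. l t *\<^sub>R q t)" for q :: "'i \<Rightarrow> 'u::real_vector"
        proof -
          have "(\<Sum>t\<in>S. l' t *\<^sub>R q t) = (\<Sum>t\<in>T. l' t *\<^sub>R q t)"
            by (rule sum.mono_neutral_right) (use S TS in \<open>auto simp: l'_def\<close>)
          also have "\<dots> = (\<Sum>t\<in>T. l t *\<^sub>R q t)" by (rule sum.cong) (auto simp: l'_def)
          finally show ?thesis .
        qed
        moreover have "sum l' S = sum l T" using l'S[of "\<lambda>_. 1::real"] by simp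
        ultimately show "sum c S = sum l' S" using a b l by simp
        have "(\<Sum>t\<in>S. c t *\<^sub>R p t) = (1 - u) *\<^sub>R x + u *\<^sub>R y"
          unfolding a(3) b(3) by (simp add: c_def scaleR_add_left sum.distrib scaleR_sum_right)
        then show "(\<Sum>t\<in>S. c t *\<^sub>R p t) = (\<Sum>t\<in>S. l' t *\<^sub>R p t)"
          using l'S[of p] l(3) u(3) by simp
        show "0 < c t" by (rule that(2))
      qed
      then show ?thesis using that(1) by (simp add: T_def)
    qed
    have zero: "a t = 0 \<and> b t = 0" if "t \<in> S - T" for t
    proof -
      have "c t \<le> 0" using supp[of t] that by force
      moreover have "0 \<le> (1 - u) * a t" "0 \<le> u * b t" using u a(1) b(1) that by auto
      moreover have "c t = (1 - u) * a t + u * b t" using that by (simp add: c_def)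
      ultimately have "(1 - u) * a t = 0" "u * b t = 0" by linarith+
      then show ?thesis using u(1,2) by simp
    qed
    have hull: "(\<Sum>t\<in>S. e t *\<^sub>R p t) \<in> convex hull (p ` T)"
      if e: "\<forall>t\<in>S. 0 \<le> e t" "sum e S = 1" "\<And>t. t \<in> S - T \<Longrightarrow> e t = 0" for e
    proof -
      have "sum e T = 1" using e sum.mono_neutral_right[of S T e] S TS by auto
      moreover have "(\<Sum>t\<in>S. e t *\<^sub>R p t) = (\<Sum>t\<in>T. e t *\<^sub>R p t)"
        using e sum.mono_neutral_right[of S T "\<lambda>t. e t *\<^sub>R p t"] S TS by auto
      ultimately show ?thesis unfolding convex_hull_image_finite[OF finT] using e(1) TS by blast
    qed
    show ?thesis unfolding a(3) b(3) using hull[of a] hull[of b] a b zero by blast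
  qed
  show ?thesis
    unfolding face_of_def
  proof (intro conjI ballI impI)
    show "convex hull (p ` T) \<subseteq> convex hull (p ` S)" by (intro hull_mono image_mono TS)
    show "convex (convex hull (p ` T))" by (rule convex_convex_hull)
    fix x y z assume "x \<in> convex hull (p ` S)" "y \<in> convex hull (p ` S)" "z \<in> convex hull (p ` T)"
      "z \<in> open_segment x y"
    then show "x \<in> convex hull (p ` T)" "y \<in> convex hull (p ` T)" using key by blast+
  qed
qed

lemma balanced_in_face:
  fixes p :: "'i \<Rightarrow> 'v::real_vector"
  assumes S: "finite S" "D \<subseteq> S" and F: "F face_of (convex hull (p ` S))" "p ` D \<subseteq> F"
    and b: "balanced S D p \<mu> \<nu>" and s: "s \<in> S" "0 < \<mu> s"
  shows "p s \<in> F"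
proof -
  define m where "m = sum \<mu> S"
  have nn: "0 \<le> \<mu> t" "0 \<le> \<nu> t" for t using b by (auto simp: balanced_def)
  have sm: "\<mu> s \<le> m" unfolding m_def using s S(1) nn by (intro member_le_sum) auto
  then have m: "0 < m" using s by linarith
  have \<nu>0: "\<nu> t = 0" if "t \<notin> D" for t using b that by (simp add: balanced_def)
  define y where "y = (\<Sum>t\<in>S. (\<mu> t / m) *\<^sub>R p t)"
  have inv: "(\<Sum>t\<in>S. (e t / m) *\<^sub>R p t) = inverse m *\<^sub>R (\<Sum>t\<in>S. e t *\<^sub>R p t)" for e
    by (simp add: scaleR_sum_right divide_inverse mult.commute)
  have finD: "finite D" using S finite_subset by blast
  have "y \<in> convex hull (p ` D)"
  proof -
    have "y = (\<Sum>t\<in>S. (\<nu> t / m) *\<^sub>R p t)"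
      unfolding y_def inv using b by (simp add: balanced_def)
    also have "\<dots> = (\<Sum>t\<in>D. (\<nu> t / m) *\<^sub>R p t)"
      using S \<nu>0 by (intro sum.mono_neutral_right) auto
    finally have "y = (\<Sum>t\<in>D. (\<nu> t / m) *\<^sub>R p t)" .
    moreover have "sum \<nu> D = m"
      using b sum.mono_neutral_right[of S D \<nu>] S \<nu>0 by (simp add: m_def balanced_def)
    then have "(\<Sum>t\<in>D. \<nu> t / m) = 1" using m by (simp flip: sum_divide_distrib)
    ultimately show ?thesis
      unfolding convex_hull_image_finite[OF finD] using nn m
      by (intro exI[of _ "\<lambda>t. \<nu> t / m"]) auto
  qed
  moreover have "convex hull (p ` D) \<subseteq> F" using F by (intro hull_minimal) (auto simp: face_of_def)
  ultimately have yF: "y \<in> F" by blast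
  define \<theta> where "\<theta> = \<mu> s / m"
  have \<theta>: "0 < \<theta>" "\<theta> \<le> 1" using s m sm by (auto simp: \<theta>_def)
  have sum_split: "y = \<theta> *\<^sub>R p s + (\<Sum>t\<in>S - {s}. (\<mu> t / m) *\<^sub>R p t)"
    unfolding y_def \<theta>_def using S(1) s(1) by (rule sum.remove)
  have "sum \<mu> S = \<mu> s + sum \<mu> (S - {s})" using S(1) s(1) by (rule sum.remove)
  then have rest: "(\<Sum>t\<in>S - {s}. \<mu> t / m) = 1 - \<theta>"
    using m by (simp add: \<theta>_def m_def field_simps flip: sum_divide_distrib)
  show ?thesis
  proof (cases "\<theta> = 1")
    case True
    have "\<mu> t / m = 0" if "t \<in> S - {s}" for t
      using sum_nonneg_eq_0_iff[of "S - {s}" "\<lambda>t. \<mu> t / m"] rest True S(1) nn m that by auto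
    then have "(\<Sum>t\<in>S - {s}. (\<mu> t / m) *\<^sub>R p t) = 0" by (intro sum.neutral) auto
    then have "y = p s" using sum_split True by simp
    then show ?thesis using yF by simp
  next
    case False
    then have t1: "0 < 1 - \<theta>" using \<theta> by linarith
    define r where "r = (\<Sum>t\<in>S - {s}. (\<mu> t / m / (1 - \<theta>)) *\<^sub>R p t)"
    have "r \<in> convex hull (p ` (S - {s}))"
      unfolding convex_hull_image_finite[OF finite_Diff[OF S(1)]]
    proof (intro exI[of _ "\<lambda>t. \<mu> t / m / (1 - \<theta>)"] conjI)
      show "\<forall>t\<in>S - {s}. 0 \<le> \<mu> t / m / (1 - \<theta>)" using nn m t1 by auto
      show "(\<Sum>t\<in>S - {s}. \<mu> t / m / (1 - \<theta>)) = 1"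
        unfolding sum_divide_distrib[symmetric, of "\<lambda>t. \<mu> t / m"] rest using t1 by simp
    qed (simp add: r_def)
    then have rP: "r \<in> convex hull (p ` S)" using hull_mono[of "p ` (S - {s})" "p ` S"] by auto
    have "(1 - \<theta>) *\<^sub>R r = (\<Sum>t\<in>S - {s}. (\<mu> t / m) *\<^sub>R p t)"
      unfolding r_def using t1 by (simp add: scaleR_sum_right)
    then have y: "y = \<theta> *\<^sub>R p s + (1 - \<theta>) *\<^sub>R r" using sum_split by simp
    show ?thesis
    proof (cases "p s = r")
      case True
      then have "y = p s" using y by (simp flip: scaleR_add_left)
      then show ?thesis using yF by simp
    next
      case neq: False
      have "y \<in> open_segment (p s) r"
        unfolding in_segment using neq y \<theta> t1 by (intro conjI exI[of _ "1 - \<theta>"]) auto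
      moreover have "p s \<in> convex hull (p ` S)" using s(1) by (simp add: hull_inc)
      ultimately show ?thesis using face_ofD[OF F(1) _ _ rP yF] by blast
    qed
  qed
qed

lemma minimal_face_face_of:
  "convex P \<Longrightarrow> A \<subseteq> P \<Longrightarrow> minimal_face P A face_of P"
  unfolding minimal_face_def by (rule face_of_Inter) (auto intro: face_of_refl)

lemma subset_minimal_face: "A \<subseteq> minimal_face P A"
  unfolding minimal_face_def by auto

lemma minimal_face_subset: "F face_of P \<Longrightarrow> A \<subseteq> F \<Longrightarrow> minimal_face P A \<subseteq> F"
  unfolding minimal_face_def by auto

lemma minimal_face_eq_iff:
  assumes "convex P" "A \<subseteq> P" "A' \<subseteq> P"
  shows "minimal_face P A = minimal_face P A' \<longleftrightarrow> A \<subseteq> minimal_face P A' \<and> A' \<subseteq> minimal_face P A"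
  using subset_minimal_face[of A P] subset_minimal_face[of A' P]
    minimal_face_subset[OF minimal_face_face_of[OF assms(1,2)], of A']
    minimal_face_subset[OF minimal_face_face_of[OF assms(1,3)], of A] by blast

text \<open>The balanced letters span a face containing \<open>p\<close>
  D\<open>, and every face containing\<close>p \<open>D\<close> contains them; this pins down the
  minimal face from both sides. That it is covered by the hull of its own letters is what later
  describes the preimage of a face under \<open>Pr\<close>.\<close>

lemma minimal_face_hull:
  fixes p :: "'i \<Rightarrow> 'v::real_vector"
  assumes S: "finite S" "D \<subseteq> S"
  defines "F \<equiv> minimal_face (convex hull (p ` S)) (p ` D)"
  shows "s \<in> S \<Longrightarrow> p s \<in> F \<longleftrightarrow> (\<exists>\<mu> \<nu>. balanced S D p \<mu> \<nu> \<and> 0 < \<mu> s)"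
    and "F \<subseteq> convex hull (p ` {s \<in> S. p s \<in> F})"
proof -
  let ?T = "{t \<in> S. \<exists>\<mu> \<nu>. balanced S D p \<mu> \<nu> \<and> 0 < \<mu> t}"
  have DT: "D \<subseteq> ?T"
  proof
    fix d assume d: "d \<in> D"
    let ?i = "\<lambda>t. if t = d then 1 else 0 :: real"
    have "balanced S D p ?i ?i" using d by (auto simp: balanced_def)
    then show "d \<in> ?T" using d S by (intro CollectI conjI exI[of _ ?i]) auto
  qed
  have "p ` D \<subseteq> convex hull (p ` ?T)" using DT by (meson hull_subset image_mono order_trans)
  then have FT: "F \<subseteq> convex hull (p ` ?T)"
    unfolding F_def by (intro minimal_face_subset balanced_hull_face[OF S(1)])
  have "p ` D \<subseteq> convex hull (p ` S)" using S(2) by (meson hull_subset image_mono order_trans)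
  then have F: "F face_of (convex hull (p ` S))"
    unfolding F_def by (intro minimal_face_face_of convex_convex_hull)
  have DF: "p ` D \<subseteq> F" unfolding F_def by (rule subset_minimal_face)
  have T_F: "p t \<in> F" if "t \<in> ?T" for t
    using that balanced_in_face[OF S F DF] by blast
  show iff: "p s \<in> F \<longleftrightarrow> (\<exists>\<mu> \<nu>. balanced S D p \<mu> \<nu> \<and> 0 < \<mu> s)" if s: "s \<in> S" for s
  proof
    assume "p s \<in> F"
    then have "p s \<in> convex hull (p ` ?T)" using FT by blast
    moreover have finT: "finite ?T" using S(1) by simp
    ultimately obtain l where l: "\<forall>t\<in>?T. 0 \<le> l t" "sum l ?T = 1" "p s = (\<Sum>t\<in>?T. l t *\<^sub>R p t)"
      unfolding convex_hull_image_finite[OF finT] by blast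
    define l' where "l' t = (if t \<in> ?T then l t else 0)" for t
    let ?i = "\<lambda>t. if t = s then 1 else 0 :: real"
    show "\<exists>\<mu> \<nu>. balanced S D p \<mu> \<nu> \<and> 0 < \<mu> s"
    proof (rule balanced_substitute[OF S(1), of ?T D p l' ?i])
      show "0 \<le> l' t" "t \<notin> ?T \<Longrightarrow> l' t = 0" for t using l(1) by (auto simp: l'_def)
      have "sum l' S = sum l' ?T" by (rule sum.mono_neutral_right) (use S in \<open>auto simp: l'_def\<close>)
      also have "\<dots> = sum l ?T" by (rule sum.cong) (auto simp: l'_def)
      also have "\<dots> = 1" by (rule l(2))
      finally show "sum ?i S = sum l' S" using s S(1) by simp
      have "(\<Sum>t\<in>S. l' t *\<^sub>R p t) = (\<Sum>t\<in>?T. l' t *\<^sub>R p t)"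
        by (rule sum.mono_neutral_right) (use S in \<open>auto simp: l'_def\<close>)
      also have "\<dots> = p s" unfolding l(3) by (rule sum.cong) (auto simp: l'_def)
      moreover have "(\<Sum>t\<in>S. ?i t *\<^sub>R p t) = (\<Sum>t\<in>S. if t = s then p t else 0)"
        by (rule sum.cong) auto
      ultimately show "(\<Sum>t\<in>S. ?i t *\<^sub>R p t) = (\<Sum>t\<in>S. l' t *\<^sub>R p t)"
        using s S(1) by simp
    qed auto
  next
    assume "\<exists>\<mu> \<nu>. balanced S D p \<mu> \<nu> \<and> 0 < \<mu> s"
    then show "p s \<in> F" using T_F s by blast
  qed
  then have "{s \<in> S. p s \<in> F} = ?T" by blast
  then show "F \<subseteq> convex hull (p ` {s \<in> S. p s \<in> F})" using FT by simp
qed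

section \<open>Finite-dimensional subspaces and simultaneous approximation\<close>

text \<open>The Lie algebra sits in an arbitrary normed space, and its subspaces must be known to be
  closed. Vectors are added one at a time, each new coordinate being controlled by the distance to
  the span of the earlier ones.\<close>

lemma complete_span_finite:
  fixes B :: "'v::real_normed_vector set"
  assumes "finite B"
  shows "complete (span B)"
  using assms
proof induction
  case empty
  have "compact {0 :: 'v}" by simp
  then show ?case by (simp add: compact_imp_complete)
next
  case (insert a B)
  show ?case
  proof (cases "a \<in> span B")
    case True
    then show ?thesis using insert by (simp add: span_redundant)
  next
    case False
    define d where "d = infdist a (span B)"
    have cl: "closed (span B)" by (rule complete_imp_closed[OF insert.IH])
    have d: "0 < d"
      using infdist_pos_not_in_closed[OF cl _ False] span_zero unfolding d_def by blast
    \<comment> \<open>The coordinate along \<open>a\<close> is Lipschitz with constant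
      \<open>1 / d\<close>, so a Cauchy sequence has Cauchy coordinates.\<close>
    have coord: "\<bar>c\<bar> * d \<le> norm (c *\<^sub>R a + y)" if "y \<in> span B" for c y
    proof (cases "c = 0")
      case False
      have "(- (1 / c)) *\<^sub>R y \<in> span B" using that by (rule span_scale)
      then have "d \<le> dist a ((- (1 / c)) *\<^sub>R y)" unfolding d_def by (rule infdist_le)
      also have "\<dots> = norm (c *\<^sub>R a + y) / \<bar>c\<bar>"
      proof -
        have "a - (- (1 / c)) *\<^sub>R y = (1 / c) *\<^sub>R (c *\<^sub>R a + y)" using False by (simp add: algebra_simps)
        then show ?thesis unfolding dist_norm by (simp add: divide_inverse mult.commute)
      qed
      finally show ?thesis using False by (simp add: pos_le_divide_eq mult.commute)
    qed simp
    show ?thesis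
      unfolding complete_def
    proof (intro allI impI)
      fix f assume f: "(\<forall>n. f n \<in> span (insert a B)) \<and> Cauchy f"
      have "\<exists>k. f n - k *\<^sub>R a \<in> span B" for n using f span_breakdown_eq[of "f n" a B] by blast
      then obtain c where c: "\<And>n. f n - c n *\<^sub>R a \<in> span B" by metis
      have "Cauchy c"
      proof (rule CauchyI)
        fix e :: real assume "0 < e"
        then have "0 < e * d" using d by simp
        then obtain M where M: "\<And>m n. m \<ge> M \<Longrightarrow> n \<ge> M \<Longrightarrow> norm (f m - f n) < e * d"
          using f CauchyD[of f "e * d"] by blast
        have "norm (c m - c n) < e" if "m \<ge> M" "n \<ge> M" for m n
        proof -
          have "(f m - c m *\<^sub>R a) - (f n - c n *\<^sub>R a) \<in> span B" by (rule span_diff[OF c c])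
          from coord[OF this, of "c m - c n"] have "\<bar>c m - c n\<bar> * d \<le> norm (f m - f n)"
            by (simp add: algebra_simps)
          also have "\<dots> < e * d" using M that by blast
          finally show ?thesis using d by simp
        qed
        then show "\<exists>M. \<forall>m\<ge>M. \<forall>n\<ge>M. norm (c m - c n) < e" by blast
      qed
      then obtain c0 where c0: "c \<longlonglongrightarrow> c0" using Cauchy_convergent convergent_def by blast
      then have ca: "(\<lambda>n. c n *\<^sub>R a) \<longlonglongrightarrow> c0 *\<^sub>R a" by (intro tendsto_intros)
      have "Cauchy (\<lambda>n. f n - c n *\<^sub>R a)"
      proof (rule CauchyI)
        fix e :: real assume e: "0 < e"
        obtain M1 where M1: "\<And>m n. m \<ge> M1 \<Longrightarrow> n \<ge> M1 \<Longrightarrow> norm (f m - f n) < e / 2"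
          using CauchyD[of f "e / 2"] f e by auto
        obtain M2 where M2: "\<And>m n. m \<ge> M2 \<Longrightarrow> n \<ge> M2 \<Longrightarrow> norm (c m *\<^sub>R a - c n *\<^sub>R a) < e / 2"
          using CauchyD[OF LIMSEQ_imp_Cauchy[OF ca], of "e / 2"] e by auto
        have "norm ((f m - c m *\<^sub>R a) - (f n - c n *\<^sub>R a)) < e"
          if "m \<ge> max M1 M2" "n \<ge> max M1 M2" for m n
        proof -
          have "norm ((f m - f n) - (c m *\<^sub>R a - c n *\<^sub>R a)) \<le> norm (f m - f n) + norm (c m *\<^sub>R a - c n *\<^sub>R a)"
            by (rule norm_triangle_ineq4)
          moreover have "(f m - f n) - (c m *\<^sub>R a - c n *\<^sub>R a) = (f m - c m *\<^sub>R a) - (f n - c n *\<^sub>R a)"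
            by simp
          ultimately show ?thesis using M1[of m n] M2[of m n] that by simp
        qed
        then show "\<exists>M. \<forall>m\<ge>M. \<forall>n\<ge>M. norm ((f m - c m *\<^sub>R a) - (f n - c n *\<^sub>R a)) < e" by blast
      qed
      then obtain y where y: "y \<in> span B" "(\<lambda>n. f n - c n *\<^sub>R a) \<longlonglongrightarrow> y"
        using completeE[OF insert.IH, of "\<lambda>n. f n - c n *\<^sub>R a"] c by blast
      have "f \<longlonglongrightarrow> y + c0 *\<^sub>R a" using tendsto_add[OF y(2) ca] by simp
      moreover have "y + c0 *\<^sub>R a \<in> span (insert a B)"
        using y(1) span_mono[of B "insert a B"] by (intro span_add span_scale) (auto intro: span_base)
      ultimately show "\<exists>l\<in>span (insert a B). f \<longlonglongrightarrow> l" by blast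
    qed
  qed
qed

text \<open>Dirichlet's box principle. Some cell of side \<delta> is visited infinitely often, so
  two visits can be chosen at least \<open>k\<close> apart.\<close>

lemma simultaneous_pigeonhole:
  fixes c :: "nat \<Rightarrow> 'i \<Rightarrow> real"
  assumes I: "finite I" and c: "\<And>n i. i \<in> I \<Longrightarrow> 0 \<le> c n i \<and> c n i \<le> 1" and \<delta>: "0 < \<delta>"
  shows "\<exists>m n. m + k \<le> n \<and> (\<forall>i\<in>I. \<bar>c m i - c n i\<bar> < \<delta>)"
proof -
  let ?cell = "\<lambda>n. restrict (\<lambda>i. \<lfloor>c n i / \<delta>\<rfloor>) I"
  have "?cell n \<in> I \<rightarrow>\<^sub>E {0..\<lfloor>1 / \<delta>\<rfloor>}" for n
    using c \<delta> by (auto intro!: floor_mono divide_right_mono)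
  then have "range ?cell \<subseteq> I \<rightarrow>\<^sub>E {0..\<lfloor>1 / \<delta>\<rfloor>}" by blast
  then have "finite (range ?cell)" using I finite_PiE finite_subset by (metis finite_atLeastAtMost_int)
  then obtain m where m: "infinite {n \<in> UNIV. ?cell n = ?cell m}"
    using pigeonhole_infinite[of UNIV ?cell] infinite_UNIV_nat by blast
  then obtain n where n: "m + k \<le> n" "?cell n = ?cell m"
    unfolding infinite_nat_iff_unbounded_le by blast
  have "\<bar>c m i - c n i\<bar> < \<delta>" if "i \<in> I" for i
  proof -
    have "\<lfloor>c n i / \<delta>\<rfloor> = \<lfloor>c m i / \<delta>\<rfloor>" using fun_cong[OF n(2), of i] that by simp
    then have "\<bar>c m i / \<delta> - c n i / \<delta>\<bar> < 1" by linarith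
    then have "\<bar>c m i - c n i\<bar> / \<delta> < 1" using \<delta> by (simp flip: diff_divide_distrib)
    then show ?thesis using \<delta> by simp
  qed
  then show ?thesis using n(1) by blast
qed

section \<open>The Malcev completion\<close>

lemma lie_bracket_rules:
  assumes "two_step_lie_algebra V br"
  shows "bilinear br" "subspace V" "x \<in> V \<Longrightarrow> y \<in> V \<Longrightarrow> br x y \<in> V" "x \<in> V \<Longrightarrow> br x x = 0"
    "x \<in> V \<Longrightarrow> y \<in> V \<Longrightarrow> u \<in> V \<Longrightarrow> br (br x y) u = 0"
    "x \<in> V \<Longrightarrow> y \<in> V \<Longrightarrow> br y x = - br x y"
    "x \<in> V \<Longrightarrow> y \<in> V \<Longrightarrow> u \<in> V \<Longrightarrow> br u (br x y) = 0"
proof -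
  show bil: "bilinear br" and sub: "subspace V" using assms by (auto simp: two_step_lie_algebra_def)
  show c: "br x y \<in> V" if "x \<in> V" "y \<in> V" for x y using assms that by (auto simp: two_step_lie_algebra_def)
  show s: "br x x = 0" if "x \<in> V" for x using assms that by (auto simp: two_step_lie_algebra_def)
  show d: "br (br x y) u = 0" if "x \<in> V" "y \<in> V" "u \<in> V" for x y u
    using assms that by (auto simp: two_step_lie_algebra_def)
  show a: "br y x = - br x y" if "x \<in> V" "y \<in> V" for x y
  proof -
    have "br (x + y) (x + y) = br x x + br x y + (br y x + br y y)"
      using bil by (simp add: bilinear_ladd bilinear_radd)
    then show ?thesis using s that subspace_add[OF sub that] by (simp add: eq_neg_iff_add_eq_0 add.commute)
  qed
  show "br u (br x y) = 0" if "x \<in> V" "y \<in> V" "u \<in> V" for x y u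
    using d[OF that] a[of "br x y" u] c that by simp
qed

lemma bch_group_group:
  assumes L: "two_step_lie_algebra V br"
  shows "group (bch_group V br)"
    and "x \<in> V \<Longrightarrow> inv\<^bsub>bch_group V br\<^esub> x = - x"
proof -
  note r = lie_bracket_rules[OF L]
  note bil = bilinear_ladd[OF r(1)] bilinear_radd[OF r(1)] bilinear_lmul[OF r(1)] bilinear_rmul[OF r(1)]
    bilinear_lneg[OF r(1)] bilinear_rneg[OF r(1)] bilinear_lzero[OF r(1)] bilinear_rzero[OF r(1)]
  note subs = subspace_add[OF r(2)] subspace_scale[OF r(2)] subspace_0[OF r(2)] subspace_neg[OF r(2)]
  show g: "group (bch_group V br)"
  proof (rule groupI)
    fix x y u assume "x \<in> carrier (bch_group V br)" "y \<in> carrier (bch_group V br)" "u \<in> carrier (bch_group V br)"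
    then have V: "x \<in> V" "y \<in> V" "u \<in> V" by (auto simp: bch_group_def)
    then show "x \<otimes>\<^bsub>bch_group V br\<^esub> y \<otimes>\<^bsub>bch_group V br\<^esub> u = x \<otimes>\<^bsub>bch_group V br\<^esub> (y \<otimes>\<^bsub>bch_group V br\<^esub> u)"
      by (simp add: bch_group_def bil r(5,7) algebra_simps)
  next
    fix x assume x: "x \<in> carrier (bch_group V br)"
    then show "\<exists>y\<in>carrier (bch_group V br). y \<otimes>\<^bsub>bch_group V br\<^esub> x = \<one>\<^bsub>bch_group V br\<^esub>"
      by (intro bexI[of _ "- x"]) (auto simp: bch_group_def bil r(4) subs)
  qed (auto simp: bch_group_def bil r(3) subs)
  show "inv\<^bsub>bch_group V br\<^esub> x = - x" if "x \<in> V"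
    by (rule group.inv_equality[OF g]) (use that in \<open>auto simp: bch_group_def bil r(4) subs\<close>)
qed

locale malcev = two_step_group +
  fixes V :: "'v::real_normed_vector set" and br :: "'v \<Rightarrow> 'v \<Rightarrow> 'v" and j :: "'a \<Rightarrow> 'v"
    and Pr :: "'v \<Rightarrow> 'w::real_vector"
  assumes malcev: "malcev_completion G V br j" and abelianization: "abelianization_map V br Pr"
begin

section \<open>Brackets of lattice elements\<close>

lemma lie: "two_step_lie_algebra V br"
  using malcev by (simp add: malcev_completion_def)

lemmas br_bilinear = lie_bracket_rules(1)[OF lie] and V_subspace = lie_bracket_rules(2)[OF lie]
  and br_closed = lie_bracket_rules(3)[OF lie] and br_self = lie_bracket_rules(4)[OF lie]
  and br_br_left = lie_bracket_rules(5)[OF lie] and br_swap = lie_bracket_rules(6)[OF lie]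
  and br_br_right = lie_bracket_rules(7)[OF lie]

lemmas br_simps = bilinear_ladd[OF br_bilinear] bilinear_radd[OF br_bilinear]
  bilinear_lmul[OF br_bilinear] bilinear_rmul[OF br_bilinear]
  bilinear_lneg[OF br_bilinear] bilinear_rneg[OF br_bilinear]
  bilinear_lzero[OF br_bilinear] bilinear_rzero[OF br_bilinear]

lemmas V_simps = subspace_add[OF V_subspace] subspace_scale[OF V_subspace] subspace_0[OF V_subspace]
  subspace_neg[OF V_subspace] subspace_diff[OF V_subspace]

lemma j_closed [simp]: "x \<in> carrier G \<Longrightarrow> j x \<in> V"
  and j_mult: "x \<in> carrier G \<Longrightarrow> y \<in> carrier G \<Longrightarrow> j (x \<otimes> y) = j x + j y + (1/2) *\<^sub>R br (j x) (j y)"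
  using malcev by (auto simp: malcev_completion_def hom_def bch_group_def)

lemma j_inj: "x \<in> carrier G \<Longrightarrow> y \<in> carrier G \<Longrightarrow> j x = j y \<longleftrightarrow> x = y"
  using malcev by (auto simp: malcev_completion_def inj_on_def)

lemma j_one [simp]: "j \<one> = 0"
  using j_mult[of \<one> \<one>] br_self[of "j \<one>"] by simp

lemma j_inv: "x \<in> carrier G \<Longrightarrow> j (inv x) = - j x"
proof -
  assume x: "x \<in> carrier G"
  have e: "j x + j (inv x) + (1/2) *\<^sub>R br (j x) (j (inv x)) = 0"
    using j_mult[of x "inv x"] x by simp
  \<comment> \<open>Bracketing \<open>e\<close> with \<open>j x\<close> isolates the bracket term,
    because double brackets vanish.\<close>
  have "br (j x) (j x + j (inv x) + (1/2) *\<^sub>R br (j x) (j (inv x))) = br (j x) (j (inv x))"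
    using x by (simp add: br_simps br_self br_br_right)
  then have "br (j x) (j (inv x)) = 0" using e by (simp add: br_simps)
  then show ?thesis using e by (simp add: eq_neg_iff_add_eq_0 add.commute)
qed

lemma j_z_central: "x \<in> carrier G \<Longrightarrow> br (j x) (j z) = 0"
proof -
  assume x: "x \<in> carrier G"
  have "j x + j z + (1/2) *\<^sub>R br (j x) (j z) = j z + j x + (1/2) *\<^sub>R br (j z) (j x)"
    using j_mult[of x z] j_mult[of z x] z_central[OF x] x z_closed by simp
  then have "br (j x) (j z) = br (j z) (j x)" by simp
  also have "\<dots> = - br (j x) (j z)" using x z_closed by (intro br_swap) auto
  finally have "2 *\<^sub>R br (j x) (j z) = 0" by (simp only: eq_neg_iff_add_eq_0 scaleR_2)
  then show ?thesis by simp
qed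

lemma j_zs: "x \<in> carrier G \<Longrightarrow> j (zs x n) = j x + of_int n *\<^sub>R j z"
proof -
  have nat: "j (zs x (int k)) = j x + real k *\<^sub>R j z" if x: "x \<in> carrier G" for x k
  proof (induction k)
    case (Suc k)
    have "zs (zs x (int k)) 1 = zs x (int k) \<otimes> z"
      unfolding zs_def[of "zs x (int k)"] using z_closed by simp
    then have e: "zs x (int (Suc k)) = zs x (int k) \<otimes> z" using x by (simp add: add.commute)
    have "j (zs x (int (Suc k))) = j (zs x (int k)) + j z"
      unfolding e j_mult[OF zs_closed[OF x] z_closed] j_z_central[OF zs_closed[OF x]] by simp
    then show ?case using Suc by (simp add: algebra_simps)
  qed (use x in auto)
  assume x: "x \<in> carrier G"
  show ?thesis
  proof (cases n rule: int_cases2)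
    case (nonneg k)
    then show ?thesis using nat[OF x, of k] by simp
  next
    case (nonpos k)
    have "j x = j (zs x n) + real k *\<^sub>R j z" using nat[of "zs x n" k] x nonpos by simp
    then show ?thesis using nonpos by (simp add: algebra_simps)
  qed
qed

text \<open>In exponential coordinates the two orders of the product differ by the full bracket, in
  \<open>G\<close> by a power of \<open>z\<close>. So on the lattice the Lie bracket is the
  commutator pairing.\<close>

lemma br_j: "x \<in> carrier G \<Longrightarrow> y \<in> carrier G \<Longrightarrow> br (j x) (j y) = of_int (w x y) *\<^sub>R j z"
proof -
  assume x: "x \<in> carrier G" and y: "y \<in> carrier G"
  have "j (x \<otimes> y) = j (y \<otimes> x) + of_int (w x y) *\<^sub>R j z"
    using j_zs[of "y \<otimes> x" "w x y"] commute_w[OF x y] x y by simp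
  then have "j x + j y + (1/2) *\<^sub>R br (j x) (j y) = j y + j x + (1/2) *\<^sub>R br (j y) (j x) + of_int (w x y) *\<^sub>R j z"
    using x y by (simp add: j_mult)
  moreover have "br (j y) (j x) = - br (j x) (j y)" using x y by (intro br_swap) auto
  ultimately have "(1/2) *\<^sub>R br (j x) (j y) + (1/2) *\<^sub>R br (j x) (j y) = of_int (w x y) *\<^sub>R j z"
    by (simp add: algebra_simps)
  then show ?thesis by (simp flip: scaleR_add_left)
qed

lemma j_ev:
  "set u \<subseteq> S \<Longrightarrow> j (ev u) = sum_list (map j u) + (of_int (area u) / 2) *\<^sub>R j z"
proof (induction u)
  case (Cons s u)
  then have S: "s \<in> carrier G" "ev u \<in> carrier G" by auto
  have "j (ev (s # u)) = j s + j (ev u) + (real_of_int (w s (ev u)) / 2) *\<^sub>R j z"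
    using j_mult[OF S] br_j[OF S] by simp
  then show ?case using Cons by (simp add: algebra_simps add_divide_distrib)
qed auto

text \<open>If \<open>v\<close> were outside the span, its multiples would move away from the span
  at linear speed. By cocompactness each multiple is a lattice point times an element of the compact
  \<open>K\<close>, hence agrees modulo the span with a vector of bounded norm. The brackets are
  included to absorb the correction term of the product.\<close>

lemma V_eq_span: "V = span (j ` carrier G \<union> {br x y | x y. x \<in> V \<and> y \<in> V})" (is "V = span ?A")
proof
  have "?A \<subseteq> V" using br_closed by auto
  then show "span ?A \<subseteq> V" using V_subspace by (rule span_minimal)
  show "V \<subseteq> span ?A"
  proof
    fix v assume v: "v \<in> V"
    show "v \<in> span ?A"
    proof (rule ccontr)
      assume nv: "v \<notin> span ?A"
      have "\<exists>B. finite B \<and> V = span B" using lie by (simp only: two_step_lie_algebra_def)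
      then obtain B where B: "finite B" "V = span B" by (elim exE conjE)
      obtain C where C: "C \<subseteq> span ?A" "independent C" "span ?A \<subseteq> span C"
        by (rule maximal_independent_subset)
      have "C \<subseteq> span B" using subset_trans[OF C(1) \<open>span ?A \<subseteq> V\<close>] unfolding B(2) .
      then have "finite C" by (rule independent_span_bound[OF B(1) C(2), THEN conjunct1])
      then have "closed (span C)" by (rule complete_imp_closed[OF complete_span_finite])
      moreover have "span C = span ?A"
        using span_minimal[OF C(1) subspace_span] C(3) by (rule subset_antisym)
      ultimately have cl: "closed (span ?A)" by simp
      define d where "d = infdist v (span ?A)"
      have d: "0 < d" unfolding d_def
        using infdist_pos_not_in_closed[OF cl _ nv] span_zero by blast
      obtain K where K: "compact K" "K \<subseteq> V" "V = (j ` carrier G) <#>\<^bsub>bch_group V br\<^esub> K"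
      proof -
        have "\<exists>K. compact K \<and> K \<subseteq> V \<and> V = (j ` carrier G) <#>\<^bsub>bch_group V br\<^esub> K"
          using malcev by (simp only: malcev_completion_def)
        then show thesis using that by (elim exE conjE)
      qed
      obtain M where M: "\<And>k. k \<in> K \<Longrightarrow> norm k \<le> M"
        using compact_imp_bounded[OF K(1)] by (auto simp: bounded_iff)
      obtain n :: nat where n: "M / d < real n" using reals_Archimedean2 by blast
      have "real n *\<^sub>R v \<in> V" using v by (simp add: V_simps)
      then obtain h k where hk: "h \<in> carrier G" "k \<in> K" "real n *\<^sub>R v = j h + k + (1/2) *\<^sub>R br (j h) k"
      proof -
        have "real n *\<^sub>R v \<in> (j ` carrier G) <#>\<^bsub>bch_group V br\<^esub> K"
          using K(3) \<open>real n *\<^sub>R v \<in> V\<close> by (rule equalityD1[THEN subsetD])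
        then show thesis using that by (auto simp: set_mult_def bch_group_def)
      qed
      have M0: "0 \<le> M" using M[OF hk(2)] norm_ge_zero order_trans by blast
      then have n0: "0 < real n" using n d by (metis divide_nonneg_pos le_less_trans)
      have kV: "k \<in> V" using hk(2) K(2) by blast
      let ?u = "(1 / real n) *\<^sub>R (j h + (1/2) *\<^sub>R br (j h) k)"
      have "br (j h) k \<in> ?A" using hk(1) kV j_closed by blast
      moreover have "j h \<in> ?A" using hk(1) by blast
      ultimately have u: "?u \<in> span ?A" by (intro span_scale span_add span_base)
      have "k = real n *\<^sub>R (v - ?u)" using hk(3) n0 by (simp add: algebra_simps)
      then have "norm k = norm (real n *\<^sub>R (v - ?u))" by (rule arg_cong)
      then have "norm k = real n * dist v ?u" unfolding dist_norm norm_scaleR by simp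
      moreover have "d \<le> dist v ?u" unfolding d_def by (rule infdist_le[OF u])
      ultimately have "real n * d \<le> M"
        using M[OF hk(2)] mult_left_mono[of d "dist v ?u" "real n"] by simp
      then show False using n d by (simp add: pos_divide_less_eq mult.commute)
    qed
  qed
qed

text \<open>On the spanning set the brackets are multiples of \<open>j z\<close> by
  \<open>br_j\<close>, or zero as double brackets; bilinearity extends this to one variable after
  the other.\<close>

lemma br_in_centre: 
  assumes "x \<in> V" "y \<in> V" shows "br x y \<in> span {j z}"
proof -
  let ?A = "j ` carrier G \<union> {br x y | x y. x \<in> V \<and> y \<in> V}"
  have sub: "subspace {y. br x y \<in> span {j z}}" "subspace {y. br y x \<in> span {j z}}" for x
    by (auto simp: subspace_def br_simps span_zero intro: span_add span_scale)
  have AV: "a \<in> V" if "a \<in> ?A" for a using that br_closed by auto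
  have AA: "br a b \<in> span {j z}" if "a \<in> ?A" "b \<in> ?A" for a b
  proof -
    consider h h' where "h \<in> carrier G" "h' \<in> carrier G" "a = j h" "b = j h'"
      | x y where "x \<in> V" "y \<in> V" "a = br x y" | x y where "x \<in> V" "y \<in> V" "b = br x y"
      using \<open>a \<in> ?A\<close> \<open>b \<in> ?A\<close> by blast
    then show ?thesis
    proof cases
      case 1
      then show ?thesis by (simp add: br_j span_scale span_base)
    next
      case 2
      then show ?thesis using br_br_left[OF 2(1,2) AV[OF \<open>b \<in> ?A\<close>]] by (simp add: span_zero)
    next
      case 3
      then show ?thesis using br_br_right[OF 3(1,2) AV[OF \<open>a \<in> ?A\<close>]] by (simp add: span_zero)
    qed
  qed
  have Ay: "br a y \<in> span {j z}" if a: "a \<in> ?A" and y: "y \<in> V" for a y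
  proof -
    have "span ?A \<subseteq> {y. br a y \<in> span {j z}}"
      by (rule span_minimal[OF _ sub(1)]) (use AA[OF a] in blast)
    then show ?thesis using V_eq_span y by blast
  qed
  have "span ?A \<subseteq> {x. br x y \<in> span {j z}}"
    by (rule span_minimal[OF _ sub(2)]) (use Ay[OF _ assms(2)] in blast)
  then show ?thesis using V_eq_span assms(1) by blast
qed

lemma br_span_jz: "x \<in> V \<Longrightarrow> v \<in> span {j z} \<Longrightarrow> br x v = 0"
proof -
  assume x: "x \<in> V" and v: "v \<in> span {j z}"
  let ?A = "j ` carrier G \<union> {br x y | x y. x \<in> V \<and> y \<in> V}"
  have zV: "j z \<in> V" using z_closed by simp
  have s: "subspace {y. br y (j z) = 0}"
    by (auto simp: subspace_def br_simps)
  have "br a (j z) = 0" if "a \<in> ?A" for a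
    using that j_z_central br_br_left[OF _ _ zV] by auto
  then have "span ?A \<subseteq> {y. br y (j z) = 0}" by (intro span_minimal s) blast
  then have "br x (j z) = 0" using V_eq_span x by blast
  then show ?thesis using v by (auto simp: span_singleton br_simps)
qed

section \<open>The kernel of the abelianization\<close>

lemma linear_Pr: "linear Pr"
  using abelianization by (simp add: abelianization_map_def)

lemma commutator_bch:
  assumes "x \<in> V" "y \<in> V"
  shows "x \<otimes>\<^bsub>bch_group V br\<^esub> y \<otimes>\<^bsub>bch_group V br\<^esub> inv\<^bsub>bch_group V br\<^esub> x \<otimes>\<^bsub>bch_group V br\<^esub> inv\<^bsub>bch_group V br\<^esub> y = br x y"
proof -
  have "br y x = - br x y" using assms by (rule br_swap)
  moreover have "br x y = (1/2) *\<^sub>R br x y + (1/2) *\<^sub>R br x y" by (simp flip: scaleR_add_left)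
  ultimately show ?thesis
    using assms bch_group_group(2)[OF lie] by (simp add: bch_group_def br_simps br_self br_br_left br_br_right br_closed V_simps)
qed

text \<open>Commutators in \<open>V\<close> are brackets and lie on the line of \<open>j z\<close>.
  Conversely a single non-trivial commutator of \<open>G\<close> puts a non-zero multiple of
  \<open>j z\<close> into the kernel, and linearity of \<open>Pr\<close> supplies the rest of the
  line.\<close>

lemma Pr_zero_iff: 
  assumes v: "v \<in> V" shows "Pr v = 0 \<longleftrightarrow> v \<in> span {j z}"
proof -
  have ker: "{v \<in> V. Pr v = 0} = derived (bch_group V br) V"
    using abelianization by (simp add: abelianization_map_def)
  have zV: "j z \<in> V" using z_closed by simp
  then have szV: "span {j z} \<subseteq> V" by (intro span_minimal V_subspace) simp
  have "derived (bch_group V br) V \<subseteq> span {j z}"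
  proof
    fix x assume "x \<in> derived (bch_group V br) V"
    then show "x \<in> span {j z}"
      unfolding derived_def
    proof (induction rule: generate.induct)
      case one
      then show ?case by (simp add: bch_group_def span_zero)
    next
      case (incl h)
      then show ?case using commutator_bch br_in_centre by auto
    next
      case (inv h)
      then obtain x y where "x \<in> V" "y \<in> V" "h = br x y" using commutator_bch by auto
      then show ?case using bch_group_group(2)[OF lie] br_closed br_in_centre by (simp add: span_neg)
    next
      case (eng h1 h2)
      then have "br h1 h2 = 0" using szV by (intro br_span_jz) auto
      then show ?case using eng by (simp add: bch_group_def span_add)
    qed
  qed
  then have 1: "Pr v = 0 \<Longrightarrow> v \<in> span {j z}" using ker v by blast
  obtain x y where xy: "x \<in> carrier G" "y \<in> carrier G" "x \<otimes> y \<noteq> y \<otimes> x" using nonabelian by blast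
  then have wne: "w x y \<noteq> 0" using commute_iff_w by blast
  have "br (j x) (j y) \<in> derived (bch_group V br) V"
    unfolding derived_def commutator_bch[OF j_closed[OF xy(1)] j_closed[OF xy(2)], symmetric]
    using xy by (intro generate.incl UN_I[of "j x"] UN_I[of "j y"] singletonI j_closed)
  then have "Pr (br (j x) (j y)) = 0" using ker by blast
  then have "of_int (w x y) *\<^sub>R Pr (j z) = 0" using xy linear_Pr by (simp add: br_j linear_scale)
  then have "Pr (j z) = 0" using wne by simp
  then have "v \<in> span {j z} \<Longrightarrow> Pr v = 0" using linear_Pr by (auto simp: span_singleton linear_scale)
  then show ?thesis using 1 by blast
qed

lemma Pr_jz [simp]: "Pr (j z) = 0"
  using Pr_zero_iff[of "j z"] z_closed by (simp add: span_base)

lemma j_discrete: "\<exists>e>0. \<forall>x\<in>carrier G. norm (j x) < e \<longrightarrow> x = \<one>"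
proof -
  have "discrete (j ` carrier G)" using malcev by (simp add: malcev_completion_def)
  then have "j \<one> isolated_in (j ` carrier G)" by (rule discreteD) (rule imageI[OF one_closed])
  then obtain e where e: "e > 0" "\<forall>y\<in>j ` carrier G. dist (j \<one>) y < e \<longrightarrow> y = j \<one>"
    unfolding isolated_in_dist_Ex_iff by blast
  have "x = \<one>" if "x \<in> carrier G" "norm (j x) < e" for x
    using e(2) that j_inj[of x \<one>] by (auto simp: dist_norm)
  then show ?thesis using e(1) by blast
qed

end

section \<open>From real to integral relations\<close>

context malcev
begin

section \<open>Letter counts and the rounding argument\<close>

lemma word_with_counts: "\<exists>u. set u \<subseteq> S \<and> (\<forall>t\<in>S. count (mset u) t = n t)"
proof -
  obtain u where u: "mset u = (\<Sum>t\<in>S. replicate_mset (n t) t)" using ex_mset by blast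
  have "set u \<subseteq> S"
  proof -
    have "set_mset (\<Sum>t\<in>S. replicate_mset (n t) t) \<subseteq> S"
      using finite_S by (subst set_mset_sum) auto
    then show ?thesis using u by (metis set_mset_mset)
  qed
  moreover have "count (mset u) t = n t" if "t \<in> S" for t
    using that finite_S by (simp add: u count_sum)
  ultimately show ?thesis by blast
qed

lemma sum_list_counts:
  fixes f :: "'a \<Rightarrow> 'u::real_vector"
  assumes "set u \<subseteq> S"
  shows "sum_list (map f u) = (\<Sum>t\<in>S. real (count (mset u) t) *\<^sub>R f t)"
  using assms
proof (induction u)
  case (Cons a u)
  have "(\<Sum>t\<in>S. real (count (mset (a # u)) t) *\<^sub>R f t) =
      (\<Sum>t\<in>S. real (count (mset u) t) *\<^sub>R f t + (if t = a then f t else 0))"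
    by (rule sum.cong) (auto simp: algebra_simps)
  also have "\<dots> = (\<Sum>t\<in>S. real (count (mset u) t) *\<^sub>R f t) + f a"
    using Cons.prems finite_S by (simp add: sum.distrib)
  finally show ?case using Cons by simp
qed simp

lemma length_counts: "set u \<subseteq> S \<Longrightarrow> real (length u) = (\<Sum>t\<in>S. real (count (mset u) t))"
  using sum_list_counts[of u "\<lambda>_. 1::real"] by (simp add: sum_list_triv)

text \<open>The central terms drop out of the bracket, so only pairs of letters contribute, with one
  coefficient bounded and the other small.\<close>

lemma norm_br_combination:
  assumes a: "\<And>t. t \<in> S \<Longrightarrow> \<bar>a t\<bar> \<le> 1" and b: "\<And>t. t \<in> S \<Longrightarrow> \<bar>b t\<bar> \<le> 2 * \<delta>" and \<delta>: "0 \<le> \<delta>"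
  shows "norm (br ((\<Sum>t\<in>S. a t *\<^sub>R j t) + r *\<^sub>R j z) ((\<Sum>t\<in>S. b t *\<^sub>R j t) + r' *\<^sub>R j z))
    \<le> \<delta> * (\<Sum>(t, t')\<in>S \<times> S. 2 * \<bar>real_of_int (w t t')\<bar> * norm (j z))"
proof -
  have zV: "j z \<in> V" using z_closed by simp
  have SV: "(\<Sum>t\<in>S. c t *\<^sub>R j t) \<in> V" for c
    by (rule subspace_sum[OF V_subspace]) (simp add: V_simps)
  have z1: "br x (j z) = 0" "br (j z) x = 0" if "x \<in> V" for x
    using br_span_jz[OF that, of "j z"] br_swap[OF that zV] by (auto simp: span_base)
  have "br ((\<Sum>t\<in>S. a t *\<^sub>R j t) + r *\<^sub>R j z) ((\<Sum>t\<in>S. b t *\<^sub>R j t) + r' *\<^sub>R j z) =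
      br (\<Sum>t\<in>S. a t *\<^sub>R j t) (\<Sum>t\<in>S. b t *\<^sub>R j t)"
    using z1 SV zV by (simp add: br_simps)
  also have "\<dots> = (\<Sum>(t, t')\<in>S \<times> S. br (a t *\<^sub>R j t) (b t' *\<^sub>R j t'))"
    by (rule bilinear_sum[OF br_bilinear])
  also have "norm \<dots> \<le> (\<Sum>(t, t')\<in>S \<times> S. \<delta> * (2 * \<bar>real_of_int (w t t')\<bar> * norm (j z)))"
  proof (rule sum_norm_le, clarify)
    fix t t' assume t: "t \<in> S" "t' \<in> S"
    have "norm (br (a t *\<^sub>R j t) (b t' *\<^sub>R j t')) = \<bar>a t\<bar> * \<bar>b t'\<bar> * (\<bar>real_of_int (w t t')\<bar> * norm (j z))"
      using t by (simp add: br_simps br_j abs_mult)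
    also have "\<dots> \<le> (1 * (2 * \<delta>)) * (\<bar>real_of_int (w t t')\<bar> * norm (j z))"
      using a[OF t(1)] b[OF t(2)] \<delta> by (intro mult_right_mono mult_mono) auto
    finally show "norm (br (a t *\<^sub>R j t) (b t' *\<^sub>R j t')) \<le> \<delta> * (2 * \<bar>real_of_int (w t t')\<bar> * norm (j z))"
      by (simp add: ac_simps)
  qed
  also have "\<dots> = \<delta> * (\<Sum>(t, t')\<in>S \<times> S. 2 * \<bar>real_of_int (w t t')\<bar> * norm (j z))"
    by (simp add: sum_distrib_left case_prod_unfold)
  finally show ?thesis .
qed

text \<open>The elements \<open>h n\<close> below, obtained by rounding \<open>n\<close> times the given relation, stay in a
  bounded region. By discreteness two of them coincide, and their difference is an integral
  relation close to a multiple of the given one.\<close>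

lemma integral_relation:
  assumes nn: "\<And>t. 0 \<le> \<mu> t" "\<And>t. 0 \<le> \<nu> t" and sums: "sum \<mu> S = sum \<nu> S"
    and rel: "(\<Sum>t\<in>S. \<mu> t *\<^sub>R j t) = (\<Sum>t\<in>S. \<nu> t *\<^sub>R j t) + \<rho> *\<^sub>R j z"
    and s: "s \<in> S" "0 < \<mu> s"
  shows "\<exists>p q c. set p \<subseteq> {t\<in>S. 0 < \<mu> t} \<and> set q \<subseteq> {t\<in>S. 0 < \<nu> t} \<and> s \<in> set p \<and>
    length p = length q \<and> ev p = zs (ev q) c \<and>
    (\<rho> = 0 \<and> commuting {t\<in>S. 0 < \<mu> t \<or> 0 < \<nu> t} \<longrightarrow> c = 0)"
proof -
  let ?X = "{t\<in>S. 0 < \<mu> t \<or> 0 < \<nu> t}"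
  have XS: "?X \<subseteq> S" by blast
  define W where "W \<phi> n = (SOME u. set u \<subseteq> S \<and> (\<forall>t\<in>S. count (mset u) t = nat \<lfloor>real n * \<phi> t\<rfloor>))"
    for \<phi> :: "'a \<Rightarrow> real" and n
  have W': "set (W \<phi> n) \<subseteq> S \<and> (\<forall>t\<in>S. count (mset (W \<phi> n)) t = nat \<lfloor>real n * \<phi> t\<rfloor>)" for \<phi> n
    unfolding W_def by (rule someI_ex) (rule word_with_counts)
  have W: "set (W \<phi> n) \<subseteq> S" "t \<in> S \<Longrightarrow> count (mset (W \<phi> n)) t = nat \<lfloor>real n * \<phi> t\<rfloor>" for \<phi> n t
    using W'[of \<phi> n] by blast+
  have cnt: "real (count (mset (W \<phi> n)) t) = real n * \<phi> t - frac (real n * \<phi> t)"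
    if "t \<in> S" "\<And>t. 0 \<le> \<phi> t" for \<phi> n t
  proof -
    have "0 \<le> \<lfloor>real n * \<phi> t\<rfloor>" using that(2)[of t] by simp
    then show ?thesis using W(2)[OF that(1)] by (simp add: frac_def)
  qed
  have supp: "set (W \<phi> n) \<subseteq> {t\<in>S. 0 < \<phi> t}" if "\<And>t. 0 \<le> \<phi> t" for \<phi> n
  proof
    fix t assume t: "t \<in> set (W \<phi> n)"
    then have tS: "t \<in> S" using W(1) by blast
    have "0 < count (mset (W \<phi> n)) t" using t by simp
    then have "\<phi> t \<noteq> 0" using W(2)[OF tS, of \<phi> n] by (intro notI) simp
    then show "t \<in> {t\<in>S. 0 < \<phi> t}" using that[of t] tS by simp
  qed
  define P Q where "P = W \<mu>" and "Q = W \<nu>"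
  have PS: "set (P n) \<subseteq> S" and QS: "set (Q n) \<subseteq> S" for n unfolding P_def Q_def by (rule W(1))+
  have PX: "set (P n) \<subseteq> ?X" and QX: "set (Q n) \<subseteq> ?X" for n
    unfolding P_def Q_def using supp[of \<mu> n] supp[of \<nu> n] nn by blast+
  \<comment> \<open>The central term created by the arrangement of letters in \<open>P n\<close> and
    \<open>Q n\<close> and by multiplying the first with the inverse of the second.\<close>
  define \<tau> where "\<tau> n = (real_of_int (area (P n)) - real_of_int (area (Q n)) - real_of_int (w (ev (P n)) (ev (Q n)))) / 2" for n
  define \<sigma> where "\<sigma> n = real n * \<rho> + \<tau> n" for n
  define b where "b n t = frac (real n * \<nu> t) - frac (real n * \<mu> t)" for n t
  \<comment> \<open>Removing the integer part of the central coordinate leaves a fractional part, so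
    \<open>j (h n)\<close> stays bounded although areas may grow quadratically in
    \<open>n\<close>.\<close>
  define h where "h n = zs (ev (P n) \<otimes> inv (ev (Q n))) (- \<lfloor>\<sigma> n\<rfloor>)" for n
  have hC [simp]: "h n \<in> carrier G" for n unfolding h_def using PS QS by simp
  have sum_word: "sum_list (map j (W \<phi> n)) = real n *\<^sub>R (\<Sum>t\<in>S. \<phi> t *\<^sub>R j t) - (\<Sum>t\<in>S. frac (real n * \<phi> t) *\<^sub>R j t)"
    if "\<And>t. 0 \<le> \<phi> t" for \<phi> n
  proof -
    have "sum_list (map j (W \<phi> n)) = (\<Sum>t\<in>S. (real n * \<phi> t - frac (real n * \<phi> t)) *\<^sub>R j t)"
      unfolding sum_list_counts[OF W(1)] by (rule sum.cong) (simp_all add: cnt that)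
    then show ?thesis by (simp add: scaleR_diff_left sum_subtractf scaleR_sum_right)
  qed
  have jh: "j (h n) = (\<Sum>t\<in>S. b n t *\<^sub>R j t) + frac (\<sigma> n) *\<^sub>R j z" for n
  proof -
    have "j (ev (P n) \<otimes> inv (ev (Q n))) = j (ev (P n)) - j (ev (Q n)) - (real_of_int (w (ev (P n)) (ev (Q n))) / 2) *\<^sub>R j z"
      using PS[of n] QS[of n] by (simp add: j_mult j_inv br_simps br_j)
    also have "\<dots> = sum_list (map j (P n)) - sum_list (map j (Q n)) + \<tau> n *\<^sub>R j z"
      using PS[of n] QS[of n] by (simp add: j_ev \<tau>_def algebra_simps diff_divide_distrib add_divide_distrib)
    also have "\<dots> = (\<Sum>t\<in>S. b n t *\<^sub>R j t) + \<sigma> n *\<^sub>R j z"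
      unfolding P_def Q_def sum_word[of \<mu>, OF nn(1)] sum_word[of \<nu>, OF nn(2)] rel
      by (simp add: b_def \<sigma>_def scaleR_diff_left sum_subtractf algebra_simps)
    finally have "j (ev (P n) \<otimes> inv (ev (Q n))) = (\<Sum>t\<in>S. b n t *\<^sub>R j t) + \<sigma> n *\<^sub>R j z" .
    then show ?thesis
      using PS[of n] QS[of n] by (simp add: h_def j_zs frac_def algebra_simps)
  qed
  obtain e where e: "e > 0" "\<And>x. x \<in> carrier G \<Longrightarrow> norm (j x) < e \<Longrightarrow> x = \<one>" using j_discrete by blast
  define A where "A = (\<Sum>t\<in>S. 2 * norm (j t)) + norm (j z)"
  define B where "B = (\<Sum>(t, t')\<in>S \<times> S. 2 * \<bar>real_of_int (w t t')\<bar> * norm (j z))"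
  have AB: "0 \<le> A" "0 \<le> B" unfolding A_def B_def by (auto intro!: sum_nonneg add_nonneg_nonneg)
  \<comment> \<open>The first bound brings \<open>inv (h m) \<otimes> h n\<close> into the ball that
    contains no lattice point but the identity; the second keeps the length difference of
    \<open>p\<close> and \<open>q\<close> below one.\<close>
  define \<delta> where "\<delta> = min (e / (A + B + 1)) (1 / (2 * real (card S) + 1))"
  have \<delta>: "0 < \<delta>" "\<delta> \<le> e / (A + B + 1)" "\<delta> \<le> 1 / (2 * real (card S) + 1)"
    using e(1) AB by (auto simp: \<delta>_def)
  \<comment> \<open>All fractional parts entering \<open>j (h n)\<close> as one vector: tags 0 and 1
    for the coefficients of \<mu> and \<nu>, tag 2 for the central coordinate, where
    \<open>z\<close> is a mere placeholder.\<close>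
  define c where "c n i = (if fst i = (0::nat) then frac (real n * \<mu> (snd i)) else
      if fst i = 1 then frac (real n * \<nu> (snd i)) else frac (\<sigma> n))" for n and i :: "nat \<times> 'a"
  let ?I = "{0, 1} \<times> S \<union> {(2, z)}"
  \<comment> \<open>The gap makes \<open>(n - m) * \<mu> s\<close> at least two, so \<open>s\<close>
    survives in \<open>p\<close> despite a rounding error below one.\<close>
  have "\<exists>m n. m + nat \<lceil>2 / \<mu> s\<rceil> \<le> n \<and> (\<forall>i\<in>?I. \<bar>c m i - c n i\<bar> < \<delta>)"
  proof (rule simultaneous_pigeonhole)
    show "finite ?I" using finite_S by simp
    show "0 \<le> c n i \<and> c n i \<le> 1" for n i
      using frac_lt_1[THEN less_imp_le] by (auto simp: c_def)
  qed (rule \<delta>(1))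
  then obtain m n where mn: "m + nat \<lceil>2 / \<mu> s\<rceil> \<le> n" and close: "\<forall>i\<in>?I. \<bar>c m i - c n i\<bar> < \<delta>" by blast
  have cl: "\<bar>frac (real m * \<mu> t) - frac (real n * \<mu> t)\<bar> < \<delta>" "\<bar>frac (real m * \<nu> t) - frac (real n * \<nu> t)\<bar> < \<delta>"
    if "t \<in> S" for t
    using bspec[OF close, of "(0, t)"] bspec[OF close, of "(1, t)"] that by (auto simp: c_def)
  have clz: "\<bar>frac (\<sigma> m) - frac (\<sigma> n)\<bar> < \<delta>"
    using bspec[OF close, of "(2, z)"] by (auto simp: c_def)
  have b1: "\<bar>b m t\<bar> \<le> 1" for t
    using frac_lt_1[of "real m * \<mu> t"] frac_lt_1[of "real m * \<nu> t"] frac_ge_0[of "real m * \<mu> t"] frac_ge_0[of "real m * \<nu> t"]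
    unfolding b_def by linarith
  have b2: "\<bar>b n t - b m t\<bar> \<le> 2 * \<delta>" if "t \<in> S" for t
    using cl[OF that] unfolding b_def by linarith
  define d where "d = j (h n) - j (h m)"
  have d: "d = (\<Sum>t\<in>S. (b n t - b m t) *\<^sub>R j t) + (frac (\<sigma> n) - frac (\<sigma> m)) *\<^sub>R j z"
    unfolding d_def jh by (simp add: scaleR_diff_left sum_subtractf algebra_simps)
  have normd: "norm d \<le> \<delta> * A"
  proof -
    have "norm d \<le> norm (\<Sum>t\<in>S. (b n t - b m t) *\<^sub>R j t) + norm ((frac (\<sigma> n) - frac (\<sigma> m)) *\<^sub>R j z)"
      unfolding d by (rule norm_triangle_ineq)
    moreover have "norm (\<Sum>t\<in>S. (b n t - b m t) *\<^sub>R j t) \<le> (\<Sum>t\<in>S. \<delta> * (2 * norm (j t)))"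
    proof (rule sum_norm_le)
      fix t assume "t \<in> S"
      then show "norm ((b n t - b m t) *\<^sub>R j t) \<le> \<delta> * (2 * norm (j t))"
        using mult_right_mono[OF b2, of t "norm (j t)"] by (simp add: ac_simps)
    qed
    moreover have "norm ((frac (\<sigma> n) - frac (\<sigma> m)) *\<^sub>R j z) \<le> \<delta> * norm (j z)"
      using clz by (auto intro!: mult_right_mono)
    ultimately show ?thesis unfolding A_def by (simp add: distrib_left sum_distrib_left)
  qed
  \<comment> \<open>Closeness in the vector space is not yet closeness in the group: the bracket
    correction is small as well because \<open>j (h m)\<close> has bounded coefficients.\<close>
  have jd: "j (inv (h m) \<otimes> h n) = d - (1/2) *\<^sub>R br (j (h m)) d"
  proof -
    have "br (j (h m)) d = br (j (h m)) (j (h n))"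
      unfolding d_def using br_self[of "j (h m)"]
      by (simp add: bilinear_rsub[OF br_bilinear])
    then show ?thesis by (simp add: j_mult j_inv br_simps d_def)
  qed
  have "norm (br (j (h m)) d) \<le> \<delta> * B"
    unfolding d jh B_def using \<delta>(1) b1 b2 by (intro norm_br_combination) auto
  then have "norm (j (inv (h m) \<otimes> h n)) \<le> \<delta> * A + \<delta> * B"
    unfolding jd using normd norm_triangle_ineq4[of d "(1/2) *\<^sub>R br (j (h m)) d"] AB \<delta>(1) norm_ge_zero[of "br (j (h m)) d"]
    by (simp only: norm_scaleR)
  also have "\<dots> < \<delta> * (A + B + 1)" using \<delta>(1) by (simp add: algebra_simps)
  also have "\<dots> \<le> e" using \<delta>(2) AB by (simp add: pos_le_divide_eq)
  finally have "inv (h m) \<otimes> h n = \<one>" by (intro e(2)) auto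
  then have hh: "h m = h n"
    by (metis hC inv_closed inv_equality inv_inv)
  have mlen: "m \<le> n" using mn by linarith
  have sub: "mset (W \<phi> m) \<subseteq># mset (W \<phi> n)" if "\<And>t. 0 \<le> \<phi> t" for \<phi>
    unfolding subseteq_mset_def
  proof
    fix t
    show "count (mset (W \<phi> m)) t \<le> count (mset (W \<phi> n)) t"
    proof (cases "t \<in> S")
      case True
      have "real m * \<phi> t \<le> real n * \<phi> t" using mlen that by (intro mult_right_mono) auto
      then show ?thesis using W(2)[OF True] by (simp add: nat_mono floor_mono)
    next
      case False
      then have "count (mset (W \<phi> m)) t = 0" using W(1) by (metis count_mset_0_iff subsetD)
      then show ?thesis by (rule ord_eq_le_trans) simp
    qed
  qed
  obtain p where p: "mset p = mset (P n) - mset (P m)" using ex_mset by blast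
  obtain q where q: "mset q = mset (Q n) - mset (Q m)" using ex_mset by blast
  have mp: "mset (P n) = mset (P m @ p)" and mq: "mset (Q n) = mset (Q m @ q)"
    using sub[of \<mu>] sub[of \<nu>] nn by (simp_all add: p q P_def Q_def)
  have sp: "set p \<subseteq> set (P n)" and sq: "set q \<subseteq> set (Q n)"
    using mset_eq_setD[OF mp] mset_eq_setD[OF mq] by auto
  have pS: "set p \<subseteq> S" and qS: "set q \<subseteq> S" using sp sq PS QS by blast+
  have pcount: "real (count (mset p) t) = (real n - real m) * \<mu> t - (frac (real n * \<mu> t) - frac (real m * \<mu> t))"
    and qcount: "real (count (mset q) t) = (real n - real m) * \<nu> t - (frac (real n * \<nu> t) - frac (real m * \<nu> t))"
    if t: "t \<in> S" for t
  proof -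
    have "count (mset (P n)) t = count (mset (P m)) t + count (mset p) t"
      "count (mset (Q n)) t = count (mset (Q m)) t + count (mset q) t" using mp mq by simp_all
    then have "real (count (mset p) t) = real (count (mset (P n)) t) - real (count (mset (P m)) t)"
      "real (count (mset q) t) = real (count (mset (Q n)) t) - real (count (mset (Q m)) t)" by linarith+
    then show "real (count (mset p) t) = (real n - real m) * \<mu> t - (frac (real n * \<mu> t) - frac (real m * \<mu> t))"
      "real (count (mset q) t) = (real n - real m) * \<nu> t - (frac (real n * \<nu> t) - frac (real m * \<nu> t))"
      using cnt[OF t, of \<mu>] cnt[OF t, of \<nu>] nn by (simp_all add: P_def Q_def algebra_simps)
  qed
  have "s \<in> set p"
  proof -
    have "2 / \<mu> s \<le> real n - real m" using mn by linarith
    then have "2 \<le> (real n - real m) * \<mu> s" using s(2) by (simp add: pos_divide_le_eq)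
    then have "0 < real (count (mset p) s)"
      using pcount[OF s(1)] frac_lt_1[of "real n * \<mu> s"] frac_ge_0[of "real m * \<mu> s"] by linarith
    then show ?thesis by simp
  qed
  moreover have "length p = length q"
  proof -
    have "real (length p) - real (length q) = (\<Sum>t\<in>S. real (count (mset p) t) - real (count (mset q) t))"
      using length_counts pS qS by (simp add: sum_subtractf)
    also have "\<dots> = (\<Sum>t\<in>S. (real n - real m) * (\<mu> t - \<nu> t) + (b n t - b m t))"
      by (rule sum.cong) (auto simp: pcount qcount b_def algebra_simps)
    also have "\<dots> = (\<Sum>t\<in>S. b n t - b m t)"
      using sums by (simp add: sum.distrib sum_subtractf flip: sum_distrib_left)
    finally have "\<bar>real (length p) - real (length q)\<bar> \<le> (\<Sum>t\<in>S. \<bar>b n t - b m t\<bar>)"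
      by (simp add: sum_abs)
    also have "\<dots> \<le> real (card S) * (2 * \<delta>)" using b2 by (intro sum_bounded_above) auto
    also have "\<dots> < 1"
    proof -
      have "\<delta> * (2 * real (card S) + 1) \<le> 1" using \<delta>(3) by (simp add: pos_le_divide_eq add_nonneg_pos)
      then show ?thesis using \<delta>(1) by (simp add: algebra_simps)
    qed
    finally show ?thesis by linarith
  qed
  moreover have "\<exists>c. ev p = zs (ev q) c \<and> (\<rho> = 0 \<and> commuting ?X \<longrightarrow> c = 0)"
  proof -
    obtain a where a: "ev (P n) = zs (ev (P m @ p)) a" "2 * a = area (P n) - area (P m @ p)"
      using ev_permute[OF PS mp] by blast
    obtain a' where a': "ev (Q n) = zs (ev (Q m @ q)) a'" "2 * a' = area (Q n) - area (Q m @ q)"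
      using ev_permute[OF QS mq] by blast
    \<comment> \<open>What remains of the equality of \<open>h m\<close> and \<open>h n\<close> once
      \<open>P m\<close> is cancelled on the left and \<open>Q m\<close> on the right: the
      reordering costs and the change of the removed integer parts.\<close>
    define f where "f = a - a' - \<lfloor>\<sigma> n\<rfloor> + \<lfloor>\<sigma> m\<rfloor>"
    have C: "ev (P m) \<in> carrier G" "ev (Q m) \<in> carrier G" "ev p \<in> carrier G" "ev q \<in> carrier G"
      using PS QS pS qS by simp_all
    have "zs (ev (P m) \<otimes> inv (ev (Q m))) (- \<lfloor>\<sigma> m\<rfloor>) =
        zs (ev (P m) \<otimes> (ev p \<otimes> (inv (ev q) \<otimes> inv (ev (Q m))))) (a - a' - \<lfloor>\<sigma> n\<rfloor>)"
      using hh a(1) a'(1) C PS[of m] QS[of m] pS qS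
      by (simp add: h_def inv_mult_group m_assoc algebra_simps)
    then have "ev (P m) \<otimes> inv (ev (Q m)) = ev (P m) \<otimes> (zs (ev p \<otimes> inv (ev q)) f \<otimes> inv (ev (Q m)))"
      using C by (simp add: zs_eq_iff f_def m_assoc algebra_simps)
    then have "inv (ev (Q m)) = zs (ev p \<otimes> inv (ev q)) f \<otimes> inv (ev (Q m))"
      by (rule left_cancelD) (use C in auto)
    then have "zs (ev p \<otimes> inv (ev q)) f = \<one>"
      using C r_cancel_one'[of "inv (ev (Q m))" "zs (ev p \<otimes> inv (ev q)) f"]
      by (simp only: inv_closed m_closed zs_closed simp_thms)
    then have "zs (ev p \<otimes> inv (ev q)) f \<otimes> ev q = ev q" using C by simp
    then have "zs (ev p) f = ev q" using C by (simp add: m_assoc)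
    then have "ev p = zs (ev q) (- f)" using C by (metis add.right_inverse zs_0 zs_zs)
    moreover have "f = 0" if ex: "\<rho> = 0" "commuting ?X"
    proof -
      have pX: "set p \<subseteq> ?X" and qX: "set q \<subseteq> ?X" using sp sq PX QX by blast+
      note ar = commuting_area[OF ex(2) XS]
      \<comment> \<open>For commuting letters all areas and pairings vanish, so neither rounding nor
        reordering creates a central term.\<close>
      have "\<tau> k = 0" for k
        using ar[OF PX[of k]] ar[OF QX[of k]] commuting_ev[OF ex(2) XS PX[of k] QX[of k]] by (simp add: \<tau>_def)
      then have "\<sigma> k = 0" for k using ex(1) by (simp add: \<sigma>_def)
      moreover have "set (P m @ p) \<subseteq> ?X" "set (Q m @ q) \<subseteq> ?X" using PX[of m] QX[of m] pX qX by simp_all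
      then have "a = 0" "a' = 0"
        using a(2) a'(2) ar[OF PX[of n]] ar[OF QX[of n]] ar[of "P m @ p"] ar[of "Q m @ q"] by linarith+
      ultimately show ?thesis by (simp add: f_def)
    qed
    ultimately show ?thesis by (intro exI[of _ "- f"]) simp
  qed
  moreover have "set p \<subseteq> {t\<in>S. 0 < \<mu> t}" "set q \<subseteq> {t\<in>S. 0 < \<nu> t}"
    using sp sq supp[of \<mu> n] supp[of \<nu> n] nn unfolding P_def Q_def by blast+
  ultimately show ?thesis by blast
qed

end

section \<open>Faces and letters\<close>

context malcev
begin

lemma face_letters_relation:
  assumes "set p \<subseteq> S" "set q \<subseteq> D" "D \<subseteq> S" "length p = length q" "ev p = zs (ev q) c" "s \<in> set p"
  shows "s \<in> face_letters D"
proof -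
  obtain p1 p2 where p: "p = p1 @ s # p2" using assms(6) by (meson split_list)
  let ?u = "p1 @ p2"
  obtain c' where c': "ev p = zs (ev (s # ?u)) c'"
    using ev_permute_mod[OF assms(1), of "s # ?u"] p by auto
  have S: "set (s # ?u) \<subseteq> S" "set q \<subseteq> S" using assms p by auto
  have "ev (s # ?u) = zs (ev q) (c - c')"
    using c' assms(5) ev_closed_S[OF S(1)] ev_closed_S[OF S(2)] by (simp add: zs_eq_iff del: ev_Cons)
  moreover have "length q = Suc (length ?u)" using assms(4) p by simp
  moreover have "s \<in> S" "set ?u \<subseteq> S" using S by simp_all
  ultimately show ?thesis unfolding face_letters_def using assms(2) by blast
qed

lemma fine_letters_relation:
  assumes "commuting X" "X \<subseteq> S" "set p \<subseteq> X" "set q \<subseteq> D" "length p = length q" "ev p = ev q" "s \<in> set p"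
  shows "s \<in> fine_letters X D"
proof -
  obtain p1 p2 where p: "p = p1 @ s # p2" using assms(7) by (meson split_list)
  let ?u = "p1 @ p2"
  have "ev p = ev (s # ?u)"
    by (rule commuting_permute[OF assms(1,2,3)]) (simp add: p)
  then have "ev (s # ?u) = ev q" using assms(6) by simp
  moreover have "length q = Suc (length ?u)" using assms(5) p by simp
  moreover have "s \<in> X" "set ?u \<subseteq> X" using assms(3) p by simp_all
  ultimately show ?thesis unfolding fine_letters_def using assms(4) by blast
qed

lemma balanced_counts:
  fixes f :: "'a \<Rightarrow> 'u::real_vector"
  assumes "set p \<subseteq> S" "set q \<subseteq> D" "D \<subseteq> S" "length p = length q"
    and "sum_list (map f p) = sum_list (map f q)"
  shows "balanced S D f (\<lambda>t. real (count (mset p) t)) (\<lambda>t. real (count (mset q) t))"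
proof -
  have qS: "set q \<subseteq> S" using assms by blast
  have "count (mset q) t = 0" if "t \<notin> D" for t using assms(2) that by (metis count_mset_0_iff subsetD)
  then show ?thesis
    using assms length_counts[OF assms(1)] length_counts[OF qS]
    unfolding balanced_def sum_list_counts[OF assms(1)] sum_list_counts[OF qS] by simp
qed

lemma F_face_eq:
  "F_face S j Pr \<gamma> = minimal_face (convex hull ((\<lambda>s. Pr (j s)) ` S)) ((\<lambda>s. Pr (j s)) ` recurrent_letters \<gamma>)"
  unfolding F_face_def convex_hull_linear_image[OF linear_Pr] image_image ..

lemma balanced_Pr:
  assumes "balanced S D (\<lambda>s. Pr (j s)) \<mu> \<nu>"
  shows "\<exists>\<rho>. (\<Sum>t\<in>S. \<mu> t *\<^sub>R j t) = (\<Sum>t\<in>S. \<nu> t *\<^sub>R j t) + \<rho> *\<^sub>R j z"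
proof -
  let ?d = "(\<Sum>t\<in>S. \<mu> t *\<^sub>R j t) - (\<Sum>t\<in>S. \<nu> t *\<^sub>R j t)"
  have V: "(\<Sum>t\<in>S. c t *\<^sub>R j t) \<in> V" for c
    by (rule subspace_sum[OF V_subspace]) (simp add: V_simps)
  have "Pr ?d = 0"
    using assms linear_Pr by (simp add: balanced_def linear_diff linear_sum linear_scale)
  then have "?d \<in> span {j z}" using Pr_zero_iff[of ?d] V by (simp add: V_simps)
  then obtain \<rho> where "?d = \<rho> *\<^sub>R j z" by (auto simp: span_singleton)
  then show ?thesis by (intro exI[of _ \<rho>]) (simp add: algebra_simps)
qed

text \<open>A real relation between projections is a relation in \<open>V\<close> up to a multiple
  of \<open>j z\<close>, which \<open>integral_relation\<close> turns into words equal up to a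
  central power, as \<open>face_letters\<close> allows. In the other direction the letter counts are
  the weights.\<close>

lemma Pr_in_F_face_iff:
  assumes g: "\<gamma> \<in> Geo G S" and s: "s \<in> S"
  shows "Pr (j s) \<in> F_face S j Pr \<gamma> \<longleftrightarrow> s \<in> face_letters (recurrent_letters \<gamma>)"
proof -
  let ?D = "recurrent_letters \<gamma>" and ?p = "\<lambda>s. Pr (j s)"
  note DS = rec_S[OF g]
  have "Pr (j s) \<in> F_face S j Pr \<gamma> \<longleftrightarrow> (\<exists>\<mu> \<nu>. balanced S ?D ?p \<mu> \<nu> \<and> 0 < \<mu> s)"
    unfolding F_face_eq by (rule minimal_face_hull(1)[OF finite_S DS s])
  also have "\<dots> \<longleftrightarrow> s \<in> face_letters ?D"
  proof
    assume "\<exists>\<mu> \<nu>. balanced S ?D ?p \<mu> \<nu> \<and> 0 < \<mu> s"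
    then obtain \<mu> \<nu> where b: "balanced S ?D ?p \<mu> \<nu>" "0 < \<mu> s" by blast
    obtain \<rho> where \<rho>: "(\<Sum>t\<in>S. \<mu> t *\<^sub>R j t) = (\<Sum>t\<in>S. \<nu> t *\<^sub>R j t) + \<rho> *\<^sub>R j z"
      using balanced_Pr[OF b(1)] by blast
    have nn: "\<And>t. 0 \<le> \<mu> t" "\<And>t. 0 \<le> \<nu> t" "sum \<mu> S = sum \<nu> S" and \<nu>0: "\<And>t. t \<notin> ?D \<Longrightarrow> \<nu> t = 0"
      using b(1) by (auto simp: balanced_def)
    obtain p q c where pq: "set p \<subseteq> {t\<in>S. 0 < \<mu> t}" "set q \<subseteq> {t\<in>S. 0 < \<nu> t}" "s \<in> set p"
      "length p = length q" "ev p = zs (ev q) c"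
      using integral_relation[OF nn \<rho> s b(2)] by blast
    have "set p \<subseteq> S" using pq(1) by blast
    moreover have "set q \<subseteq> ?D"
    proof
      fix t assume "t \<in> set q"
      then have "\<nu> t \<noteq> 0" using pq(2) by auto
      then show "t \<in> ?D" using \<nu>0 by blast
    qed
    ultimately show "s \<in> face_letters ?D" by (rule face_letters_relation[OF _ _ DS pq(4,5,3)])
  next
    assume "s \<in> face_letters ?D"
    then obtain u q c where u: "set u \<subseteq> S" "set q \<subseteq> ?D" "length q = Suc (length u)"
      "ev (s # u) = zs (ev q) c"
      unfolding face_letters_def by blast
    have S: "set (s # u) \<subseteq> S" "set q \<subseteq> S" using u s DS by auto
    have Prsum: "Pr (sum_list (map j v)) = sum_list (map ?p v)" for v
      by (induction v) (auto simp: linear_add[OF linear_Pr] linear_0[OF linear_Pr])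
    have Prev: "Pr (j (ev v)) = sum_list (map ?p v)" if "set v \<subseteq> S" for v
      using that by (simp add: j_ev linear_add[OF linear_Pr] linear_scale[OF linear_Pr] Prsum)
    have "Pr (j (ev (s # u))) = Pr (j (ev q))"
      unfolding u(4) using S(2) by (simp add: j_zs linear_add[OF linear_Pr] linear_scale[OF linear_Pr])
    then have "sum_list (map ?p (s # u)) = sum_list (map ?p q)"
      unfolding Prev[OF S(1)] Prev[OF S(2)] .
    then have "balanced S ?D ?p (\<lambda>t. real (count (mset (s # u)) t)) (\<lambda>t. real (count (mset q) t))"
      using balanced_counts[OF S(1) u(2) DS, of ?p] u(3) by simp
    then show "\<exists>\<mu> \<nu>. balanced S ?D ?p \<mu> \<nu> \<and> 0 < \<mu> s"
      by (intro exI conjI) (assumption, simp)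
  qed
  finally show ?thesis .
qed

text \<open>A relation without central defect stays exact under rounding only if its letters
  commute. Projecting the relation shows that they all belong to \<open>face_letters\<close>, which
  is commuting by assumption.\<close>

lemma j_in_E_face_iff:
  assumes g: "\<gamma> \<in> Geo G S" and s: "s \<in> S" and com: "commuting (face_letters (recurrent_letters \<gamma>))"
  shows "j s \<in> E_face S j \<gamma> \<longleftrightarrow>
    s \<in> fine_letters (face_letters (recurrent_letters \<gamma>)) (recurrent_letters \<gamma>)"
proof -
  let ?D = "recurrent_letters \<gamma>" and ?p = "\<lambda>s. Pr (j s)"
  let ?X = "face_letters ?D"
  note DS = rec_S[OF g]
  have X: "?X \<subseteq> S" by (rule face_letters_S)
  have DX: "?D \<subseteq> ?X" by (rule subset_face_letters[OF DS])
  have "j s \<in> E_face S j \<gamma> \<longleftrightarrow> (\<exists>\<mu> \<nu>. balanced S ?D j \<mu> \<nu> \<and> 0 < \<mu> s)"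
    unfolding E_face_def by (rule minimal_face_hull(1)[OF finite_S DS s])
  also have "\<dots> \<longleftrightarrow> s \<in> fine_letters ?X ?D"
  proof
    assume "\<exists>\<mu> \<nu>. balanced S ?D j \<mu> \<nu> \<and> 0 < \<mu> s"
    then obtain \<mu> \<nu> where b: "balanced S ?D j \<mu> \<nu>" "0 < \<mu> s" by blast
    have nn: "\<And>t. 0 \<le> \<mu> t" "\<And>t. 0 \<le> \<nu> t" "sum \<mu> S = sum \<nu> S" and \<nu>0: "\<And>t. t \<notin> ?D \<Longrightarrow> \<nu> t = 0"
      and eq: "(\<Sum>t\<in>S. \<mu> t *\<^sub>R j t) = (\<Sum>t\<in>S. \<nu> t *\<^sub>R j t)"
      using b(1) by (auto simp: balanced_def)
    have "(\<Sum>t\<in>S. c t *\<^sub>R Pr (j t)) = Pr (\<Sum>t\<in>S. c t *\<^sub>R j t)" for c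
      by (simp add: linear_sum[OF linear_Pr] linear_scale[OF linear_Pr])
    then have bPr: "balanced S ?D ?p \<mu> \<nu>" using b(1) by (simp add: balanced_def)
    have \<mu>X: "{t\<in>S. 0 < \<mu> t} \<subseteq> ?X"
    proof
      fix t assume t: "t \<in> {t\<in>S. 0 < \<mu> t}"
      then have "Pr (j t) \<in> F_face S j Pr \<gamma>"
        unfolding F_face_eq using minimal_face_hull(1)[OF finite_S DS, of t ?p] bPr by blast
      then show "t \<in> ?X" using Pr_in_F_face_iff[OF g, of t] t by blast
    qed
    have \<nu>D: "{t\<in>S. 0 < \<nu> t} \<subseteq> ?D" using \<nu>0 by force
    have "commuting {t\<in>S. 0 < \<mu> t \<or> 0 < \<nu> t}"
      using com \<mu>X \<nu>D DX unfolding commuting_def by blast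
    moreover have "(\<Sum>t\<in>S. \<mu> t *\<^sub>R j t) = (\<Sum>t\<in>S. \<nu> t *\<^sub>R j t) + 0 *\<^sub>R j z" using eq by simp
    ultimately obtain p q where pq: "set p \<subseteq> {t\<in>S. 0 < \<mu> t}" "set q \<subseteq> {t\<in>S. 0 < \<nu> t}" "s \<in> set p"
      "length p = length q" "ev p = zs (ev q) 0"
      using integral_relation[OF nn _ s b(2), of 0] by blast
    have "set q \<subseteq> S" using pq(2) by blast
    then have "ev p = ev q" using pq(5) by simp
    then show "s \<in> fine_letters ?X ?D"
      using fine_letters_relation[OF com X _ _ pq(4) _ pq(3)] pq(1,2) \<mu>X \<nu>D by blast
  next
    assume "s \<in> fine_letters ?X ?D"
    then obtain u q where u: "s \<in> ?X" "set u \<subseteq> ?X" "set q \<subseteq> ?D" "length q = Suc (length u)"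
      "ev (s # u) = ev q"
      unfolding fine_letters_def by blast
    have XX: "set (s # u) \<subseteq> ?X" "set q \<subseteq> ?X" using u DX by auto
    have S: "set (s # u) \<subseteq> S" "set q \<subseteq> S" using XX X by blast+
    have "j (ev v) = sum_list (map j v)" if "set v \<subseteq> ?X" for v
      using j_ev[of v] commuting_area[OF com X that] that X by simp
    then have "sum_list (map j (s # u)) = sum_list (map j q)"
      using XX u(5) by metis
    then have "balanced S ?D j (\<lambda>t. real (count (mset (s # u)) t)) (\<lambda>t. real (count (mset q) t))"
      using balanced_counts[OF S(1) u(3) DS, of j] u(4) by simp
    then show "\<exists>\<mu> \<nu>. balanced S ?D j \<mu> \<nu> \<and> 0 < \<mu> s"
      by (intro exI conjI) (assumption, simp)
  qed
  finally show ?thesis .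
qed

lemma F_face_eq_iff:
  assumes g: "\<gamma>1 \<in> Geo G S" "\<gamma>2 \<in> Geo G S"
  shows "F_face S j Pr \<gamma>1 = F_face S j Pr \<gamma>2 \<longleftrightarrow>
    recurrent_letters \<gamma>1 \<subseteq> face_letters (recurrent_letters \<gamma>2) \<and>
    recurrent_letters \<gamma>2 \<subseteq> face_letters (recurrent_letters \<gamma>1)"
proof -
  let ?p = "\<lambda>s. Pr (j s)"
  have sub: "?p ` recurrent_letters \<gamma> \<subseteq> convex hull (?p ` S)" if "\<gamma> \<in> Geo G S" for \<gamma>
    using rec_S[OF that] by (meson hull_subset image_mono order_trans)
  have "F_face S j Pr \<gamma>1 = F_face S j Pr \<gamma>2 \<longleftrightarrow>
      ?p ` recurrent_letters \<gamma>1 \<subseteq> F_face S j Pr \<gamma>2 \<and> ?p ` recurrent_letters \<gamma>2 \<subseteq> F_face S j Pr \<gamma>1"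
    unfolding F_face_eq by (rule minimal_face_eq_iff[OF convex_convex_hull sub[OF g(1)] sub[OF g(2)]])
  moreover have "?p ` recurrent_letters \<gamma> \<subseteq> F_face S j Pr \<gamma>' \<longleftrightarrow>
      recurrent_letters \<gamma> \<subseteq> face_letters (recurrent_letters \<gamma>')"
    if "\<gamma> \<in> Geo G S" "\<gamma>' \<in> Geo G S" for \<gamma> \<gamma>'
    using Pr_in_F_face_iff[OF that(2)] rec_S[OF that(1)] by blast
  ultimately show ?thesis using g by simp
qed

lemma F_face_eq_imp_face_letters_eq:
  assumes g: "\<gamma>1 \<in> Geo G S" "\<gamma>2 \<in> Geo G S" and F: "F_face S j Pr \<gamma>1 = F_face S j Pr \<gamma>2"
  shows "face_letters (recurrent_letters \<gamma>1) = face_letters (recurrent_letters \<gamma>2)"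
  using Pr_in_F_face_iff[OF g(1)] Pr_in_F_face_iff[OF g(2)] F face_letters_S by blast

lemma E_face_eq_iff:
  assumes g: "\<gamma>1 \<in> Geo G S" "\<gamma>2 \<in> Geo G S"
    and X: "face_letters (recurrent_letters \<gamma>1) = X" "face_letters (recurrent_letters \<gamma>2) = X"
    and com: "commuting X"
  shows "E_face S j \<gamma>1 = E_face S j \<gamma>2 \<longleftrightarrow>
    recurrent_letters \<gamma>1 \<subseteq> fine_letters X (recurrent_letters \<gamma>2) \<and>
    recurrent_letters \<gamma>2 \<subseteq> fine_letters X (recurrent_letters \<gamma>1)"
proof -
  have sub: "j ` recurrent_letters \<gamma> \<subseteq> convex hull (j ` S)" if "\<gamma> \<in> Geo G S" for \<gamma>
    using rec_S[OF that] by (meson hull_subset image_mono order_trans)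
  have "E_face S j \<gamma>1 = E_face S j \<gamma>2 \<longleftrightarrow>
      j ` recurrent_letters \<gamma>1 \<subseteq> E_face S j \<gamma>2 \<and> j ` recurrent_letters \<gamma>2 \<subseteq> E_face S j \<gamma>1"
    unfolding E_face_def by (rule minimal_face_eq_iff[OF convex_convex_hull sub[OF g(1)] sub[OF g(2)]])
  moreover have "j ` recurrent_letters \<gamma> \<subseteq> E_face S j \<gamma>' \<longleftrightarrow>
      recurrent_letters \<gamma> \<subseteq> fine_letters X (recurrent_letters \<gamma>')"
    if "\<gamma> \<in> Geo G S" "\<gamma>' \<in> Geo G S" "face_letters (recurrent_letters \<gamma>') = X" for \<gamma> \<gamma>'
  proof -
    have "j t \<in> E_face S j \<gamma>' \<longleftrightarrow> t \<in> fine_letters X (recurrent_letters \<gamma>')" if "t \<in> S" for t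
      using j_in_E_face_iff[OF \<open>\<gamma>' \<in> Geo G S\<close> that] \<open>face_letters (recurrent_letters \<gamma>') = X\<close> com by simp
    then show ?thesis using rec_S[OF that(1)] by blast
  qed
  ultimately show ?thesis using g X by simp
qed

text \<open>A vector over the face is a combination of its letters plus a multiple of
  \<open>j z\<close>, because the face is covered by the hull of its letters. Brackets of such
  vectors are governed by \<open>w\<close> on the letters, and vanishing brackets pass to the
  generated subgroup.\<close>

lemma commutative_face_iff:
  assumes g: "\<gamma> \<in> Geo G S"
  shows "commutative_face V br Pr (F_face S j Pr \<gamma>) \<longleftrightarrow> commuting (face_letters (recurrent_letters \<gamma>))"
proof -
  let ?B = "bch_group V br" and ?F = "F_face S j Pr \<gamma>" and ?X = "face_letters (recurrent_letters \<gamma>)"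
  let ?A = "{v \<in> V. Pr v \<in> ?F}"
  let ?G = "?B\<lparr>carrier := generate ?B ?A\<rparr>"
  have XF: "{s \<in> S. Pr (j s) \<in> ?F} = ?X" using Pr_in_F_face_iff[OF g] face_letters_S by blast
  interpret B: group ?B by (rule bch_group_group(1)[OF lie])
  have carB: "carrier ?B = V" by (simp add: bch_group_def)
  have AC: "?A \<subseteq> carrier ?B" by (auto simp: bch_group_def)
  have X: "?X \<subseteq> S" by (rule face_letters_S)
  show ?thesis
    unfolding commutative_face_def
  proof
    assume "comm_group ?G"
    then interpret C: comm_group ?G .
    show "commuting ?X"
      unfolding commuting_def
    proof (intro ballI)
      fix s t assume st: "s \<in> ?X" "t \<in> ?X"
      then have S: "s \<in> S" "t \<in> S" using X by auto
      have "j s \<in> ?A" "j t \<in> ?A" using st S XF by auto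
      then have "j s \<in> generate ?B ?A" "j t \<in> generate ?B ?A" by (blast intro: generate.incl)+
      then have "j s \<otimes>\<^bsub>?B\<^esub> j t = j t \<otimes>\<^bsub>?B\<^esub> j s" using C.m_comm[of "j s" "j t"] by simp
      then have "j (s \<otimes> t) = j (t \<otimes> s)" using S by (simp add: bch_group_def j_mult)
      then have "s \<otimes> t = t \<otimes> s" using j_inj S by simp
      then show "w s t = 0" using commute_iff_w S by simp
    qed
  next
    assume com: "commuting ?X"
    have finX: "finite ?X" using X finite_S finite_subset by blast
    have zV: "j z \<in> V" using z_closed by simp
    have SV: "(\<Sum>t\<in>?X. c t *\<^sub>R j t) \<in> V" for c
      by (rule subspace_sum[OF V_subspace]) (use X in \<open>auto simp: V_simps\<close>)
    have rep: "\<exists>l r. v = (\<Sum>t\<in>?X. l t *\<^sub>R j t) + r *\<^sub>R j z" if v: "v \<in> ?A" for v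
    proof -
      have "?F \<subseteq> convex hull ((\<lambda>s. Pr (j s)) ` ?X)"
        using minimal_face_hull(2)[OF finite_S rec_S[OF g], of "\<lambda>s. Pr (j s)"] XF by (simp add: F_face_eq)
      then have "Pr v \<in> convex hull ((\<lambda>s. Pr (j s)) ` ?X)" using v by blast
      then obtain l where l: "Pr v = (\<Sum>t\<in>?X. l t *\<^sub>R Pr (j t))"
        unfolding convex_hull_image_finite[OF finX] by blast
      let ?d = "v - (\<Sum>t\<in>?X. l t *\<^sub>R j t)"
      have "Pr ?d = 0" using l by (simp add: linear_diff[OF linear_Pr] linear_sum[OF linear_Pr] linear_scale[OF linear_Pr])
      then have "?d \<in> span {j z}" using Pr_zero_iff[of ?d] v SV by (simp add: V_simps)
      then obtain r where "?d = r *\<^sub>R j z" by (auto simp: span_singleton)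
      then have "v = (\<Sum>t\<in>?X. l t *\<^sub>R j t) + r *\<^sub>R j z" by (simp add: algebra_simps)
      then show ?thesis by blast
    qed
    have brz: "br x (j z) = 0" "br (j z) x = 0" if "x \<in> V" for x
      using br_span_jz[OF that, of "j z"] br_swap[OF that zV] by (auto simp: span_base)
    have AA: "br v v' = 0" if v: "v \<in> ?A" "v' \<in> ?A" for v v'
    proof -
      obtain l r where l: "v = (\<Sum>t\<in>?X. l t *\<^sub>R j t) + r *\<^sub>R j z" using rep[OF v(1)] by blast
      obtain l' r' where l': "v' = (\<Sum>t\<in>?X. l' t *\<^sub>R j t) + r' *\<^sub>R j z" using rep[OF v(2)] by blast
      have "br v v' = br (\<Sum>t\<in>?X. l t *\<^sub>R j t) (\<Sum>t\<in>?X. l' t *\<^sub>R j t)"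
        unfolding l l' using brz SV zV by (simp add: br_simps)
      also have "\<dots> = (\<Sum>(t, t')\<in>?X \<times> ?X. br (l t *\<^sub>R j t) (l' t' *\<^sub>R j t'))"
        by (rule bilinear_sum[OF br_bilinear])
      also have "\<dots> = 0"
      proof (rule sum.neutral, clarify)
        fix t t' assume t: "t \<in> ?X" "t' \<in> ?X"
        then have "t \<in> S" "t' \<in> S" "w t t' = 0" using X com by (auto simp: commuting_def)
        then show "br (l t *\<^sub>R j t) (l' t' *\<^sub>R j t') = 0" by (simp add: br_simps br_j)
      qed
      finally show ?thesis .
    qed
    have genV: "x \<in> V" if "x \<in> generate ?B ?A" for x
      using B.generate_in_carrier[OF AC that] carB by simp
    have gen: "br x y = 0" if x: "x \<in> generate ?B ?A" and y: "y \<in> V" "\<And>v. v \<in> ?A \<Longrightarrow> br v y = 0" for x y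
      using x
    proof (induction rule: generate.induct)
      case one
      then show ?case by (simp add: bch_group_def br_simps)
    next
      case (incl h)
      then show ?case by (rule y(2))
    next
      case (inv h)
      then show ?case using bch_group_group(2)[OF lie, of h] y(2)[of h] by (simp add: br_simps)
    next
      case (eng h1 h2)
      then show ?case using genV br_br_left[OF _ _ y(1)] by (simp add: bch_group_def br_simps)
    qed
    have gg: "br x y = 0" if x: "x \<in> generate ?B ?A" and y: "y \<in> generate ?B ?A" for x y
    proof (rule gen[OF x genV[OF y]])
      fix v assume v: "v \<in> ?A"
      then have vV: "v \<in> V" by blast
      have "br y v = 0" using AA v by (intro gen[OF y vV]) blast
      then show "br v y = 0" using br_swap[OF genV[OF y] vV] by simp
    qed
    show "comm_group ?G"
    proof (rule group.group_comm_groupI)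
      show "group ?G" by (rule B.subgroup_imp_group[OF B.generate_is_subgroup[OF AC]])
      fix x y assume "x \<in> carrier ?G" "y \<in> carrier ?G"
      then have "br x y = 0" "br y x = 0" using gg by simp_all
      then show "x \<otimes>\<^bsub>?G\<^esub> y = y \<otimes>\<^bsub>?G\<^esub> x" by (simp add: bch_group_def add.commute)
    qed
  qed
qed

section \<open>Orbits and Busemann functions in terms of the polytope faces\<close>

lemma same_orbit_imp_F_face_eq:
  assumes g: "\<gamma>1 \<in> Geo G S" "\<gamma>2 \<in> Geo G S" and o: "same_orbit \<gamma>1 \<gamma>2"
  shows "F_face S j Pr \<gamma>1 = F_face S j Pr \<gamma>2"
  unfolding F_face_eq_iff[OF g]
  using same_orbit_face_letters[OF g o] same_orbit_face_letters[OF g(2,1) same_orbit_sym[OF o]] by simp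

lemma same_orbit_imp_E_face_eq:
  assumes g: "\<gamma>1 \<in> Geo G S" "\<gamma>2 \<in> Geo G S" and o: "same_orbit \<gamma>1 \<gamma>2"
    and com: "commutative_face V br Pr (F_face S j Pr \<gamma>1)"
  shows "E_face S j \<gamma>1 = E_face S j \<gamma>2"
proof -
  have X: "face_letters (recurrent_letters \<gamma>1) = face_letters (recurrent_letters \<gamma>2)"
    by (rule F_face_eq_imp_face_letters_eq[OF g same_orbit_imp_F_face_eq[OF g o]])
  have c: "commuting (face_letters (recurrent_letters \<gamma>1))" using com commutative_face_iff[OF g(1)] by simp
  show ?thesis
    unfolding E_face_eq_iff[OF g refl X[symmetric] c]
    using same_orbit_fine_letters[OF g o X c]
      same_orbit_fine_letters[OF g(2,1) same_orbit_sym[OF o] X[symmetric]] c X by simp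
qed

lemma faces_eq_imp_same_orbit:
  assumes g: "\<gamma>1 \<in> Geo G S" "\<gamma>2 \<in> Geo G S" and F: "F_face S j Pr \<gamma>1 = F_face S j Pr \<gamma>2"
    and E: "commutative_face V br Pr (F_face S j Pr \<gamma>1) \<Longrightarrow> E_face S j \<gamma>1 = E_face S j \<gamma>2"
  shows "same_orbit \<gamma>1 \<gamma>2"
proof (rule same_faces_imp_same_orbit[OF g])
  show X: "face_letters (recurrent_letters \<gamma>1) = face_letters (recurrent_letters \<gamma>2)"
    by (rule F_face_eq_imp_face_letters_eq[OF g F])
  assume c: "commuting (face_letters (recurrent_letters \<gamma>1))"
  let ?X = "face_letters (recurrent_letters \<gamma>1)"
  have "E_face S j \<gamma>1 = E_face S j \<gamma>2" using E c commutative_face_iff[OF g(1)] by simp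
  then have "s \<in> fine_letters ?X (recurrent_letters \<gamma>1) \<longleftrightarrow> s \<in> fine_letters ?X (recurrent_letters \<gamma>2)"
    if "s \<in> S" for s
    using j_in_E_face_iff[OF g(1) that c] j_in_E_face_iff[OF g(2) that] c X by simp
  moreover have "fine_letters ?X D \<subseteq> S" for D
    using fine_letters_subset face_letters_S by (rule subset_trans)
  ultimately show "fine_letters ?X (recurrent_letters \<gamma>1) = fine_letters ?X (recurrent_letters \<gamma>2)"
    by blast
qed

lemma busemann_eq_commutative:
  assumes g: "\<gamma>1 \<in> Geo G S" "\<gamma>2 \<in> Geo G S" and F: "F_face S j Pr \<gamma>1 = F_face S j Pr \<gamma>2"
    and com: "commutative_face V br Pr (F_face S j Pr \<gamma>1)" and E: "E_face S j \<gamma>1 = E_face S j \<gamma>2"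
    and l: "\<And>n. j (\<gamma>1 n) \<in> E_face S j \<gamma>1" "\<And>n. j (\<gamma>2 n) \<in> E_face S j \<gamma>1"
  shows "busemann G S \<gamma>1 = busemann G S \<gamma>2"
proof -
  let ?X = "face_letters (recurrent_letters \<gamma>1)"
  have X: "?X = face_letters (recurrent_letters \<gamma>2)" by (rule F_face_eq_imp_face_letters_eq[OF g F])
  have c: "commuting ?X" using com commutative_face_iff[OF g(1)] by simp
  have f1: "\<gamma>1 n \<in> fine_letters ?X (recurrent_letters \<gamma>1)" "\<gamma>2 n \<in> fine_letters ?X (recurrent_letters \<gamma>1)" for n
    using j_in_E_face_iff[OF g(1) _ c] Geo_S[OF g(1)] Geo_S[OF g(2)] l by blast+
  have f2: "\<gamma>1 n \<in> fine_letters ?X (recurrent_letters \<gamma>2)" for n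
    using j_in_E_face_iff[OF g(2) Geo_S[OF g(1)]] c X l(1) E by simp
  have lX: "\<gamma>1 n \<in> ?X" "\<gamma>2 n \<in> ?X" for n using f1 fine_letters_subset by blast+
  have "bus \<gamma>1 x = bus \<gamma>2 x" if x: "x \<in> carrier G" for x
    using bus_le_commuting[OF g c face_letters_S lX(1) f1(2) x]
      bus_le_commuting[OF g(2,1) c face_letters_S lX(2) f2 x] by (rule antisym)
  then show ?thesis using busemann_eq_iff[OF g] by blast
qed

lemma busemann_eq_noncommutative:
  assumes g: "\<gamma>1 \<in> Geo G S" "\<gamma>2 \<in> Geo G S" and F: "F_face S j Pr \<gamma>1 = F_face S j Pr \<gamma>2"
    and com: "\<not> commutative_face V br Pr (F_face S j Pr \<gamma>1)"
    and l: "\<And>n. Pr (j (\<gamma>1 n)) \<in> F_face S j Pr \<gamma>1" "\<And>n. Pr (j (\<gamma>2 n)) \<in> F_face S j Pr \<gamma>1"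
  shows "busemann G S \<gamma>1 = busemann G S \<gamma>2"
proof -
  let ?X = "face_letters (recurrent_letters \<gamma>1)"
  have X: "?X = face_letters (recurrent_letters \<gamma>2)" by (rule F_face_eq_imp_face_letters_eq[OF g F])
  have c: "\<not> commuting ?X" using com commutative_face_iff[OF g(1)] by simp
  have lX: "\<gamma>1 n \<in> ?X" "\<gamma>2 n \<in> ?X" for n
    using Pr_in_F_face_iff[OF g(1)] Geo_S[OF g(1)] Geo_S[OF g(2)] l by blast+
  have "bus \<gamma>1 x = bus \<gamma>2 x" if x: "x \<in> carrier G" for x
    using bus_le_noncommuting[OF g c lX(2) x] bus_le_noncommuting[OF g(2,1) c[unfolded X] lX(1)[unfolded X] x]
    by (rule antisym)
  then show ?thesis using busemann_eq_iff[OF g] by blast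
qed

end

text \<open>The vanishing second step makes \<open>z\<close> central. The first step is non-trivial,
  so \<open>z\<close> is not the identity, and torsion-freeness gives it infinite order.\<close>

lemma two_step_group_of_nilpotent:
  fixes H :: "('a, 'b) monoid_scheme"
  assumes "group H" and tf: "torsion_free H" and nil: "nilpotent_of_step H 2"
    and z: "z \<in> carrier H" and der: "derived H (carrier H) = generate H {z}"
    and S: "fin_sym_generating_set H S"
  shows "two_step_group H S z"
proof -
  interpret group H by fact
  have lc1: "lower_central H (Suc 0) = generate H {z}"
    using der by (simp add: derived_def)
  have lc2: "lower_central H (Suc (Suc 0)) = {\<one>\<^bsub>H\<^esub>}"
    and lc1_ne: "lower_central H (Suc 0) \<noteq> {\<one>\<^bsub>H\<^esub>}"
    using nil by (auto simp: nilpotent_of_step_def numeral_2_eq_2)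
  have comm_in: "x \<otimes>\<^bsub>H\<^esub> y \<otimes>\<^bsub>H\<^esub> inv\<^bsub>H\<^esub> x \<otimes>\<^bsub>H\<^esub> inv\<^bsub>H\<^esub> y \<in> lower_central H (Suc n)"
    if "x \<in> lower_central H n" "y \<in> carrier H" for x y n
    unfolding lower_central.simps(2) using that by (intro generate.incl) blast
  have undo: "x \<otimes>\<^bsub>H\<^esub> y = x \<otimes>\<^bsub>H\<^esub> y \<otimes>\<^bsub>H\<^esub> inv\<^bsub>H\<^esub> x \<otimes>\<^bsub>H\<^esub> inv\<^bsub>H\<^esub> y \<otimes>\<^bsub>H\<^esub> (y \<otimes>\<^bsub>H\<^esub> x)"
    if "x \<in> carrier H" "y \<in> carrier H" for x y
  proof -
    have "inv\<^bsub>H\<^esub> x \<otimes>\<^bsub>H\<^esub> inv\<^bsub>H\<^esub> y \<otimes>\<^bsub>H\<^esub> (y \<otimes>\<^bsub>H\<^esub> x) = \<one>\<^bsub>H\<^esub>"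
      using that by (simp flip: inv_mult_group)
    then show ?thesis using that by (simp add: m_assoc)
  qed
  have central: "z \<otimes>\<^bsub>H\<^esub> x = x \<otimes>\<^bsub>H\<^esub> z" if x: "x \<in> carrier H" for x
  proof -
    have "z \<in> lower_central H (Suc 0)" unfolding lc1 by (rule generate.incl) simp
    then have "z \<otimes>\<^bsub>H\<^esub> x \<otimes>\<^bsub>H\<^esub> inv\<^bsub>H\<^esub> z \<otimes>\<^bsub>H\<^esub> inv\<^bsub>H\<^esub> x = \<one>\<^bsub>H\<^esub>"
      using comm_in[of z "Suc 0" x] x unfolding lc2 by blast
    then show ?thesis using undo[OF z x] x z by simp
  qed
  show ?thesis
  proof (intro two_step_group.intro two_step_group_axioms.intro)
    show "group H" by fact
    show "fin_sym_generating_set H S" by (rule S)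
    show "z \<in> carrier H" by (rule z)
    show "z \<otimes>\<^bsub>H\<^esub> x = x \<otimes>\<^bsub>H\<^esub> z" if "x \<in> carrier H" for x by (rule central[OF that])
    show "n = 0" if n: "z [^]\<^bsub>H\<^esub> n = \<one>\<^bsub>H\<^esub>" for n :: int
    proof (rule ccontr)
      assume n0: "n \<noteq> 0"
      have "z [^]\<^bsub>H\<^esub> (int (nat \<bar>n\<bar>)) = \<one>\<^bsub>H\<^esub>"
        using n int_pow_neg[OF z, of n] by (cases "0 \<le> n") simp_all
      then have "z [^]\<^bsub>H\<^esub> (nat \<bar>n\<bar>) = \<one>\<^bsub>H\<^esub>" by (simp only: int_pow_int)
      then have "z = \<one>\<^bsub>H\<^esub>" using tf z n0 unfolding torsion_free_def by (meson zero_less_abs_iff zero_less_nat_eq)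
      then have "generate H {z} = {\<one>\<^bsub>H\<^esub>}" using generate_one by simp
      then show False using lc1 lc1_ne by simp
    qed
    show "\<exists>n::int. x \<otimes>\<^bsub>H\<^esub> y = y \<otimes>\<^bsub>H\<^esub> x \<otimes>\<^bsub>H\<^esub> z [^]\<^bsub>H\<^esub> n" if x: "x \<in> carrier H" and y: "y \<in> carrier H" for x y
    proof -
      have "x \<otimes>\<^bsub>H\<^esub> y \<otimes>\<^bsub>H\<^esub> inv\<^bsub>H\<^esub> x \<otimes>\<^bsub>H\<^esub> inv\<^bsub>H\<^esub> y \<in> generate H {z}"
        using comm_in[of x 0 y] x y lc1 by simp
      then obtain n :: int where n: "x \<otimes>\<^bsub>H\<^esub> y \<otimes>\<^bsub>H\<^esub> inv\<^bsub>H\<^esub> x \<otimes>\<^bsub>H\<^esub> inv\<^bsub>H\<^esub> y = z [^]\<^bsub>H\<^esub> n"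
        unfolding generate_pow[OF z] by blast
      have "z [^]\<^bsub>H\<^esub> n \<otimes>\<^bsub>H\<^esub> (y \<otimes>\<^bsub>H\<^esub> x) = (y \<otimes>\<^bsub>H\<^esub> x) \<otimes>\<^bsub>H\<^esub> z [^]\<^bsub>H\<^esub> n"
      proof -
        have c: "(y \<otimes>\<^bsub>H\<^esub> x) \<otimes>\<^bsub>H\<^esub> z = z \<otimes>\<^bsub>H\<^esub> (y \<otimes>\<^bsub>H\<^esub> x)" using central x y by simp
        have "z [^]\<^bsub>H\<^esub> n \<in> generate H {z}" unfolding generate_pow[OF z] by blast
        then have "z [^]\<^bsub>H\<^esub> n \<in> lower_central H (Suc 0)" using lc1 by simp
        then have "z [^]\<^bsub>H\<^esub> n \<otimes>\<^bsub>H\<^esub> (y \<otimes>\<^bsub>H\<^esub> x) \<otimes>\<^bsub>H\<^esub> inv\<^bsub>H\<^esub> (z [^]\<^bsub>H\<^esub> n) \<otimes>\<^bsub>H\<^esub> inv\<^bsub>H\<^esub> (y \<otimes>\<^bsub>H\<^esub> x) = \<one>\<^bsub>H\<^esub>"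
          using comm_in[of _ "Suc 0" "y \<otimes>\<^bsub>H\<^esub> x"] x y unfolding lc2 by blast
        then show ?thesis using undo[of "z [^]\<^bsub>H\<^esub> n" "y \<otimes>\<^bsub>H\<^esub> x"] x y z by simp
      qed
      then show ?thesis using undo[OF x y] n by (intro exI[of _ n]) simp
    qed
    show "\<exists>x\<in>carrier H. \<exists>y\<in>carrier H. x \<otimes>\<^bsub>H\<^esub> y \<noteq> y \<otimes>\<^bsub>H\<^esub> x"
    proof (rule ccontr)
      assume "\<not> ?thesis"
      then have ab: "x \<otimes>\<^bsub>H\<^esub> y = y \<otimes>\<^bsub>H\<^esub> x" if "x \<in> carrier H" "y \<in> carrier H" for x y using that by blast
      have one: "x \<otimes>\<^bsub>H\<^esub> y \<otimes>\<^bsub>H\<^esub> inv\<^bsub>H\<^esub> x \<otimes>\<^bsub>H\<^esub> inv\<^bsub>H\<^esub> y = \<one>\<^bsub>H\<^esub>" if "x \<in> carrier H" "y \<in> carrier H" for x y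
        using that ab[of x y] by (simp add: m_assoc)
      have "lower_central H (Suc 0) \<subseteq> {\<one>\<^bsub>H\<^esub>}"
        unfolding lower_central.simps
        by (rule generate_subgroup_incl[OF _ triv_subgroup]) (use one in auto)
      moreover have "\<one>\<^bsub>H\<^esub> \<in> lower_central H (Suc 0)"
        unfolding lower_central.simps(2) by (rule generate.one)
      ultimately show False using lc1_ne by blast
    qed
  qed
qed

theorem theorem2p7:
  fixes H :: "('a, 'b) monoid_scheme" and S :: "'a set" and z :: 'a
  assumes "group H"
    and "torsion_free H"
    and "nilpotent_of_step H 2"
    and "z \<in> carrier H"
    and "derived H (carrier H) = generate H {z}"
    and "H\<lparr>carrier := generate H {z}\<rparr> \<cong> integer_group"
    and "fin_sym_generating_set H S"
  shows
    "(\<forall>(V :: 'v::real_normed_vector set) br j (Pr :: 'v \<Rightarrow> 'w::real_vector) \<gamma>1 \<gamma>2.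
        malcev_completion H V br j \<and> abelianization_map V br Pr \<and>
        \<gamma>1 \<in> Geo H S \<and> \<gamma>2 \<in> Geo H S \<longrightarrow>
        (busemann H S \<gamma>1 = busemann H S \<gamma>2 \<longrightarrow>
           F_face S j Pr \<gamma>1 = F_face S j Pr \<gamma>2 \<and>
           (commutative_face V br Pr (F_face S j Pr \<gamma>1) \<longrightarrow> E_face S j \<gamma>1 = E_face S j \<gamma>2)) \<and>
        (F_face S j Pr \<gamma>1 = F_face S j Pr \<gamma>2 \<and>
         ((commutative_face V br Pr (F_face S j Pr \<gamma>1) \<and>
           E_face S j \<gamma>1 = E_face S j \<gamma>2 \<and>
           (\<forall>n. j (\<gamma>1 n) \<in> E_face S j \<gamma>1 \<and> j (\<gamma>2 n) \<in> E_face S j \<gamma>1)) \<or>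
          (\<not> commutative_face V br Pr (F_face S j Pr \<gamma>1) \<and>
           (\<forall>n. Pr (j (\<gamma>1 n)) \<in> F_face S j Pr \<gamma>1 \<and> Pr (j (\<gamma>2 n)) \<in> F_face S j Pr \<gamma>1))) \<longrightarrow>
         busemann H S \<gamma>1 = busemann H S \<gamma>2) \<and>
        (orbit H (horo_action H) (busemann H S \<gamma>1) = orbit H (horo_action H) (busemann H S \<gamma>2) \<longleftrightarrow>
           (F_face S j Pr \<gamma>1 = F_face S j Pr \<gamma>2 \<and>
            commutative_face V br Pr (F_face S j Pr \<gamma>1) \<and> E_face S j \<gamma>1 = E_face S j \<gamma>2) \<or>
           (F_face S j Pr \<gamma>1 = F_face S j Pr \<gamma>2 \<and>
            \<not> commutative_face V br Pr (F_face S j Pr \<gamma>1)))) \<and>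
     finite (orbits H (busemann_points H S) (horo_action H)) \<and>
     countable (busemann_points H S)"
proof -
  interpret two_step_group H S z
    by (rule two_step_group_of_nilpotent) fact+
  have faces: "(busemann H S \<gamma>1 = busemann H S \<gamma>2 \<longrightarrow>
           F_face S j Pr \<gamma>1 = F_face S j Pr \<gamma>2 \<and>
           (commutative_face V br Pr (F_face S j Pr \<gamma>1) \<longrightarrow> E_face S j \<gamma>1 = E_face S j \<gamma>2)) \<and>
        (F_face S j Pr \<gamma>1 = F_face S j Pr \<gamma>2 \<and>
         ((commutative_face V br Pr (F_face S j Pr \<gamma>1) \<and>
           E_face S j \<gamma>1 = E_face S j \<gamma>2 \<and>
           (\<forall>n. j (\<gamma>1 n) \<in> E_face S j \<gamma>1 \<and> j (\<gamma>2 n) \<in> E_face S j \<gamma>1)) \<or>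
          (\<not> commutative_face V br Pr (F_face S j Pr \<gamma>1) \<and>
           (\<forall>n. Pr (j (\<gamma>1 n)) \<in> F_face S j Pr \<gamma>1 \<and> Pr (j (\<gamma>2 n)) \<in> F_face S j Pr \<gamma>1))) \<longrightarrow>
         busemann H S \<gamma>1 = busemann H S \<gamma>2) \<and>
        (orbit H (horo_action H) (busemann H S \<gamma>1) = orbit H (horo_action H) (busemann H S \<gamma>2) \<longleftrightarrow>
           (F_face S j Pr \<gamma>1 = F_face S j Pr \<gamma>2 \<and>
            commutative_face V br Pr (F_face S j Pr \<gamma>1) \<and> E_face S j \<gamma>1 = E_face S j \<gamma>2) \<or>
           (F_face S j Pr \<gamma>1 = F_face S j Pr \<gamma>2 \<and>
            \<not> commutative_face V br Pr (F_face S j Pr \<gamma>1)))"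
    if "malcev_completion H V br j" "abelianization_map V br Pr" and g: "\<gamma>1 \<in> Geo H S" "\<gamma>2 \<in> Geo H S"
    for V :: "'v set" and br j and Pr :: "'v \<Rightarrow> 'w" and \<gamma>1 \<gamma>2
  proof -
    interpret malcev H S z V br j Pr by unfold_locales (rule that)+
    let ?F = "F_face S j Pr \<gamma>1 = F_face S j Pr \<gamma>2" and ?E = "E_face S j \<gamma>1 = E_face S j \<gamma>2"
    let ?C = "commutative_face V br Pr (F_face S j Pr \<gamma>1)"
    \<comment> \<open>The two alternatives of the orbit criterion, distinguished by
      \<open>?C\<close>, merge into this single condition.\<close>
    have orbit: "same_orbit \<gamma>1 \<gamma>2 \<longleftrightarrow> ?F \<and> (?C \<longrightarrow> ?E)"
    proof
      assume o: "same_orbit \<gamma>1 \<gamma>2"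
      show "?F \<and> (?C \<longrightarrow> ?E)"
        by (intro conjI impI same_orbit_imp_F_face_eq[OF g o] same_orbit_imp_E_face_eq[OF g o])
    next
      assume "?F \<and> (?C \<longrightarrow> ?E)"
      then show "same_orbit \<gamma>1 \<gamma>2" by (intro faces_eq_imp_same_orbit[OF g]) simp_all
    qed
    show ?thesis
    proof (intro conjI impI)
      assume "busemann H S \<gamma>1 = busemann H S \<gamma>2"
      then have o: "same_orbit \<gamma>1 \<gamma>2"
        unfolding busemann_eq_iff[OF g] by (intro same_orbit_refl) (rule bspec)
      show ?F by (rule same_orbit_imp_F_face_eq[OF g o])
      show ?E if ?C by (rule same_orbit_imp_E_face_eq[OF g o that])
    next
      assume a: "?F \<and> ((?C \<and> ?E \<and> (\<forall>n. j (\<gamma>1 n) \<in> E_face S j \<gamma>1 \<and> j (\<gamma>2 n) \<in> E_face S j \<gamma>1)) \<or>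
        (\<not> ?C \<and> (\<forall>n. Pr (j (\<gamma>1 n)) \<in> F_face S j Pr \<gamma>1 \<and> Pr (j (\<gamma>2 n)) \<in> F_face S j Pr \<gamma>1)))"
      show "busemann H S \<gamma>1 = busemann H S \<gamma>2"
      proof (cases ?C)
        case True
        show ?thesis by (rule busemann_eq_commutative[OF g _ True]) (use a True in blast)+
      next
        case False
        show ?thesis by (rule busemann_eq_noncommutative[OF g _ False]) (use a False in blast)+
      qed
    next
      show "orbit H (horo_action H) (busemann H S \<gamma>1) = orbit H (horo_action H) (busemann H S \<gamma>2) \<longleftrightarrow>
          (?F \<and> ?C \<and> ?E) \<or> (?F \<and> \<not> ?C)"
        unfolding orbit_eq_iff_same_orbit[OF g] orbit by (cases ?C) simp_all
    qed
  qed
  show ?thesis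
    by (rule conjI[OF _ conjI[OF finite_busemann_orbits countable_busemann_points]],
        intro allI impI, elim conjE, rule faces)
qed

end
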